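(* Let $K$ be a compact Hausdorff space and let $\mathcal{S}\subset\mathcal{L}(C(K))$ be a right amenable semigroup of Markov operators. The fixed space $\mathrm{fix}(\mathcal{S}_{\mathrm{rad}_{\mathcal{S}}(0)})$ is a Banach sublattice of $C(M(\mathcal{S}))$ and the mapping $$\hat{\ }\colon \mathrm{fix}(\mathcal{S}_{\mathrm{rad}_{\mathcal{S}}(0)})\to C(\mathrm{Prim}(\mathcal{S})),\quad f\mapsto\hat f,$$ where $\hat f(I_\mu)=\int_{M(\mathcal{S})}f\,d\mu$ for every ergodic $\mu\in P_{\mathcal{S}}(K)$, is an isometric Markov lattice isomorphism.
   Context: $C(K)$ is the Banach lattice of continuous complex-valued functions on $K$; its dual $C(K)'$ is identified with the complex regular Borel measures on $K$, with $\langle f,\mu\rangle=\int_K f\,d\mu$. $\mathcal{L}(C(K))$ denotes the bounded linear operators on $C(K)$; $T\in\mathcal{L}(C(K))$ is Markov if it is positive and $T\mathbf{1}=\mathbf{1}$. A semigroup $\mathcal{S}\subset\mathcal{L}(C(K))$ (under composition, with the strong operator topology) is right amenable if there is a positive $m\in C_b(\mathcal{S})'$ with $m(\mathbf{1})=1$ and $m(R_Sf)=m(f)$ for all $f\in C_b(\mathcal{S})$, $S\in\mathcal{S}$, where $(R_Sf)(T)=f(TS)$. For a semigroup of operators, $\mathrm{fix}$ denotes its common fixed space. $P_{\mathcal{S}}(K)$ is the set of probability measures $\mu\in C(K)'$ with $S'\mu=\mu$ for all $S\in\mathcal{S}$. For $\mu\in P_{\mathcal{S}}(K)$, let $I_\mu=\{f\in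 C(K): \langle |f|,\mu\rangle=0\}$; every $S\in\mathcal{S}$ induces (uniquely, by continuous extension) a bounded operator $S_\mu$ on $L^1(K,\mu)$, and $\mu$ is ergodic if the common fixed space of all $S_\mu$ ($S\in\mathcal{S}$) in $L^1(K,\mu)$ is one-dimensional. $\mathrm{Prim}(\mathcal{S})=\{I_\mu: \mu\in P_{\mathcal{S}}(K)\text{ ergodic}\}$ is the primitive spectrum, equipped with the hull-kernel topology: the closure of $A\subset\mathrm{Prim}(\mathcal{S})$ is $\{q\in\mathrm{Prim}(\mathcal{S}):\bigcap_{p\in A}p\subset q\}$ (the empty intersection being $C(K)$). This space is quasi-compact, and $C(\mathrm{Prim}(\mathcal{S}))$ is the Banach lattice of continuous complex-valued functions on it with the sup norm. $\mathrm{rad}_{\mathcal{S}}(0)=\bigcap_{p\in\mathrm{Prim}(\mathcal{S})}p$, and $M(\mathcal{S})$ is its support, i.e. the closed set with $\mathrm{rad}_{\mathcal{S}}(0)=\{f\in C(K): f|_{M(\mathcal{S})}=0\}$; equivalently, the closure of the union of the supports of all ergodic measures in $P_{\mathcal{S}}(K)$. $\mathcal{S}_{\mathrm{rad}_{\mathcal{S}}(0)}$ is the semigroup of Markov operators on $C(M(\mathcal{S}))$ induced by $\mathcal{S}$: each $S\in\mathcal{S}$ induces $f\mapsto (SF)|_{M(\mathcal{S})}$, where $F\in C(K)$ is any extension of $f\in C(M(\mathcal{S}))$. For $f\in\mathrm{fix}(\mathcal{S}_{\mathrm{rad}_{\mathcal{S}}(0)})$ the value $\int_{M(\mathcal{S})}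 f\,d\mu$ ($\mu$ ergodic) depends only on $I_\mu$, so $\hat f$ is well defined, and $\hat f$ is continuous. "Markov lattice isomorphism" means a bijective linear lattice homomorphism mapping $\mathbf{1}$ to $\mathbf{1}$. *)

theory Defs
  imports "HOL-Probability.Probability"
begin

section \<open>Spaces of continuous functions\<close>

text \<open>Functions on a space are extended by 0 off the carrier, so that equality of elements of
  \<open>C(X)\<close> is equality of HOL functions and pointwise operations stay inside \<open>C(X)\<close>.\<close>

definition Cfun :: "'b topology \<Rightarrow> ('b \<Rightarrow> complex) set" where
  "Cfun X = {f. continuous_map X euclidean f \<and> (\<forall>x. x \<notin> topspace X \<longrightarrow> f x = 0)}"

definition Cbfun :: "'b topology \<Rightarrow> ('b \<Rightarrow> complex) set" where
  "Cbfun X = {f \<in> Cfun X. bounded (f ` topspace X)}"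

abbreviation one_on :: "'b topology \<Rightarrow> 'b \<Rightarrow> complex" where
  "one_on X \<equiv> indicator (topspace X)"

text \<open>The inserted 0 only matters for the empty space.\<close>

definition supnorm :: "'b topology \<Rightarrow> ('b \<Rightarrow> complex) \<Rightarrow> real" where
  "supnorm X f = Sup (insert 0 ((\<lambda>x. cmod (f x)) ` topspace X))"

definition modulus :: "('b \<Rightarrow> complex) \<Rightarrow> 'b \<Rightarrow> complex" where
  "modulus f = (\<lambda>x. complex_of_real (cmod (f x)))"

definition nonneg_fun :: "('b \<Rightarrow> complex) \<Rightarrow> bool" where
  "nonneg_fun f \<longleftrightarrow> (\<forall>x. f x \<in> \<real>\<^sub>\<ge>\<^sub>0)"

definition clinear_subspace :: "('b \<Rightarrow> complex) set \<Rightarrow> bool" where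
  "clinear_subspace V \<longleftrightarrow> (\<lambda>x. 0) \<in> V
     \<and> (\<forall>f\<in>V. \<forall>g\<in>V. (\<lambda>x. f x + g x) \<in> V)
     \<and> (\<forall>c. \<forall>f\<in>V. (\<lambda>x. c * f x) \<in> V)"

definition clinear_op_on ::
  "('b \<Rightarrow> complex) set \<Rightarrow> (('b \<Rightarrow> complex) \<Rightarrow> 'c \<Rightarrow> complex) \<Rightarrow> bool" where
  "clinear_op_on V T \<longleftrightarrow>
     (\<forall>f\<in>V. \<forall>g\<in>V. T (\<lambda>x. f x + g x) = (\<lambda>y. T f y + T g y))
   \<and> (\<forall>c. \<forall>f\<in>V. T (\<lambda>x. c * f x) = (\<lambda>y. c * T f y))"

text \<open>As \<open>C(X)\<close> is a complex Banach lattice, a sublattice is required to be closed under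
  conjugation and modulus; suprema and infima of real elements are then obtained from
  the modulus. A closed subspace of the Banach space \<open>C(X)\<close> is complete.\<close>

definition banach_sublattice :: "'b topology \<Rightarrow> ('b \<Rightarrow> complex) set \<Rightarrow> bool" where
  "banach_sublattice X F \<longleftrightarrow> F \<subseteq> Cfun X \<and> clinear_subspace F
     \<and> (\<forall>f\<in>F. (\<lambda>x. cnj (f x)) \<in> F) \<and> (\<forall>f\<in>F. modulus f \<in> F)
     \<and> (\<forall>h f. (\<forall>n::nat. h n \<in> F) \<and> f \<in> Cfun X
          \<and> (\<lambda>n. supnorm X (\<lambda>x. h n x - f x)) \<longlonglongrightarrow> 0 \<longrightarrow> f \<in> F)"

definition markov_lattice_iso ::
  "'b topology \<Rightarrow> ('b \<Rightarrow> complex) set \<Rightarrow> 'c topology \<Rightarrow>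
   (('b \<Rightarrow> complex) \<Rightarrow> 'c \<Rightarrow> complex) \<Rightarrow> bool" where
  "markov_lattice_iso X F Y \<Phi> \<longleftrightarrow> bij_betw \<Phi> F (Cfun Y) \<and> clinear_op_on F \<Phi>
     \<and> (\<forall>f\<in>F. \<Phi> (modulus f) = modulus (\<Phi> f))
     \<and> one_on X \<in> F \<and> \<Phi> (one_on X) = one_on Y"


section \<open>Semigroups of Markov operators\<close>

type_synonym 'a oper = "('a \<Rightarrow> complex) \<Rightarrow> 'a \<Rightarrow> complex"

text \<open>Operators are set to 0 off \<open>C(K)\<close>; this convention is preserved by composition.\<close>

definition bounded_ops :: "'a topology \<Rightarrow> 'a oper set" where
  "bounded_ops K = {T. (\<forall>f\<in>Cfun K. T f \<in> Cfun K) \<and> (\<forall>f. f \<notin> Cfun K \<longrightarrow> T f = (\<lambda>x. 0))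
     \<and> clinear_op_on (Cfun K) T
     \<and> (\<exists>B. \<forall>f\<in>Cfun K. supnorm K (T f) \<le> B * supnorm K f)}"

definition markov_op :: "'a topology \<Rightarrow> 'a oper \<Rightarrow> bool" where
  "markov_op K T \<longleftrightarrow> T \<in> bounded_ops K
     \<and> (\<forall>f\<in>Cfun K. nonneg_fun f \<longrightarrow> nonneg_fun (T f)) \<and> T (one_on K) = one_on K"

definition markov_semigroup :: "'a topology \<Rightarrow> 'a oper set \<Rightarrow> bool" where
  "markov_semigroup K \<S> \<longleftrightarrow> (\<forall>S\<in>\<S>. markov_op K S) \<and> (\<forall>S\<in>\<S>. \<forall>T\<in>\<S>. S \<circ> T \<in> \<S>)"

definition strong_op_topology :: "'a topology \<Rightarrow> 'a oper topology" where
  "strong_op_topology K = topology_generated_by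
     {{T \<in> bounded_ops K. supnorm K (\<lambda>x. T f x - T0 f x) < e} | f T0 e.
        f \<in> Cfun K \<and> T0 \<in> bounded_ops K \<and> e > 0}"

definition right_translate ::
  "'a oper set \<Rightarrow> 'a oper \<Rightarrow> ('a oper \<Rightarrow> complex) \<Rightarrow> 'a oper \<Rightarrow> complex" where
  "right_translate \<S> S f = (\<lambda>T. if T \<in> \<S> then f (T \<circ> S) else 0)"

definition right_amenable :: "'a topology \<Rightarrow> 'a oper set \<Rightarrow> bool" where
  "right_amenable K \<S> \<longleftrightarrow>
    (let X = subtopology (strong_op_topology K) \<S> in
     \<exists>m :: ('a oper \<Rightarrow> complex) \<Rightarrow> complex.
       (\<forall>f\<in>Cbfun X. \<forall>g\<in>Cbfun X. m (\<lambda>T. f T + g T) = m f + m g)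
     \<and> (\<forall>c. \<forall>f\<in>Cbfun X. m (\<lambda>T. c * f T) = c * m f)
     \<and> (\<exists>B. \<forall>f\<in>Cbfun X. cmod (m f) \<le> B * supnorm X f)
     \<and> (\<forall>f\<in>Cbfun X. nonneg_fun f \<longrightarrow> m f \<in> \<real>\<^sub>\<ge>\<^sub>0)
     \<and> m (one_on X) = 1
     \<and> (\<forall>f\<in>Cbfun X. \<forall>S\<in>\<S>. m (right_translate \<S> S f) = m f))"

definition fixspace :: "('b \<Rightarrow> complex) set \<Rightarrow> 'b oper set \<Rightarrow> ('b \<Rightarrow> complex) set" where
  "fixspace V \<T> = {f \<in> V. \<forall>T\<in>\<T>. T f = f}"


section \<open>Invariant and ergodic measures\<close>

definition regular_prob_measure :: "'a topology \<Rightarrow> 'a measure \<Rightarrow> bool" where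
  "regular_prob_measure K \<mu> \<longleftrightarrow> prob_space \<mu> \<and> space \<mu> = topspace K
     \<and> sets \<mu> = sigma_sets (topspace K) {U. openin K U}
     \<and> (\<forall>A\<in>sets \<mu>. emeasure \<mu> A = (SUP C\<in>{C. compactin K C \<and> C \<subseteq> A}. emeasure \<mu> C))
     \<and> (\<forall>A\<in>sets \<mu>. emeasure \<mu> A = (INF U\<in>{U. openin K U \<and> A \<subseteq> U}. emeasure \<mu> U))"

text \<open>The invariance condition is \<open>S'\<mu> = \<mu>\<close> under the identification of
  \<open>C(K)'\<close> with the regular Borel measures.\<close>

definition inv_prob :: "'a topology \<Rightarrow> 'a oper set \<Rightarrow> 'a measure set" where
  "inv_prob K \<S> = {\<mu>. regular_prob_measure K \<mu>
     \<and> (\<forall>S\<in>\<S>. \<forall>f\<in>Cfun K. integral\<^sup>L \<mu> (S f) = integral\<^sup>L \<mu> f)}"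

definition null_ideal :: "'a topology \<Rightarrow> 'a measure \<Rightarrow> ('a \<Rightarrow> complex) set" where
  "null_ideal K \<mu> = {f \<in> Cfun K. (\<integral>x. cmod (f x) \<partial>\<mu>) = 0}"

text \<open>Elements of \<open>L\<^sup>1(K,\<mu>)\<close> are represented by integrable functions, equality being equality
  almost everywhere. The induced operator is the extension of \<open>S\<close> by continuity from the
  \<open>L\<^sup>1\<close>-dense subspace \<open>C(K)\<close>: the value at \<open>f\<close> is the \<open>L\<^sup>1\<close>-limit of \<open>S h\<^sub>n\<close> for \<open>h\<^sub>n\<close> in
  \<open>C(K)\<close> tending to \<open>f\<close>. For invariant \<open>\<mu>\<close> one has \<open>\<integral>|S h| d\<mu> \<le> \<integral>|h| d\<mu>\<close> on \<open>C(K)\<close>, so this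
  limit exists and is unique almost everywhere.\<close>

definition L1_ext :: "'a topology \<Rightarrow> 'a measure \<Rightarrow> 'a oper \<Rightarrow> 'a oper" where
  "L1_ext K \<mu> S f = (SOME g. integrable \<mu> g \<and>
     (\<exists>h. (\<forall>n::nat. h n \<in> Cfun K)
        \<and> (\<lambda>n. \<integral>x. cmod (h n x - f x) \<partial>\<mu>) \<longlonglongrightarrow> 0
        \<and> (\<lambda>n. \<integral>x. cmod (S (h n) x - g x) \<partial>\<mu>) \<longlonglongrightarrow> 0))"

definition L1_fix :: "'a topology \<Rightarrow> 'a oper set \<Rightarrow> 'a measure \<Rightarrow> ('a \<Rightarrow> complex) set" where
  "L1_fix K \<S> \<mu> = {f. integrable \<mu> f \<and> (\<forall>S\<in>\<S>. AE x in \<mu>. L1_ext K \<mu> S f x = f x)}"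

text \<open>The second condition says that the fixed space, modulo null functions, is
  one-dimensional.\<close>

definition ergodic_measures :: "'a topology \<Rightarrow> 'a oper set \<Rightarrow> 'a measure set" where
  "ergodic_measures K \<S> = {\<mu> \<in> inv_prob K \<S>.
     \<exists>f\<in>L1_fix K \<S> \<mu>. \<not> (AE x in \<mu>. f x = 0)
       \<and> (\<forall>g\<in>L1_fix K \<S> \<mu>. \<exists>c. AE x in \<mu>. g x = c * f x)}"


section \<open>Primitive spectrum\<close>

definition Prim :: "'a topology \<Rightarrow> 'a oper set \<Rightarrow> ('a \<Rightarrow> complex) set set" where
  "Prim K \<S> = null_ideal K ` ergodic_measures K \<S>"

text \<open>Intersection of a family of ideals; \<open>C(K)\<close> for the empty family.\<close>

definition ker :: "'a topology \<Rightarrow> ('a \<Rightarrow> complex) set set \<Rightarrow> ('a \<Rightarrow> complex) set" where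
  "ker K A = {f \<in> Cfun K. \<forall>p\<in>A. f \<in> p}"

definition hk_closure ::
  "'a topology \<Rightarrow> 'a oper set \<Rightarrow> ('a \<Rightarrow> complex) set set \<Rightarrow> ('a \<Rightarrow> complex) set set" where
  "hk_closure K \<S> A = {q \<in> Prim K \<S>. ker K A \<subseteq> q}"

text \<open>The topology whose closure operator is \<open>hk_closure\<close>. That \<open>hk_closure\<close> commutes with finite
  unions (so that this is indeed a topology) is a property of ergodic measures: an
  \<open>\<S>\<close>-invariant open set of the form \<open>{x. \<exists>f\<in>I. f x \<noteq> 0}\<close>, with \<open>I\<close> an invariant
  ideal, has measure 0 or 1.\<close>

definition prim_topology :: "'a topology \<Rightarrow> 'a oper set \<Rightarrow> ('a \<Rightarrow> complex) set topology" where
  "prim_topology K \<S> = topology (\<lambda>U. U \<subseteq> Prim K \<S>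
     \<and> hk_closure K \<S> (Prim K \<S> - U) = Prim K \<S> - U)"

definition rad :: "'a topology \<Rightarrow> 'a oper set \<Rightarrow> ('a \<Rightarrow> complex) set" where
  "rad K \<S> = ker K (Prim K \<S>)"

definition Msupp :: "'a topology \<Rightarrow> 'a oper set \<Rightarrow> 'a set" where
  "Msupp K \<S> = (THE M. closedin K M \<and> rad K \<S> = {f \<in> Cfun K. \<forall>x\<in>M. f x = 0})"

abbreviation Mtop :: "'a topology \<Rightarrow> 'a oper set \<Rightarrow> 'a topology" where
  "Mtop K \<S> \<equiv> subtopology K (Msupp K \<S>)"

text \<open>The choice of the extension \<open>F\<close> is immaterial when the functions vanishing on \<open>M\<close> form
  an ideal invariant under \<open>S\<close>.\<close>

definition induced_op :: "'a topology \<Rightarrow> 'a set \<Rightarrow> 'a oper \<Rightarrow> 'a oper" where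
  "induced_op K M S = (\<lambda>f. if f \<in> Cfun (subtopology K M)
     then (let F = (SOME F. F \<in> Cfun K \<and> (\<forall>x\<in>M. F x = f x))
           in (\<lambda>x. if x \<in> M then S F x else 0))
     else (\<lambda>x. 0))"

definition rad_semigroup :: "'a topology \<Rightarrow> 'a oper set \<Rightarrow> 'a oper set" where
  "rad_semigroup K \<S> = induced_op K (Msupp K \<S>) ` \<S>"

definition rad_fix :: "'a topology \<Rightarrow> 'a oper set \<Rightarrow> ('a \<Rightarrow> complex) set" where
  "rad_fix K \<S> = fixspace (Cfun (Mtop K \<S>)) (rad_semigroup K \<S>)"

definition hat ::
  "'a topology \<Rightarrow> 'a oper set \<Rightarrow> ('a \<Rightarrow> complex) \<Rightarrow> ('a \<Rightarrow> complex) set \<Rightarrow> complex" where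
  "hat K \<S> f = (\<lambda>p. if p \<in> Prim K \<S>
     then (THE c. \<forall>\<mu>\<in>ergodic_measures K \<S>. null_ideal K \<mu> = p \<longrightarrow>
             set_lebesgue_integral \<mu> (Msupp K \<S>) f = c)
     else 0)"

end

theory Submission
  imports Defs
begin

text \<open>The fixed functions on \<open>M = M(\<S>)\<close> are exactly the continuous functions that are constant almost
  everywhere for every ergodic measure, and \<open>f\<close> corresponds to the function recording these constants.
  So the lattice properties are immediate, and isometry, injectivity and continuity follow by composing
  an extension of \<open>f\<close> to \<open>K\<close> with scalar functions and asking which ideals of the primitive spectrum
  contain the result.

  Surjectivity rests on one existence theorem: if all functions of an \<open>\<S>\<close>-invariant family vanish at a
  point \<open>x\<close>, then some ergodic measure annihilates the family. The mean applied to \<open>T \<mapsto> (T f)(x)\<close> is an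
  invariant state annihilating it; an extreme state with these properties is, by the Riesz
  representation theorem, a regular measure, and a fixed set of this measure that is neither null nor
  conull would decompose it. A continuous function on the primitive spectrum then
  yields zero sets of its sub- and superlevel sets which are disjoint for separated levels, and these
  determine a continuous function on \<open>M\<close>.\<close>

section \<open>The Riesz representation theorem on a compact Hausdorff space\<close>

text \<open>Markov operators are positive but need not be lattice homomorphisms, and
  \<open>L1_ext\<close> only chooses a representative. Fixedness in L1 is therefore handled by
  approximation: \<open>f\<close> is fixed by \<open>S\<close> exactly when, for every tolerance,
  some continuous \<open>h\<close> has both \<open>h\<close> and \<open>S h\<close> within that
  tolerance of \<open>f\<close>. Closure of the fixed functions under modulus and limits then
  becomes an epsilon argument.

  As \<open>K\<close> may be nonmetrisable, the ideals involved are in effect uncountable families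
  of null functions. Their common zero set is nevertheless conull, because the measures are regular.

  The family annihilated by an ergodic measure may be a union of several kernels. One measure is
  thereby placed in several hull-kernel closed sets at once, and this separates level sets without
  any separation property of the primitive spectrum.

  Extremality is meant within the invariant states annihilating the family. This is enough for
  ergodicity, since the restrictions of the measure to subsets annihilate the family as
  well.\<close>

definition state :: "'a topology \<Rightarrow> (('a \<Rightarrow> real) \<Rightarrow> real) \<Rightarrow> bool" where
  "state K L \<longleftrightarrow>
     (\<forall>f g. continuous_map K euclideanreal f \<longrightarrow> continuous_map K euclideanreal g \<longrightarrow>
        L (\<lambda>x. f x + g x) = L f + L g)
   \<and> (\<forall>c f. continuous_map K euclideanreal f \<longrightarrow> L (\<lambda>x. c * f x) = c * L f)
   \<and> (\<forall>f. continuous_map K euclideanreal f \<longrightarrow> (\<forall>x\<in>topspace K. 0 \<le> f x) \<longrightarrow> 0 \<le> L f)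
   \<and> L (\<lambda>x. 1) = 1"

lemma continuous_map_borel_measurable:
  fixes f :: "'a \<Rightarrow> 'b::topological_space"
  assumes f: "continuous_map K euclidean f"
    and "space \<mu> = topspace K" "sets \<mu> = sigma_sets (topspace K) {U. openin K U}"
  shows "f \<in> borel_measurable \<mu>"
proof (rule borel_measurableI)
  fix S :: "'b set" assume "open S"
  then have "openin K {x \<in> topspace K. f x \<in> S}"
    using openin_continuous_map_preimage[OF f, of S] by simp
  moreover have "{x \<in> topspace K. f x \<in> S} = f -` S \<inter> space \<mu>" using assms by auto
  ultimately show "f -` S \<inter> space \<mu> \<in> sets \<mu>"
    using assms by (simp add: sigma_sets.Basic)
qed

locale compact_hausdorff =
  fixes K :: "'a topology"
  assumes compact: "compact_space K" and hausdorff: "Hausdorff_space K"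
begin

abbreviation cont :: "('a \<Rightarrow> real) \<Rightarrow> bool" where
  "cont \<equiv> continuous_map K euclideanreal"

lemma normal: "normal_space K"
  using compact hausdorff compact_Hausdorff_or_regular_imp_normal_space by blast

lemma closedin_iff_compactin: "closedin K C \<longleftrightarrow> compactin K C"
  using closedin_compact_space compactin_imp_closedin compact hausdorff by blast

lemma urysohn:
  assumes "closedin K S" "closedin K T" "S \<inter> T = {}"
  obtains u where "cont u" "\<And>x. x \<in> S \<Longrightarrow> u x = 0" "\<And>x. x \<in> T \<Longrightarrow> u x = 1"
    "\<And>x. x \<in> topspace K \<Longrightarrow> 0 \<le> u x \<and> u x \<le> 1"
proof -
  obtain f where f: "continuous_map K (top_of_set {0..1::real}) f" "f ` S \<subseteq> {0}" "f ` T \<subseteq> {1}"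
    using Urysohn_lemma[OF normal assms(1,2), of 0 1] assms(3) by (auto simp: disjnt_def)
  show thesis
  proof
    show "cont f" using f(1) by (auto simp: continuous_map_in_subtopology)
    show "0 \<le> f x \<and> f x \<le> 1" if "x \<in> topspace K" for x
      using f(1) that by (auto simp: continuous_map_in_subtopology)
  qed (use f in auto)
qed

lemma cont_bounded:
  assumes "cont f"
  obtains B where "B > 0" "\<And>x. x \<in> topspace K \<Longrightarrow> \<bar>f x\<bar> \<le> B"
proof -
  have "compact (f ` topspace K)"
    using image_compactin[OF _ assms, of "topspace K"] compact by (simp add: compact_space_def)
  then have "bounded (f ` topspace K)" by (rule compact_imp_bounded)
  then obtain B where "\<And>x. x \<in> topspace K \<Longrightarrow> \<bar>f x\<bar> \<le> B" unfolding bounded_iff by auto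
  then show thesis by (intro that[of "max B 1"]) (auto simp: le_max_iff_disj)
qed

lemma closedin_superlevel: "cont f \<Longrightarrow> closedin K {x \<in> topspace K. e \<le> f x}"
  using closedin_continuous_map_preimage[of K euclideanreal f "{e..}"] by auto

lemma openin_superlevel: "cont f \<Longrightarrow> openin K {x \<in> topspace K. e < f x}"
  using openin_continuous_map_preimage[of K euclideanreal f "{e<..}"] by auto

end

locale compact_state = compact_hausdorff +
  fixes L :: "('a \<Rightarrow> real) \<Rightarrow> real"
  assumes state: "state K L"
begin

lemma L_add: "cont f \<Longrightarrow> cont g \<Longrightarrow> L (\<lambda>x. f x + g x) = L f + L g"
  and L_scale: "cont f \<Longrightarrow> L (\<lambda>x. c * f x) = c * L f"
  and L_pos: "cont f \<Longrightarrow> (\<And>x. x \<in> topspace K \<Longrightarrow> 0 \<le> f x) \<Longrightarrow> 0 \<le> L f"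
  and L_one: "L (\<lambda>x. 1) = 1"
  using state unfolding state_def by blast+

lemma L_const: "L (\<lambda>x. c) = c"
  using L_scale[of "\<lambda>x. 1" c] by (simp add: L_one)

lemma L_minus: "cont f \<Longrightarrow> L (\<lambda>x. - f x) = - L f"
  using L_scale[of f "-1"] by simp

lemma L_diff: "cont f \<Longrightarrow> cont g \<Longrightarrow> L (\<lambda>x. f x - g x) = L f - L g"
  using L_add[of f "\<lambda>x. - g x"] by (simp add: L_minus)

lemma L_mono:
  assumes "cont f" "cont g" "\<And>x. x \<in> topspace K \<Longrightarrow> f x \<le> g x"
  shows "L f \<le> L g"
  using L_pos[of "\<lambda>x. g x - f x"] assms by (simp add: L_diff continuous_map_diff)

lemma L_sum:
  assumes "\<And>i. i \<in> I \<Longrightarrow> cont (f i)"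
  shows "L (\<lambda>x. \<Sum>i\<in>I. f i x) = (\<Sum>i\<in>I. L (f i))"
proof (cases "finite I")
  case True
  then show ?thesis using assms
  proof (induction I)
    case empty
    then show ?case by (simp add: L_const)
  next
    case (insert i I)
    then have "cont (\<lambda>x. \<Sum>i\<in>I. f i x)" by (intro continuous_map_sum) auto
    then show ?case using insert by (simp add: L_add)
  qed
qed (simp add: L_const)

section \<open>The content of open sets defined by test functions\<close>

definition testfun :: "'a set \<Rightarrow> ('a \<Rightarrow> real) \<Rightarrow> bool" where
  "testfun U f \<longleftrightarrow> cont f \<and> (\<forall>x\<in>topspace K. 0 \<le> f x \<and> f x \<le> 1) \<and> (\<forall>x\<in>topspace K - U. f x = 0)"

lemma testfunD: "testfun U f \<Longrightarrow> cont f" "testfun U f \<Longrightarrow> x \<in> topspace K \<Longrightarrow> 0 \<le> f x"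
  "testfun U f \<Longrightarrow> x \<in> topspace K \<Longrightarrow> f x \<le> 1" "testfun U f \<Longrightarrow> x \<in> topspace K \<Longrightarrow> x \<notin> U \<Longrightarrow> f x = 0"
  by (auto simp: testfun_def)

lemma testfun_0: "testfun U (\<lambda>x. 0)"
  by (auto simp: testfun_def)

lemma testfun_mono: "testfun U f \<Longrightarrow> U \<subseteq> V \<Longrightarrow> testfun V f"
  by (auto simp: testfun_def)

lemma testfun_L: "testfun U f \<Longrightarrow> 0 \<le> L f"
  by (intro L_pos) (auto dest: testfunD)

text \<open>Test functions only have to vanish off \<open>U\<close>. Truncation at \<open>e\<close>
  yields one that vanishes off a closed, hence compact, subset of \<open>U\<close>. The cost is at
  most \<open>e\<close>, because \<open>f\<close> lies below \<open>f' + e\<close> and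
  \<open>L\<close> maps constants to themselves.\<close>

lemma testfun_trunc:
  assumes "testfun U f" "0 < e"
  defines "f' \<equiv> \<lambda>x. max (f x - e) 0" and "C \<equiv> {x\<in>topspace K. e \<le> f x}"
  shows "testfun C f'" "closedin K C" "C \<subseteq> U" "L f \<le> L f' + e"
proof -
  have f: "cont f" using assms testfunD by blast
  have f': "cont f'" unfolding f'_def by (intro continuous_map_real_max continuous_map_diff f) auto
  show "testfun C f'"
    using f' assms by (auto simp: testfun_def f'_def C_def)
  show "closedin K C" unfolding C_def by (rule closedin_superlevel[OF f])
  show "C \<subseteq> U" using assms testfunD(4)[OF assms(1)] by (force simp: C_def)
  have "L f \<le> L (\<lambda>x. f' x + e)"
    by (intro L_mono f continuous_map_add f') (auto simp: f'_def)
  then show "L f \<le> L f' + e" using f' by (simp add: L_add L_const)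
qed

definition rho :: "'a set \<Rightarrow> ennreal" where
  "rho U = (SUP f\<in>{f. testfun U f}. ennreal (L f))"

lemma rho_upper: "testfun U f \<Longrightarrow> ennreal (L f) \<le> rho U"
  unfolding rho_def by (auto intro: SUP_upper)

lemma rho_mono: "U \<subseteq> V \<Longrightarrow> rho U \<le> rho V"
  unfolding rho_def by (intro SUP_subset_mono) (auto intro: testfun_mono)

lemma rho_le1: "rho U \<le> 1"
  unfolding rho_def
proof (intro SUP_least)
  fix f assume "f \<in> {f. testfun U f}"
  then have "L f \<le> L (\<lambda>x. 1)" by (intro L_mono) (auto dest: testfunD)
  then show "ennreal (L f) \<le> 1" by (simp add: L_one)
qed

lemma rho_space: "rho (topspace K) = 1"
  using rho_upper[of "topspace K" "\<lambda>x. 1"] rho_le1[of "topspace K"]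
  by (force simp: L_one testfun_def intro: antisym)

lemma rho_empty: "rho {} = 0"
proof -
  have "ennreal (L f) \<le> 0" if "testfun {} f" for f
    using L_mono[of f "\<lambda>x. 0"] testfunD[OF that] by (auto simp: L_const ennreal_eq_0_iff)
  then have "rho {} \<le> 0" unfolding rho_def by (intro SUP_least) auto
  then show ?thesis by simp
qed

lemma rho_Un:
  assumes U: "openin K U" and V: "openin K V"
  shows "rho (U \<union> V) \<le> rho U + rho V"
  unfolding rho_def[of "U \<union> V"]
proof (intro SUP_least)
  fix f assume "f \<in> {f. testfun (U \<union> V) f}"
  then have f: "testfun (U \<union> V) f" by simp
  show "ennreal (L f) \<le> rho U + rho V"
  proof (rule ennreal_le_epsilon)
    fix e :: real assume e: "0 < e"
    define f' where "f' = (\<lambda>x. max (f x - e) 0)"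
    define C where "C = {x\<in>topspace K. e \<le> f x}"
    note t = testfun_trunc[OF f e, folded f'_def C_def]
    have cl: "closedin K (topspace K - U)" "closedin K (C - V)"
      using U V t by (auto intro: closedin_diff)
    have dis: "(topspace K - U) \<inter> (C - V) = {}" using t(3) by auto
    \<comment> \<open>\<open>u\<close> vanishes off \<open>U\<close> and is 1 on
      \<open>C - V\<close>. So \<open>f' * u\<close> is a test function for \<open>U\<close>, and
      \<open>f' * (1 - u)\<close> vanishes off \<open>V\<close> because there either
      \<open>u\<close> is 1 or \<open>f'\<close> is 0.\<close>
    obtain u where u: "cont u" "\<And>x. x \<in> topspace K - U \<Longrightarrow> u x = 0"
      "\<And>x. x \<in> C - V \<Longrightarrow> u x = 1" "\<And>x. x \<in> topspace K \<Longrightarrow> 0 \<le> u x \<and> u x \<le> 1"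
      by (rule urysohn[OF cl dis]) blast
    have c1: "cont (\<lambda>x. f' x * u x)" and c2: "cont (\<lambda>x. f' x * (1 - u x))"
      by (intro continuous_map_real_mult continuous_map_diff testfunD(1)[OF t(1)] u(1); simp)+
    have 1: "testfun U (\<lambda>x. f' x * u x)"
      unfolding testfun_def using c1 testfunD(2,3)[OF t(1)] u(2,4) by (auto intro: mult_le_one)
    have z: "f' x * (1 - u x) = 0" if "x \<in> topspace K - V" for x
      using that u(3)[of x] testfunD(4)[OF t(1), of x] by (cases "x \<in> C") auto
    have 2: "testfun V (\<lambda>x. f' x * (1 - u x))"
      unfolding testfun_def using c2 testfunD(2,3)[OF t(1)] u(4) z by (auto intro: mult_le_one)
    have "L f' = L (\<lambda>x. f' x * u x + f' x * (1 - u x))"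
      by (simp add: algebra_simps)
    also have "\<dots> = L (\<lambda>x. f' x * u x) + L (\<lambda>x. f' x * (1 - u x))"
      by (rule L_add[OF c1 c2])
    finally have "ennreal (L f) \<le> ennreal (L (\<lambda>x. f' x * u x) + L (\<lambda>x. f' x * (1 - u x)) + e)"
      using t(4) by (auto intro: ennreal_leI)
    also have "\<dots> = ennreal (L (\<lambda>x. f' x * u x)) + ennreal (L (\<lambda>x. f' x * (1 - u x))) + ennreal e"
      using testfun_L[OF 1] testfun_L[OF 2] e by simp
    also have "\<dots> \<le> rho U + rho V + ennreal e"
      by (intro add_mono rho_upper 1 2) auto
    finally show "ennreal (L f) \<le> rho U + rho V + ennreal e" .
  qed
qed

lemma rho_UN_finite:
  assumes "\<And>i::nat. openin K (U i)"
  shows "rho (\<Union>i<n. U i) \<le> (\<Sum>i<n. rho (U i))"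
proof (induction n)
  case 0
  then show ?case by (simp add: rho_empty)
next
  case (Suc n)
  have "rho (\<Union>i<Suc n. U i) = rho ((\<Union>i<n. U i) \<union> U n)"
    by (simp add: lessThan_Suc Un_commute)
  also have "\<dots> \<le> rho (\<Union>i<n. U i) + rho (U n)"
    by (intro rho_Un openin_Union) (auto intro: assms)
  also have "\<dots> \<le> (\<Sum>i<n. rho (U i)) + rho (U n)" by (intro add_mono Suc order_refl)
  finally show ?case by simp
qed

text \<open>A truncated test function vanishes off a compact set, which finitely many of the
  \<open>U i\<close> already cover; this reduces the claim to \<open>rho_UN_finite\<close>.\<close>

lemma rho_UN:
  assumes U: "\<And>i::nat. openin K (U i)"
  shows "rho (\<Union>i. U i) \<le> (\<Sum>i. rho (U i))"
  unfolding rho_def[of "\<Union>i. U i"]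
proof (intro SUP_least)
  fix f assume "f \<in> {f. testfun (\<Union>i. U i) f}"
  then have f: "testfun (\<Union>i. U i) f" by simp
  show "ennreal (L f) \<le> (\<Sum>i. rho (U i))"
  proof (rule ennreal_le_epsilon)
    fix e :: real assume e: "0 < e"
    define f' where "f' = (\<lambda>x. max (f x - e) 0)"
    define C where "C = {x\<in>topspace K. e \<le> f x}"
    note t = testfun_trunc[OF f e, folded f'_def C_def]
    have "compactin K C" using t(2) closedin_iff_compactin by simp
    then obtain \<F> where \<F>: "finite \<F>" "\<F> \<subseteq> range U" "C \<subseteq> \<Union>\<F>"
      using U t(3) unfolding compactin_def by (metis (no_types, lifting) imageE)
    then obtain I where I: "finite I" "\<F> = U ` I" by (meson finite_subset_image)
    then obtain n where "\<And>i. i \<in> I \<Longrightarrow> i < n"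
      by (metis finite_nat_set_iff_bounded)
    then have "C \<subseteq> (\<Union>i<n. U i)" using \<F> I by blast
    then have "testfun (\<Union>i<n. U i) f'" using t(1) testfun_mono by blast
    then have "ennreal (L f') \<le> (\<Sum>i<n. rho (U i))"
      using rho_upper rho_UN_finite[of U, OF U] order_trans by blast
    also have "\<dots> \<le> (\<Sum>i. rho (U i))" by (intro sum_le_suminf) auto
    finally have *: "ennreal (L f') \<le> (\<Sum>i. rho (U i))" .
    have "ennreal (L f) \<le> ennreal (L f') + ennreal e"
      using t(4) e testfun_L[OF t(1)] by (simp flip: ennreal_plus add: ennreal_leI)
    also have "\<dots> \<le> (\<Sum>i. rho (U i)) + ennreal e" using * by (intro add_mono) auto
    finally show "ennreal (L f) \<le> (\<Sum>i. rho (U i)) + ennreal e" .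
  qed
qed

section \<open>The outer measure and the Caratheodory criterion for open sets\<close>

definition outer :: "'a set \<Rightarrow> ennreal" where
  "outer A = (INF U\<in>{U. openin K U \<and> A \<subseteq> U}. rho U)"

lemma outer_open: "openin K U \<Longrightarrow> outer U = rho U"
  unfolding outer_def by (intro antisym INF_lower INF_greatest rho_mono) auto

lemma outer_le: "openin K U \<Longrightarrow> A \<subseteq> U \<Longrightarrow> outer A \<le> rho U"
  unfolding outer_def by (intro INF_lower) auto

lemma outer_mono: "A \<subseteq> B \<Longrightarrow> outer A \<le> outer B"
  unfolding outer_def by (intro INF_superset_mono) auto

lemma outer_close:
  assumes "outer A < t"
  obtains U where "openin K U" "A \<subseteq> U" "rho U < t"
  using assms unfolding outer_def INF_less_iff by auto

lemma outer_le1: "A \<subseteq> topspace K \<Longrightarrow> outer A \<le> 1"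
  using outer_le[of "topspace K" A] rho_space by auto

lemma outer_measure_space_outer: "outer_measure_space (Pow (topspace K)) outer"
  unfolding outer_measure_space_def
proof (intro conjI)
  show "positive (Pow (topspace K)) outer"
    by (auto simp: positive_def outer_open rho_empty)
  show "increasing (Pow (topspace K)) outer"
    by (auto simp: increasing_def outer_mono)
  show "countably_subadditive (Pow (topspace K)) outer"
    unfolding countably_subadditive_def
  proof (intro allI impI)
    fix A :: "nat \<Rightarrow> 'a set" assume A: "range A \<subseteq> Pow (topspace K)"
    show "outer (\<Union>i. A i) \<le> (\<Sum>n. outer (A n))"
    proof (rule ennreal_le_epsilon)
      fix e :: real assume e: "0 < e"
      have *: "outer (A n) < outer (A n) + ennreal (e * (1/2)^Suc n)" for n
      proof -
        have "outer (A n) \<noteq> top" using outer_le1[of "A n"] A by (auto simp: top_unique image_subset_iff)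
        then show ?thesis using e ennreal_add_left_cancel_less[of "outer (A n)" 0] by simp
      qed
      have "\<exists>U. openin K U \<and> A n \<subseteq> U \<and> rho U \<le> outer (A n) + ennreal (e * (1/2)^Suc n)" for n
        by (rule outer_close[OF *]) (auto intro: less_imp_le)
      then obtain U where U: "\<And>n. openin K (U n)" "\<And>n. A n \<subseteq> U n"
        "\<And>n. rho (U n) \<le> outer (A n) + ennreal (e * (1/2)^Suc n)" by metis
      have "outer (\<Union>i. A i) \<le> rho (\<Union>i. U i)"
        by (intro outer_le) (use U in \<open>auto intro!: openin_Union\<close>)
      also have "\<dots> \<le> (\<Sum>n. rho (U n))" by (rule rho_UN[OF U(1)])
      also have "\<dots> \<le> (\<Sum>n. outer (A n) + ennreal (e * (1/2)^Suc n))"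
        by (intro suminf_le U) auto
      also have "\<dots> = (\<Sum>n. outer (A n)) + (\<Sum>n. ennreal (e * (1/2) ^ Suc n))"
        by (subst suminf_add[symmetric]) auto
      also have "(\<Sum>n. ennreal (e * (1/2) ^ Suc n)) = ennreal e"
        using sums_mult[OF power_half_series, of e] e by (intro suminf_ennreal_eq) auto
      finally show "outer (\<Union>i. A i) \<le> (\<Sum>n. outer (A n)) + ennreal e" .
    qed
  qed
qed

lemma outer_Un:
  assumes "A \<subseteq> topspace K" "B \<subseteq> topspace K" "A \<inter> B = {}"
  shows "outer (A \<union> B) \<le> outer A + outer B"
  using outer_measure_space_outer assms
    ring_of_sets.countably_subadditive_subadditive[OF ring_of_sets_Pow, of "topspace K" outer]
  by (intro subadditiveD[of "Pow (topspace K)"]) (auto simp: outer_measure_space_def)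

text \<open>For open \<open>V\<close> around \<open>A\<close>, a nearly optimal test function for
  \<open>V \<inter> U\<close> and one for the rest of \<open>V\<close> are added up to a single test
  function for \<open>V\<close>.\<close>

lemma open_lambda_system:
  assumes U: "openin K U"
  shows "U \<in> lambda_system (topspace K) (Pow (topspace K)) outer"
  unfolding lambda_system_def
proof (intro CollectI conjI ballI)
  show "U \<in> Pow (topspace K)" using U openin_subset by auto
  fix A assume "A \<in> Pow (topspace K)"
  then have A: "A \<subseteq> topspace K" by auto
  have le: "outer (U \<inter> A) + outer ((topspace K - U) \<inter> A) \<le> rho V"
    if V: "openin K V" "A \<subseteq> V" for V
  proof (rule ennreal_le_epsilon)
    fix e' :: real assume "0 < e'"
    \<comment> \<open>Three losses: approximating \<open>rho (V \<inter> U)\<close>, truncating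
      \<open>f\<close>, and approximating \<open>rho (V - C)\<close>.\<close>
    define e where "e = e' / 3"
    then have e: "0 < e" using \<open>0 < e'\<close> by simp
    have sup: "\<exists>f. testfun W f \<and> rho W \<le> ennreal (L f) + ennreal e" for W
    proof -
      have "rho W \<noteq> top" using rho_le1[of W] by (auto simp: top_unique)
      then have "\<exists>f\<in>{f. testfun W f}. rho W < ennreal (L f) + ennreal e"
        using e testfun_0 by (intro SUP_approx_ennreal) (auto simp: rho_def)
      then show ?thesis by (auto intro: less_imp_le)
    qed
    obtain f where f: "testfun (V \<inter> U) f" "rho (V \<inter> U) \<le> ennreal (L f) + ennreal e" using sup by blast
    define f' where "f' = (\<lambda>x. max (f x - e) 0)"
    define C where "C = {x\<in>topspace K. e \<le> f x}"
    note t = testfun_trunc[OF f(1) e, folded f'_def C_def]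
    \<comment> \<open>Removing the closed set \<open>C\<close> instead of \<open>U\<close> leaves an
      open set that still covers the part of \<open>A\<close> outside \<open>U\<close>. As
      \<open>f'\<close> vanishes off \<open>C\<close> and \<open>g\<close> vanishes on
      \<open>C\<close>, the sum stays at most 1.\<close>
    have VC: "openin K (V - C)" using V t by (auto intro: openin_diff)
    obtain g where g: "testfun (V - C) g" "rho (V - C) \<le> ennreal (L g) + ennreal e" using sup by blast
    have fg: "testfun V (\<lambda>x. f' x + g x)"
      unfolding testfun_def
    proof (intro conjI ballI)
      show "cont (\<lambda>x. f' x + g x)" using testfunD(1) t(1) g(1) by (intro continuous_map_add) auto
      fix x assume x: "x \<in> topspace K"
      show "0 \<le> f' x + g x" using testfunD(2)[OF t(1)] testfunD(2)[OF g(1)] x by fastforce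
      show "f' x + g x \<le> 1" using testfunD(3,4)[OF t(1) x] testfunD(3,4)[OF g(1) x] by (cases "x \<in> C") auto
    next
      fix x assume x: "x \<in> topspace K - V"
      then show "f' x + g x = 0" using testfunD(4)[OF t(1), of x] testfunD(4)[OF g(1), of x] t(3) by auto
    qed
    have "outer (U \<inter> A) \<le> rho (V \<inter> U)" using V U by (intro outer_le) auto
    also have "\<dots> \<le> ennreal (L f) + ennreal e" by (rule f)
    also have "ennreal (L f) \<le> ennreal (L f') + ennreal e"
      using t(4) e testfun_L[OF t(1)] by (simp flip: ennreal_plus add: ennreal_leI)
    finally have 1: "outer (U \<inter> A) \<le> ennreal (L f') + ennreal e + ennreal e"
      by (simp add: add_right_mono)
    have "outer ((topspace K - U) \<inter> A) \<le> rho (V - C)" using V VC t(3) by (intro outer_le) auto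
    also have "\<dots> \<le> ennreal (L g) + ennreal e" by (rule g)
    finally have "outer (U \<inter> A) + outer ((topspace K - U) \<inter> A) \<le>
       (ennreal (L f') + ennreal e + ennreal e) + (ennreal (L g) + ennreal e)"
      using 1 add_mono by blast
    also have "\<dots> = ennreal (L f' + L g) + ennreal e'"
      using e testfun_L[OF t(1)] testfun_L[OF g(1)] by (simp flip: ennreal_plus) (simp add: e_def)
    also have "L f' + L g = L (\<lambda>x. f' x + g x)" using t(1) g(1) testfunD(1) by (simp add: L_add)
    also have "ennreal (L (\<lambda>x. f' x + g x)) \<le> rho V" by (rule rho_upper[OF fg])
    finally show "outer (U \<inter> A) + outer ((topspace K - U) \<inter> A) \<le> rho V + ennreal e'"
      by (simp add: add_right_mono)
  qed
  have "outer (U \<inter> A) + outer ((topspace K - U) \<inter> A) \<le> outer A"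
    unfolding outer_def[of A] by (intro INF_greatest) (use le in auto)
  moreover have "outer A \<le> outer (U \<inter> A) + outer ((topspace K - U) \<inter> A)"
  proof -
    have eq: "(U \<inter> A) \<union> ((topspace K - U) \<inter> A) = A" using A by blast
    have "outer ((U \<inter> A) \<union> ((topspace K - U) \<inter> A)) \<le> outer (U \<inter> A) + outer ((topspace K - U) \<inter> A)"
      by (rule outer_Un) (use A in blast)+
    then show ?thesis by (simp only: eq)
  qed
  ultimately show "outer (U \<inter> A) + outer ((topspace K - U) \<inter> A) = outer A" by (rule antisym)
qed

section \<open>The regular Borel measure of a state and its integral\<close>

definition riesz :: "'a measure" where
  "riesz = measure_of (topspace K) {U. openin K U} outer"

lemma riesz_emeasure:
  assumes A: "A \<in> sigma_sets (topspace K) {U. openin K U}"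
  shows "emeasure riesz A = outer A"
proof -
  let ?LS = "lambda_system (topspace K) (Pow (topspace K)) outer"
  have ms: "measure_space (topspace K) ?LS outer"
    by (rule sigma_algebra.caratheodory_lemma[OF sigma_algebra_Pow outer_measure_space_outer])
  then have "sigma_algebra (topspace K) ?LS" by (simp add: measure_space_def)
  then have sub: "sigma_sets (topspace K) {U. openin K U} \<subseteq> ?LS"
    by (intro sigma_algebra.sigma_sets_subset) (auto intro: open_lambda_system)
  have "measure_space (topspace K) (sigma_sets (topspace K) {U. openin K U}) outer"
    by (rule measure_down[OF ms sigma_algebra_sigma_sets sub]) (auto dest: openin_subset)
  moreover have "sets riesz = sigma_sets (topspace K) {U. openin K U}"
    unfolding riesz_def by (rule sets_measure_of) (auto dest: openin_subset)
  moreover have "{U. openin K U} \<subseteq> Pow (topspace K)" by (auto dest: openin_subset)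
  ultimately show ?thesis using A
    by (intro emeasure_measure_of[OF riesz_def]) (simp_all add: measure_space_def)
qed

lemma riesz_sets: "sets riesz = sigma_sets (topspace K) {U. openin K U}"
  unfolding riesz_def by (rule sets_measure_of) (auto dest: openin_subset)

lemma riesz_space: "space riesz = topspace K"
  unfolding riesz_def by (rule space_measure_of) (auto dest: openin_subset)

lemma riesz_open: "openin K U \<Longrightarrow> emeasure riesz U = rho U"
  by (simp add: riesz_emeasure outer_open sigma_sets.Basic)

lemma riesz_prob: "prob_space riesz"
  by (rule prob_spaceI) (simp add: riesz_space riesz_open rho_space)

lemma riesz_regular: "regular_prob_measure K riesz"
  unfolding regular_prob_measure_def
proof (intro conjI ballI)
  interpret prob_space riesz by (rule riesz_prob)
  show "prob_space riesz" by (rule riesz_prob)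
  show "space riesz = topspace K" by (rule riesz_space)
  show "sets riesz = sigma_sets (topspace K) {U. openin K U}" by (rule riesz_sets)
  have op: "U \<in> sets riesz" if "openin K U" for U
    using that by (simp add: riesz_sets sigma_sets.Basic)
  fix A assume A: "A \<in> sets riesz"
  show outer_regular: "emeasure riesz A = (INF U\<in>{U. openin K U \<and> A \<subseteq> U}. emeasure riesz U)"
    using A by (auto simp: riesz_emeasure riesz_sets outer_def[of A] outer_open intro!: INF_cong)
  show "emeasure riesz A = (SUP C\<in>{C. compactin K C \<and> C \<subseteq> A}. emeasure riesz C)"
  proof (rule antisym)
    show "(SUP C\<in>{C. compactin K C \<and> C \<subseteq> A}. emeasure riesz C) \<le> emeasure riesz A"
      using A by (intro SUP_least emeasure_mono) auto
    show "emeasure riesz A \<le> (SUP C\<in>{C. compactin K C \<and> C \<subseteq> A}. emeasure riesz C)"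
    proof (rule ennreal_le_epsilon)
      fix e :: real assume e: "0 < e"
      \<comment> \<open>Inner regularity of \<open>A\<close> is outer regularity of the complement:
        an open set slightly larger than \<open>?B\<close> has a compact complement contained in
        \<open>A\<close>.\<close>
      let ?B = "topspace K - A"
      have B: "?B \<in> sets riesz" using A sets.compl_sets riesz_space by metis
      have eB: "emeasure riesz ?B = outer ?B"
        by (rule riesz_emeasure) (use B in \<open>simp add: riesz_sets\<close>)
      have "emeasure riesz ?B < emeasure riesz ?B + ennreal e"
        using e ennreal_add_left_cancel_less[of "emeasure riesz ?B" 0] by simp
      then have "outer ?B < emeasure riesz ?B + ennreal e"
        by (simp only: eB)
      then obtain U where U: "openin K U" "?B \<subseteq> U" "rho U < emeasure riesz ?B + ennreal e"
        by (rule outer_close)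
      have "emeasure riesz (U - ?B) = emeasure riesz U - emeasure riesz ?B"
        using U B op by (intro emeasure_Diff) auto
      also have "\<dots> \<le> ennreal e"
        using U by (simp add: riesz_open ennreal_minus_le_iff less_imp_le)
      finally have d: "emeasure riesz (U - ?B) \<le> ennreal e" .
      let ?C = "topspace K - U"
      have C: "compactin K ?C" "?C \<subseteq> A" using U closedin_iff_compactin by auto
      have "topspace K \<in> sets riesz" by (intro op) simp
      then have ms: "?C \<in> sets riesz" "U - ?B \<in> sets riesz"
        using op[OF U(1)] B by (blast intro: sets.Diff)+
      have "A \<subseteq> ?C \<union> (U - ?B)"
        using sets.sets_into_space[OF A] unfolding riesz_space by blast
      then have "emeasure riesz A \<le> emeasure riesz (?C \<union> (U - ?B))"
        by (intro emeasure_mono sets.Un ms)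
      also have "\<dots> \<le> emeasure riesz ?C + emeasure riesz (U - ?B)"
        by (intro emeasure_subadditive ms)
      also have "\<dots> \<le> (SUP C\<in>{C. compactin K C \<and> C \<subseteq> A}. emeasure riesz C) + ennreal e"
        using C d by (intro add_mono SUP_upper) auto
      finally show "emeasure riesz A \<le> (SUP C\<in>{C. compactin K C \<and> C \<subseteq> A}. emeasure riesz C) + ennreal e" .
    qed
  qed
qed

lemma cont_measurable: "cont f \<Longrightarrow> f \<in> borel_measurable riesz"
  by (rule continuous_map_borel_measurable) (auto simp: riesz_space riesz_sets)

lemma cont_integrable: "cont f \<Longrightarrow> integrable riesz f"
proof -
  interpret prob_space riesz by (rule riesz_prob)
  assume f: "cont f"
  then obtain B where "\<And>x. x \<in> topspace K \<Longrightarrow> \<bar>f x\<bar> \<le> B" using cont_bounded by metis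
  then show ?thesis
    by (intro integrable_const_bound[of _ B] cont_measurable f) (auto intro!: AE_I2 simp: riesz_space)
qed

text \<open>Slice \<open>f\<close> into the layers \<open>g k = min (max (f - k/n) 0) (1/n)\<close>; then \<open>n * g (k + 1)\<close> is a test
  function for \<open>{f > (k + 1)/n}\<close>, on which \<open>n * g k = 1\<close>.\<close>

lemma L_le_integral_unit:
  assumes f: "cont f" and f01: "\<And>x. x \<in> topspace K \<Longrightarrow> 0 \<le> f x \<and> f x \<le> 1"
  shows "L f \<le> (\<integral>x. f x \<partial>riesz)"
proof (rule field_le_epsilon)
  interpret prob_space riesz by (rule riesz_prob)
  fix e :: real assume e: "0 < e"
  obtain n :: nat where n: "0 < n" "1 / real n < e"
    using nat_approx_posE[OF e] by (metis zero_less_Suc)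
  define g where "g k x = min (max (f x - real k / n) 0) (1 / n)" for k :: nat and x
  have cg: "cont (g k)" for k
    unfolding g_def by (intro continuous_map_real_min continuous_map_real_max continuous_map_diff f) auto
  have partial: "(\<Sum>k<m. g k x) = min (f x) (real m / n)" if "x \<in> topspace K" for m x
  proof (induction m)
    case 0
    then show ?case using f01[OF that] by simp
  next
    case (Suc m)
    have "min (f x) (real m / n) + g m x = min (f x) (real (Suc m) / n)"
      unfolding g_def using f01[OF that] n by (auto simp: min_def max_def add_divide_distrib add_increasing)
    then show ?case using Suc by simp
  qed
  have sum_g: "(\<Sum>k<n. g k x) = f x" if "x \<in> topspace K" for x
    using partial[OF that] f01[OF that] n by simp
  have g_le: "g k x \<le> 1 / n" "0 \<le> g k x" for k x using n by (auto simp: g_def)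
  have layer: "L (g (Suc k)) \<le> (\<integral>x. g k x \<partial>riesz)" for k
  proof -
    let ?U = "{x \<in> topspace K. real (Suc k) / n < f x}"
    have U: "openin K ?U" by (rule openin_superlevel[OF f])
    have t: "testfun ?U (\<lambda>x. real n * g (Suc k) x)"
      unfolding testfun_def
    proof (intro conjI ballI)
      show "cont (\<lambda>x. real n * g (Suc k) x)" by (intro continuous_map_real_mult cg) auto
      fix x
      show "0 \<le> real n * g (Suc k) x" using g_le by simp
      show "real n * g (Suc k) x \<le> 1" using mult_left_mono[OF g_le(1), of "real n" "Suc k" x] n by simp
    next
      fix x assume "x \<in> topspace K - ?U"
      then show "real n * g (Suc k) x = 0" using n by (auto simp: g_def not_less)
    qed
    have "ennreal (real n * L (g (Suc k))) = ennreal (L (\<lambda>x. real n * g (Suc k) x))"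
      using cg by (simp add: L_scale)
    also have "\<dots> \<le> emeasure riesz ?U" using rho_upper[OF t] U by (simp add: riesz_open)
    also have "\<dots> = ennreal (measure riesz ?U)" by (rule emeasure_eq_measure)
    finally have "real n * L (g (Suc k)) \<le> measure riesz ?U" by simp
    also have "\<dots> = (\<integral>x. indicator ?U x \<partial>riesz)"
      using openin_subset[OF U] by (simp add: riesz_space Int_absorb2)
    also have "\<dots> \<le> (\<integral>x. real n * g k x \<partial>riesz)"
    proof (intro integral_mono)
      show "integrable riesz (indicator ?U :: 'a \<Rightarrow> real)"
        using U by (intro integrable_real_indicator) (auto simp: riesz_sets sigma_sets.Basic emeasure_eq_measure)
      show "integrable riesz (\<lambda>x. real n * g k x)" using cont_integrable[OF cg] by simp
      show "indicator ?U x \<le> real n * g k x" if "x \<in> space riesz" for x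
        using n g_le(2)[of k x] by (auto simp: indicator_def g_def divide_simps min_def max_def)
    qed
    finally have "real n * L (g (Suc k)) \<le> real n * (\<integral>x. g k x \<partial>riesz)" by simp
    then show ?thesis using n by simp
  qed
  obtain m where m: "n = Suc m" using n by (cases n) auto
  have "L f = L (\<lambda>x. \<Sum>k<n. g k x)"
    by (intro antisym L_mono f continuous_map_sum) (auto simp: sum_g cg)
  also have "\<dots> = (\<Sum>k<n. L (g k))" using cg by (intro L_sum) auto
  also have "\<dots> = L (g 0) + (\<Sum>k<m. L (g (Suc k)))" unfolding m by (rule sum.lessThan_Suc_shift)
  \<comment> \<open>Comparing layer \<open>k + 1\<close> with the integral of layer \<open>k\<close>
    leaves the bottom layer over, which costs at most \<open>1 / n\<close>, less than
    \<open>e\<close>. On the integral side the layers with index below \<open>m\<close> add up to at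
    most \<open>f\<close>.\<close>
  also have "L (g 0) \<le> L (\<lambda>x. 1 / n)" by (intro L_mono cg) (auto simp: g_le)
  also have "\<dots> = 1 / n" by (rule L_const)
  also have "(\<Sum>k<m. L (g (Suc k))) \<le> (\<Sum>k<m. \<integral>x. g k x \<partial>riesz)" by (intro sum_mono layer)
  also have "\<dots> = (\<integral>x. (\<Sum>k<m. g k x) \<partial>riesz)"
    using cont_integrable[OF cg] by (intro Bochner_Integration.integral_sum[symmetric]) auto
  also have "\<dots> \<le> (\<integral>x. f x \<partial>riesz)"
    by (intro integral_mono cont_integrable f continuous_map_sum) (auto simp: partial riesz_space cg)
  finally show "L f \<le> (\<integral>x. f x \<partial>riesz) + e" using n by simp
qed

text \<open>The affine map taking [-B, B] to [0, 1] reduces this to the unit case, since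
  \<open>L\<close> and the integral agree on constants.\<close>

lemma L_le_integral:
  assumes f: "cont f"
  shows "L f \<le> (\<integral>x. f x \<partial>riesz)"
proof -
  interpret prob_space riesz by (rule riesz_prob)
  obtain B where B: "B > 0" "\<And>x. x \<in> topspace K \<Longrightarrow> \<bar>f x\<bar> \<le> B" using cont_bounded[OF f] by metis
  let ?g = "\<lambda>x. 1 / (2 * B) * f x + 1 / 2"
  have "L ?g \<le> (\<integral>x. ?g x \<partial>riesz)"
  proof (rule L_le_integral_unit)
    show "cont ?g" by (intro continuous_map_add continuous_map_real_mult f) auto
    show "0 \<le> ?g x \<and> ?g x \<le> 1" if "x \<in> topspace K" for x
      using B(2)[OF that] B(1) by (auto simp: divide_simps abs_le_iff)
  qed
  also have "(\<integral>x. ?g x \<partial>riesz) = 1 / (2 * B) * (\<integral>x. f x \<partial>riesz) + 1 / 2"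
    using cont_integrable[OF f] by (simp add: prob_space)
  also have "L ?g = 1 / (2 * B) * L f + 1 / 2"
    using f by (subst L_add) (auto simp: L_const L_scale intro!: continuous_map_real_mult simp del: times_divide_eq_left)
  finally show ?thesis using B(1) by (simp add: divide_right_mono_neg divide_le_cancel)
qed

lemma riesz_integral:
  assumes f: "cont f"
  shows "(\<integral>x. f x \<partial>riesz) = L f"
  using L_le_integral[OF f] L_le_integral[of "\<lambda>x. - f x"] f by (simp add: L_minus)

end

context compact_hausdorff
begin

theorem riesz_representation:
  assumes "state K L"
  obtains \<mu> where "regular_prob_measure K \<mu>" "\<And>f. cont f \<Longrightarrow> (\<integral>x. f x \<partial>\<mu>) = L f"
proof -
  interpret compact_state K L by unfold_locales (rule assms)
  show thesis using that riesz_regular riesz_integral by blast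
qed

end

section \<open>Extreme points and completeness of L1\<close>

text \<open>In a chain every nonempty finite intersection is again a member, so the finite
  intersection property in \<open>Q\<close> applies.\<close>

lemma closed_chain_Inter_nonempty:
  assumes Q: "compact Q" and C: "C \<noteq> {}" and chain: "\<And>A B. A \<in> C \<Longrightarrow> B \<in> C \<Longrightarrow> A \<subseteq> B \<or> B \<subseteq> A"
    and cl: "\<And>A. A \<in> C \<Longrightarrow> closed A \<and> A \<noteq> {} \<and> A \<subseteq> Q"
  shows "\<Inter>C \<noteq> {}"
proof -
  have fin: "F \<noteq> {} \<Longrightarrow> F \<subseteq> C \<Longrightarrow> \<Inter>F \<in> C" if "finite F" for F
    using that
  proof (induction F)
    case (insert A F)
    show ?case
    proof (cases "F = {}")
      case False
      then have "\<Inter>F \<in> C" "A \<in> C" using insert by auto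
      then have "A \<subseteq> \<Inter>F \<or> \<Inter>F \<subseteq> A" using chain by blast
      then have "\<Inter>(insert A F) = A \<or> \<Inter>(insert A F) = \<Inter>F" by auto
      then show ?thesis using \<open>\<Inter>F \<in> C\<close> \<open>A \<in> C\<close> by metis
    qed (use insert in auto)
  qed simp
  obtain A0 where A0: "A0 \<in> C" using C by auto
  have "Q \<inter> \<Inter>C \<noteq> {}"
  proof (rule compact_imp_fip[OF Q])
    show "closed T" if "T \<in> C" for T using cl that by blast
    fix F assume F: "finite F" "F \<subseteq> C"
    then have "\<Inter>(insert A0 F) \<in> C" using fin[of "insert A0 F"] A0 by auto
    then have "\<Inter>(insert A0 F) \<noteq> {}" "\<Inter>(insert A0 F) \<subseteq> Q" using cl by blast+
    then show "Q \<inter> \<Inter>F \<noteq> {}" by auto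
  qed
  then show ?thesis by blast
qed

text \<open>A minimal closed face of \<open>Q\<close> is a singleton, since every coordinate is constant on it.\<close>

lemma extreme_point_exists:
  fixes Q :: "('i \<Rightarrow> real) set"
  assumes Q: "compact Q" "closed Q" "Q \<noteq> {}"
  obtains L where "L \<in> Q"
    "\<And>L1 L2 s. L1 \<in> Q \<Longrightarrow> L2 \<in> Q \<Longrightarrow> 0 < s \<Longrightarrow> s < 1 \<Longrightarrow> (\<And>i. L i = s * L1 i + (1 - s) * L2 i) \<Longrightarrow> L1 = L"
proof -
  define face where "face E \<longleftrightarrow> E \<subseteq> Q \<and> E \<noteq> {} \<and> closed E \<and>
     (\<forall>L\<in>E. \<forall>L1\<in>Q. \<forall>L2\<in>Q. \<forall>s. 0 < s \<longrightarrow> s < 1 \<longrightarrow> (\<forall>i. L i = s * L1 i + (1 - s) * L2 i) \<longrightarrow> L1 \<in> E \<and> L2 \<in> E)"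
    for E :: "('i \<Rightarrow> real) set"
  have face_Q: "face Q" using Q by (auto simp: face_def)
  \<comment> \<open>\<open>subset_Zorn\<close> produces maximal sets, so it is applied to the
    complements of the faces in order to obtain a minimal face.\<close>
  have "\<exists>M\<in>uminus ` {E. face E}. \<forall>X\<in>uminus ` {E. face E}. M \<subseteq> X \<longrightarrow> X = M"
  proof (rule subset_Zorn)
    fix C assume C: "subset.chain (uminus ` {E. face E}) C"
    show "\<exists>U\<in>uminus ` {E. face E}. \<forall>X\<in>C. X \<subseteq> U"
    proof (cases "C = {}")
      case True
      then show ?thesis using face_Q by auto
    next
      case False
      define D where "D = uminus ` C"
      have faces: "face A" if "A \<in> D" for A
        using C that by (auto simp: D_def subset.chain_def)
      have chain: "A \<subseteq> B \<or> B \<subseteq> A" if "A \<in> D" "B \<in> D" for A B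
        using C that unfolding D_def subset.chain_def by (auto simp: subset_iff) blast
      have ne: "\<Inter>D \<noteq> {}"
        using faces chain False unfolding face_def
        by (intro closed_chain_Inter_nonempty[OF Q(1)]) (auto simp: D_def)
      obtain A0 where A0: "A0 \<in> D" using False by (auto simp: D_def)
      have "face (\<Inter>D)"
        unfolding face_def
      proof (intro conjI ballI allI impI ne)
        show "\<Inter>D \<subseteq> Q" using faces[OF A0] A0 unfolding face_def by blast
        show "closed (\<Inter>D)" using faces by (intro closed_Inter) (auto simp: face_def)
        fix L L1 L2 s assume *: "L \<in> \<Inter>D" "L1 \<in> Q" "L2 \<in> Q" "0 < s" "s < (1::real)" "\<forall>i. L i = s * L1 i + (1 - s) * L2 i"
        have **: "L1 \<in> A \<and> L2 \<in> A" if "A \<in> D" for A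
          using faces[OF that] * that unfolding face_def by blast
        show "L1 \<in> \<Inter>D" "L2 \<in> \<Inter>D" using ** by blast+
      qed
      moreover have "X \<subseteq> - \<Inter>D" if "X \<in> C" for X using that by (auto simp: D_def)
      ultimately show ?thesis by blast
    qed
  qed
  then obtain E where E: "face E" and min: "\<And>X. face X \<Longrightarrow> X \<subseteq> E \<Longrightarrow> X = E"
    by (auto simp: image_iff)
  have cE: "compact E" using Q E compact_Int_closed[of Q E] by (auto simp: face_def Int_absorb1)
  have const: "L i = L' i" if "L \<in> E" "L' \<in> E" for L L' i
  proof -
    have coord: "continuous_on UNIV (\<lambda>L :: 'i \<Rightarrow> real. L i)" by (rule continuous_on_product_coordinates)
    have "\<exists>L0\<in>E. \<forall>M\<in>E. L0 i \<le> M i"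
    proof (rule continuous_attains_inf[OF cE])
      show "E \<noteq> {}" using E by (simp add: face_def)
      show "continuous_on E (\<lambda>L. L i)" by (rule continuous_on_subset[OF coord subset_UNIV])
    qed
    then obtain L0 where L0: "L0 \<in> E" "\<And>M. M \<in> E \<Longrightarrow> L0 i \<le> M i" by blast
    \<comment> \<open>The part of \<open>E\<close> where the coordinate \<open>i\<close> attains its
      minimum is again a face, because a convex combination attains the minimum only if both of its
      members do. Minimality makes it all of \<open>E\<close>.\<close>
    let ?X = "{M \<in> E. M i = L0 i}"
    have "face ?X"
      unfolding face_def
    proof (intro conjI ballI allI impI)
      show "?X \<subseteq> Q" using E unfolding face_def by blast
      show "?X \<noteq> {}" using L0(1) by blast
      have "closed {M :: 'i \<Rightarrow> real. M i = L0 i}"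
        by (intro closed_Collect_eq coord continuous_on_const)
      then have "closed (E \<inter> {M. M i = L0 i})" using E by (intro closed_Int) (auto simp: face_def)
      then show "closed ?X" by (simp add: Int_def)
      fix M L1 L2 s assume *: "M \<in> ?X" "L1 \<in> Q" "L2 \<in> Q" "0 < s" "s < (1::real)" "\<forall>i. M i = s * L1 i + (1 - s) * L2 i"
      then have in_E: "L1 \<in> E" "L2 \<in> E" using E unfolding face_def by blast+
      have "s * (L1 i - L0 i) + (1 - s) * (L2 i - L0 i) = 0" using * by (auto simp: algebra_simps)
      moreover have "0 \<le> s * (L1 i - L0 i)" "0 \<le> (1 - s) * (L2 i - L0 i)"
        using L0(2)[OF in_E(1)] L0(2)[OF in_E(2)] * by auto
      ultimately have "s * (L1 i - L0 i) = 0" "(1 - s) * (L2 i - L0 i) = 0" by linarith+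
      then show "L1 \<in> ?X" "L2 \<in> ?X" using in_E * by auto
    qed
    then have "?X = E" using min by blast
    then show ?thesis using that by (metis (mono_tags, lifting) mem_Collect_eq)
  qed
  obtain L where L: "L \<in> E" using E unfolding face_def by blast
  show thesis
  proof (rule that)
    show "L \<in> Q" using L E unfolding face_def by blast
    fix L1 L2 s assume "L1 \<in> Q" "L2 \<in> Q" "0 < s" "s < (1::real)" "\<And>i. L i = s * L1 i + (1 - s) * L2 i"
    then have "L1 \<in> E" using E L unfolding face_def by blast
    then show "L1 = L" using const L by blast
  qed
qed

text \<open>A subsequence that is Cauchy almost everywhere supplies the limit \<open>g\<close>.
  Fatou's lemma along this subsequence turns the Cauchy bound into a bound for the distance to
  \<open>g\<close>, valid for the whole sequence.\<close>

lemma Cauchy_L1_convergent: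
  fixes s :: "nat \<Rightarrow> 'a \<Rightarrow> 'b::{banach, second_countable_topology}"
  assumes s: "\<And>n. integrable M (s n)"
    and C: "\<And>e. e > 0 \<Longrightarrow> \<exists>N. \<forall>i\<ge>N. \<forall>j\<ge>N. (\<integral>x. norm (s i x - s j x) \<partial>M) < e"
  obtains g where "integrable M g" "(\<lambda>n. \<integral>x. norm (s n x - g x) \<partial>M) \<longlonglongrightarrow> 0"
proof -
  obtain r where r: "strict_mono r" "AE x in M. Cauchy (\<lambda>i. s (r i) x)"
    using cauchy_L1_AE_cauchy_subseq[OF s C] by blast
  define g where "g x = lim (\<lambda>i. s (r i) x)" for x
  have sm[measurable]: "s n \<in> borel_measurable M" for n using s by auto
  have g[measurable]: "g \<in> borel_measurable M" unfolding g_def by measurable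
  have lim: "AE x in M. (\<lambda>i. s (r i) x) \<longlonglongrightarrow> g x"
    using r(2) by eventually_elim (auto simp: g_def Cauchy_convergent_iff convergent_LIMSEQ_iff)
  have bound: "(\<integral>\<^sup>+x. norm (s n x - g x) \<partial>M) \<le> ennreal e"
    if N: "\<forall>i\<ge>N. \<forall>j\<ge>N. (\<integral>x. norm (s i x - s j x) \<partial>M) < e" and n: "n \<ge> N" for n N e
  proof -
    have "(\<integral>\<^sup>+x. norm (s n x - g x) \<partial>M) = (\<integral>\<^sup>+x. liminf (\<lambda>i. ennreal (norm (s n x - s (r i) x))) \<partial>M)"
    proof (intro nn_integral_cong_AE)
      show "AE x in M. ennreal (norm (s n x - g x)) = liminf (\<lambda>i. ennreal (norm (s n x - s (r i) x)))"
        using lim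
      proof eventually_elim
        case (elim x)
        have "(\<lambda>i. ennreal (norm (s n x - s (r i) x))) \<longlonglongrightarrow> ennreal (norm (s n x - g x))"
          by (intro tendsto_intros elim)
        then show ?case by (intro lim_imp_Liminf[symmetric]) auto
      qed
    qed
    also have "\<dots> \<le> liminf (\<lambda>i. \<integral>\<^sup>+x. ennreal (norm (s n x - s (r i) x)) \<partial>M)"
      by (rule nn_integral_liminf) measurable
    also have "\<dots> \<le> ennreal e"
    proof (rule Liminf_le)
      have "\<forall>\<^sub>F i in sequentially. (\<integral>\<^sup>+x. ennreal (norm (s n x - s (r i) x)) \<partial>M) \<le> ennreal e"
        using eventually_ge_at_top[of N]
      proof eventually_elim
        case (elim i)
        then have "r i \<ge> N" using seq_suble[OF r(1), of i] by simp
        then have "(\<integral>x. norm (s n x - s (r i) x) \<partial>M) \<le> e" using N n by (auto intro: less_imp_le)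
        moreover have "integrable M (\<lambda>x. norm (s n x - s (r i) x))" using s by auto
        ultimately show ?case by (subst nn_integral_eq_integral) (auto intro: ennreal_leI)
      qed
      then show "\<forall>\<^sub>F i in sequentially. (\<integral>\<^sup>+x. ennreal (norm (s n x - s (r i) x)) \<partial>M) \<le> ennreal e" .
    qed simp
    finally show ?thesis .
  qed
  obtain N where N: "\<forall>i\<ge>N. \<forall>j\<ge>N. (\<integral>x. norm (s i x - s j x) \<partial>M) < 1" using C[of 1] by auto
  have "(\<integral>\<^sup>+x. norm (s N x - g x) \<partial>M) < \<infinity>"
    using bound[OF N order_refl] by (rule le_less_trans) simp
  then have "integrable M (\<lambda>x. s N x - g x)"
    unfolding integrable_iff_bounded by simp
  then have gi: "integrable M g"
    using Bochner_Integration.integrable_diff[OF s[of N], of "\<lambda>x. s N x - g x"] by simp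
  have "(\<lambda>n. \<integral>x. norm (s n x - g x) \<partial>M) \<longlonglongrightarrow> 0"
  proof (rule LIMSEQ_I)
    fix e :: real assume e: "0 < e"
    obtain N where N: "\<forall>i\<ge>N. \<forall>j\<ge>N. (\<integral>x. norm (s i x - s j x) \<partial>M) < e / 2" using C[of "e / 2"] e by auto
    have "norm ((\<integral>x. norm (s n x - g x) \<partial>M) - 0) < e" if "n \<ge> N" for n
    proof -
      have "integrable M (\<lambda>x. norm (s n x - g x))" using s gi by auto
      then have "ennreal (\<integral>x. norm (s n x - g x) \<partial>M) \<le> ennreal (e / 2)"
        using bound[OF N that] by (subst (asm) nn_integral_eq_integral) auto
      then have "(\<integral>x. norm (s n x - g x) \<partial>M) \<le> e / 2" using e by (simp add: ennreal_le_iff)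
      then show ?thesis using e by simp
    qed
    then show "\<exists>no. \<forall>n\<ge>no. norm ((\<integral>x. norm (s n x - g x) \<partial>M) - 0) < e" by blast
  qed
  then show thesis using that gi by blast
qed

section \<open>Regular measures\<close>

lemma continuous_map_compose_binary:
  fixes f g :: "'a \<Rightarrow> 'b::topological_space" and h :: "'b \<Rightarrow> 'b \<Rightarrow> 'c::topological_space"
  assumes f: "continuous_map X euclidean f" and g: "continuous_map X euclidean g"
    and h: "continuous_on UNIV (\<lambda>p. h (fst p) (snd p))"
  shows "continuous_map X euclidean (\<lambda>x. h (f x) (g x))"
proof -
  have "continuous_map X euclidean (\<lambda>x. (f x, g x))"
    using continuous_map_paired[of X euclidean euclidean f g] f g by simp
  then show ?thesis
    using continuous_map_compose[of X euclidean "\<lambda>x. (f x, g x)" euclidean "\<lambda>p. h (fst p) (snd p)"] h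
    by (simp add: o_def)
qed

lemma continuous_map_compose_unary:
  assumes "continuous_map X euclidean f" "continuous_on UNIV h"
  shows "continuous_map X euclidean (\<lambda>x. h (f x))"
  using continuous_map_compose[of X euclidean f euclidean h] assms by (simp add: o_def)

lemma Cfun_continuous: "f \<in> Cfun X \<Longrightarrow> continuous_map X euclidean f"
  by (simp add: Cfun_def)

lemma Cfun_off: "f \<in> Cfun X \<Longrightarrow> x \<notin> topspace X \<Longrightarrow> f x = 0"
  by (simp add: Cfun_def)

text \<open>The condition \<open>h 0 = 0\<close> keeps the composition zero off the carrier.\<close>

lemma Cfun_compose: "f \<in> Cfun X \<Longrightarrow> continuous_on UNIV h \<Longrightarrow> h 0 = 0 \<Longrightarrow> (\<lambda>x. h (f x)) \<in> Cfun X"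
  by (auto simp: Cfun_def intro: continuous_map_compose_unary)

lemma Cfun_0: "(\<lambda>x. 0) \<in> Cfun X"
  by (simp add: Cfun_def)

lemma Cfun_add: "f \<in> Cfun X \<Longrightarrow> g \<in> Cfun X \<Longrightarrow> (\<lambda>x. f x + g x) \<in> Cfun X"
  by (auto simp: Cfun_def intro!: continuous_map_add)

lemma Cfun_diff: "f \<in> Cfun X \<Longrightarrow> g \<in> Cfun X \<Longrightarrow> (\<lambda>x. f x - g x) \<in> Cfun X"
  by (auto simp: Cfun_def intro!: continuous_map_diff)

lemma Cfun_mult: "f \<in> Cfun X \<Longrightarrow> g \<in> Cfun X \<Longrightarrow> (\<lambda>x. f x * g x) \<in> Cfun X"
  by (auto simp: Cfun_def intro!: continuous_map_compose_binary[where h="(*)"] continuous_intros)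

lemma Cfun_cmult: "f \<in> Cfun X \<Longrightarrow> (\<lambda>x. c * f x) \<in> Cfun X"
  by (erule Cfun_compose) (auto intro!: continuous_intros)

lemma Cfun_Re: "f \<in> Cfun X \<Longrightarrow> (\<lambda>x. of_real (Re (f x))) \<in> Cfun X"
  by (erule Cfun_compose) (auto intro!: continuous_intros)

lemma Cfun_Im: "f \<in> Cfun X \<Longrightarrow> (\<lambda>x. of_real (Im (f x))) \<in> Cfun X"
  by (erule Cfun_compose) (auto intro!: continuous_intros)

lemma Cfun_modulus: "f \<in> Cfun X \<Longrightarrow> modulus f \<in> Cfun X"
  unfolding modulus_def by (erule Cfun_compose) (auto intro!: continuous_intros)

lemma Cfun_restrict:
  assumes "continuous_map X euclidean f"
  shows "(\<lambda>x. if x \<in> topspace X then f x else 0) \<in> Cfun X"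
  using assms by (auto simp: Cfun_def intro: continuous_map_eq)

lemma Cfun_one: "one_on X \<in> Cfun X"
proof -
  have "one_on X = (\<lambda>x. if x \<in> topspace X then 1 else 0 :: complex)" by (auto simp: indicator_def)
  then show ?thesis using Cfun_restrict[of X "\<lambda>x. 1"] by simp
qed

text \<open>Real-valued continuous functions are not required to vanish off the carrier; \<open>cplx K\<close> passes
  to the corresponding element of \<open>C(K)\<close>.\<close>

definition cplx :: "'a topology \<Rightarrow> ('a \<Rightarrow> real) \<Rightarrow> 'a \<Rightarrow> complex" where
  "cplx K f = (\<lambda>x. if x \<in> topspace K then of_real (f x) else 0)"

lemma cplx_in_Cfun: "continuous_map K euclideanreal f \<Longrightarrow> cplx K f \<in> Cfun K"
  unfolding cplx_def
  by (intro Cfun_restrict continuous_map_compose_unary[of K f complex_of_real] continuous_on_of_real continuous_on_id)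

lemma continuous_map_Re: "f \<in> Cfun K \<Longrightarrow> continuous_map K euclideanreal (\<lambda>x. Re (f x))"
  and continuous_map_Im: "f \<in> Cfun K \<Longrightarrow> continuous_map K euclideanreal (\<lambda>x. Im (f x))"
  and continuous_map_cmod: "f \<in> Cfun K \<Longrightarrow> continuous_map K euclideanreal (\<lambda>x. cmod (f x))"
  by (auto intro!: continuous_map_compose_unary[OF Cfun_continuous] continuous_intros)

context compact_hausdorff
begin

lemma Cfun_bounded:
  assumes "f \<in> Cfun K"
  obtains B where "B > 0" "\<And>x. cmod (f x) \<le> B"
proof -
  obtain B where B: "B > 0" "\<And>x. x \<in> topspace K \<Longrightarrow> \<bar>cmod (f x)\<bar> \<le> B"
    using cont_bounded[OF continuous_map_cmod[OF assms]] by metis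
  have "cmod (f x) \<le> B" for x
    using B(1) B(2)[of x] Cfun_off[OF assms, of x] by (cases "x \<in> topspace K") auto
  then show thesis using that B(1) by blast
qed

definition zeros :: "('a \<Rightarrow> complex) set \<Rightarrow> 'a set" where
  "zeros G = {x \<in> topspace K. \<forall>g\<in>G. g x = 0}"

lemma zeros_Compl: "topspace K - zeros G = (\<Union>g\<in>G. {x \<in> topspace K. g x \<noteq> 0})"
  by (auto simp: zeros_def)

lemma openin_nonzero: "g \<in> Cfun K \<Longrightarrow> openin K {x \<in> topspace K. g x \<noteq> 0}"
  using openin_continuous_map_preimage[OF Cfun_continuous, of g K "- {0}"] by auto

lemma closedin_zeros: "G \<subseteq> Cfun K \<Longrightarrow> closedin K (zeros G)"
  unfolding closedin_def zeros_Compl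
  by (auto simp: zeros_def intro!: openin_Union openin_nonzero)

end

section \<open>Regular probability measures: zero sets of null families and density of
  \<open>Cfun K\<close> in L1\<close>

locale regular_measure = compact_hausdorff +
  fixes \<mu> :: "'a measure"
  assumes regular: "regular_prob_measure K \<mu>"

sublocale regular_measure \<subseteq> prob_space \<mu>
  using regular by (simp add: regular_prob_measure_def)

context regular_measure
begin

lemma space_mu: "space \<mu> = topspace K"
  and sets_mu: "sets \<mu> = sigma_sets (topspace K) {U. openin K U}"
  using regular by (simp_all add: regular_prob_measure_def)

lemma open_sets: "openin K U \<Longrightarrow> U \<in> sets \<mu>"
  by (simp add: sets_mu sigma_sets.Basic)

lemma closed_sets: "closedin K C \<Longrightarrow> C \<in> sets \<mu>"
  using open_sets[of "topspace K - C"] sets.compl_sets[of "topspace K - C" \<mu>] closedin_subset[of K C]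
  by (auto simp: space_mu closedin_def double_diff)

lemma continuous_measurable:
  "continuous_map K euclidean f \<Longrightarrow> f \<in> borel_measurable \<mu>" for f :: "'a \<Rightarrow> 'b::topological_space"
  by (rule continuous_map_borel_measurable) (auto simp: space_mu sets_mu)

lemma Cfun_measurable: "f \<in> Cfun K \<Longrightarrow> f \<in> borel_measurable \<mu>"
  by (intro continuous_measurable Cfun_continuous)

lemma Cfun_integrable: "f \<in> Cfun K \<Longrightarrow> integrable \<mu> f"
  using Cfun_bounded[of f] by (metis Cfun_measurable integrable_const_bound AE_I2)

lemma cont_integrable: "cont f \<Longrightarrow> integrable \<mu> f"
  using cont_bounded[of f] by (metis continuous_measurable integrable_const_bound AE_I2 real_norm_def space_mu)

lemma Cfun_norm_zero_iff: "f \<in> Cfun K \<Longrightarrow> (\<integral>x. cmod (f x) \<partial>\<mu>) = 0 \<longleftrightarrow> (AE x in \<mu>. f x = 0)"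
  using Cfun_integrable[of f] integral_nonneg_eq_0_iff_AE[of \<mu> "\<lambda>x. cmod (f x)"] by simp

text \<open>\<open>G\<close> may be uncountable. By inner regularity only compact subsets of the
  complement matter, and such a set is covered by finitely many of the null open sets on which some
  member of \<open>G\<close> is nonzero.\<close>

lemma AE_zeros:
  assumes G: "G \<subseteq> Cfun K" and null: "\<And>g. g \<in> G \<Longrightarrow> AE x in \<mu>. g x = 0"
  shows "AE x in \<mu>. x \<in> zeros G"
proof -
  let ?U = "topspace K - zeros G"
  have U: "openin K ?U" using closedin_zeros[OF G] by (simp add: closedin_def)
  have "emeasure \<mu> ?U = (SUP C\<in>{C. compactin K C \<and> C \<subseteq> ?U}. emeasure \<mu> C)"
    using regular open_sets[OF U] by (simp add: regular_prob_measure_def)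
  also have "\<dots> \<le> 0"
  proof (intro SUP_least)
    fix C assume "C \<in> {C. compactin K C \<and> C \<subseteq> ?U}"
    then have C: "compactin K C" "C \<subseteq> \<Union> ((\<lambda>g. {x \<in> topspace K. g x \<noteq> 0}) ` G)"
      unfolding zeros_Compl by auto
    have op: "\<And>V. V \<in> (\<lambda>g. {x \<in> topspace K. g x \<noteq> 0}) ` G \<Longrightarrow> openin K V"
      using G openin_nonzero by blast
    have "\<exists>\<F>. finite \<F> \<and> \<F> \<subseteq> (\<lambda>g. {x \<in> topspace K. g x \<noteq> 0}) ` G \<and> C \<subseteq> \<Union>\<F>"
      using C op unfolding compactin_def by blast
    then obtain \<F> where \<F>: "finite \<F>" "\<F> \<subseteq> (\<lambda>g. {x \<in> topspace K. g x \<noteq> 0}) ` G" "C \<subseteq> \<Union>\<F>" by blast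
    have "V \<in> null_sets \<mu>" if V: "V \<in> \<F>" for V
    proof -
      obtain g where g: "g \<in> G" "V = {x \<in> topspace K. g x \<noteq> 0}" using V \<F>(2) by blast
      show ?thesis
        using null[OF g(1)] open_sets[OF openin_nonzero[of g]] G g
        by (subst (asm) AE_iff_null) (auto simp: space_mu)
    qed
    then have "\<Union>\<F> \<in> null_sets \<mu>" using \<F>(1)
      by (metis (no_types, lifting) null_sets.finite_Union subset_iff)
    moreover have "C \<in> sets \<mu>" using C(1) closed_sets closedin_iff_compactin by simp
    ultimately show "emeasure \<mu> C \<le> 0" using \<F>(3) null_sets_subset null_setsD1 by (metis order_refl)
  qed
  finally have "?U \<in> null_sets \<mu>" using open_sets[OF U] by (auto intro: null_setsI)
  then show ?thesis by (rule AE_I') (auto simp: space_mu)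
qed

lemma approx_closed_open:
  assumes A: "A \<in> sets \<mu>" and e: "0 < e"
  obtains C U where "closedin K C" "openin K U" "C \<subseteq> A" "A \<subseteq> U" "prob (U - C) < e"
proof -
  have eq: "emeasure \<mu> A = (SUP C\<in>{C. compactin K C \<and> C \<subseteq> A}. emeasure \<mu> C)"
    "emeasure \<mu> A = (INF U\<in>{U. openin K U \<and> A \<subseteq> U}. emeasure \<mu> U)"
    using regular A unfolding regular_prob_measure_def by blast+
  have S: "\<exists>C\<in>{C. compactin K C \<and> C \<subseteq> A}. emeasure \<mu> A < emeasure \<mu> C + ennreal (e / 2)"
  proof (rule SUP_approx_ennreal[OF _ _ eq(1)])
    have "{} \<in> {C. compactin K C \<and> C \<subseteq> A}" by simp
    then show "{C. compactin K C \<and> C \<subseteq> A} \<noteq> {}" by blast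
  qed (use e in simp_all)
  have I: "\<exists>U\<in>{U. openin K U \<and> A \<subseteq> U}. emeasure \<mu> U < emeasure \<mu> A + ennreal (e / 2)"
  proof (rule INF_approx_ennreal[OF _ eq(2)])
    show "emeasure \<mu> A \<noteq> \<infinity>" by simp
  qed (use e in simp_all)
  obtain C where C: "compactin K C" "C \<subseteq> A" "emeasure \<mu> A < emeasure \<mu> C + ennreal (e / 2)" using S by blast
  obtain U where U: "openin K U" "A \<subseteq> U" "emeasure \<mu> U < emeasure \<mu> A + ennreal (e / 2)" using I by blast
  have C': "closedin K C" using C closedin_iff_compactin by simp
  have "prob A < prob C + e / 2" "prob U < prob A + e / 2"
    using C(3) U(3) e unfolding emeasure_eq_measure by (simp_all flip: ennreal_plus add: ennreal_less_iff)
  moreover have "prob (U - C) = prob U - prob C"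
    using C U C' by (intro finite_measure_Diff open_sets closed_sets) auto
  ultimately show thesis using that[OF C' U(1) C(2) U(2)] by simp
qed

lemma L1_triangle:
  fixes f g h :: "'a \<Rightarrow> 'b::{banach, second_countable_topology}"
  assumes "integrable \<mu> f" "integrable \<mu> g" "integrable \<mu> h"
  shows "(\<integral>x. norm (f x - h x) \<partial>\<mu>) \<le> (\<integral>x. norm (f x - g x) \<partial>\<mu>) + (\<integral>x. norm (g x - h x) \<partial>\<mu>)"
proof -
  have "(\<integral>x. norm (f x - h x) \<partial>\<mu>) \<le> (\<integral>x. norm (f x - g x) + norm (g x - h x) \<partial>\<mu>)"
    using assms by (intro integral_mono) (auto intro: norm_diff_triangle_le)
  then show ?thesis using assms by simp
qed

lemma Cfun_dense:
  assumes "integrable \<mu> (f :: 'a \<Rightarrow> complex)" "0 < e"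
  shows "\<exists>h\<in>Cfun K. (\<integral>x. cmod (h x - f x) \<partial>\<mu>) < e"
  using assms
proof (induction f arbitrary: e)
  case (base A c)
  \<comment> \<open>The summand 1 keeps the quotient meaningful when \<open>c\<close> is 0.\<close>
  define d where "d = e / (cmod c + 1)"
  have d: "0 < d" unfolding d_def using base(3) by (simp add: add_nonneg_pos)
  obtain C U where CU: "closedin K C" "openin K U" "C \<subseteq> A" "A \<subseteq> U" "prob (U - C) < d"
    using approx_closed_open[OF base(1) d] by blast
  have cl: "closedin K (topspace K - U)" using CU by auto
  have dis: "(topspace K - U) \<inter> C = {}" using CU by auto
  obtain u where u: "cont u" "\<And>x. x \<in> topspace K - U \<Longrightarrow> u x = 0" "\<And>x. x \<in> C \<Longrightarrow> u x = 1"
    "\<And>x. x \<in> topspace K \<Longrightarrow> 0 \<le> u x \<and> u x \<le> 1"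
    by (rule urysohn[OF cl CU(1) dis]) blast
  let ?h = "\<lambda>x. c * cplx K u x"
  have h: "?h \<in> Cfun K" by (intro Cfun_cmult cplx_in_Cfun u(1))
  have UC: "U - C \<in> sets \<mu>" using CU open_sets closed_sets by blast
  have "(\<integral>x. cmod (?h x - indicator A x *\<^sub>R c) \<partial>\<mu>) \<le> (\<integral>x. cmod c * indicator (U - C) x \<partial>\<mu>)"
  proof (intro integral_mono)
    show "integrable \<mu> (\<lambda>x. cmod (?h x - indicator A x *\<^sub>R c))"
      using base(1) Cfun_integrable[OF h] by (auto simp: emeasure_eq_measure)
    show "integrable \<mu> (\<lambda>x. cmod c * indicator (U - C) x)"
      using UC by (auto simp: emeasure_eq_measure)
    fix x assume "x \<in> space \<mu>"
    then have x: "x \<in> topspace K" by (simp add: space_mu)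
    have "cmod (?h x - indicator A x *\<^sub>R c) = cmod c * \<bar>u x - indicator A x\<bar>"
    proof -
      have "?h x - indicator A x *\<^sub>R c = c * of_real (u x - indicator A x)"
        using x by (simp add: cplx_def scaleR_conv_of_real algebra_simps)
      then show ?thesis by (simp only: norm_mult norm_of_real)
    qed
    also have "\<dots> \<le> cmod c * indicator (U - C) x"
      using u(2)[of x] u(3)[of x] u(4)[OF x] x CU(3,4) by (intro mult_left_mono) (auto simp: indicator_def)
    finally show "cmod (?h x - indicator A x *\<^sub>R c) \<le> cmod c * indicator (U - C) x" .
  qed
  also have "\<dots> = cmod c * prob (U - C)" using UC sets.sets_into_space[OF UC] by (simp add: Int_absorb2)
  also have "\<dots> \<le> cmod c * d" using CU by (intro mult_left_mono) auto
  also have "\<dots> < e" unfolding d_def using base(3)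
    by (simp add: divide_simps add_nonneg_pos)
  finally show ?case using h by (intro bexI[of _ ?h])
next
  case (add f g)
  obtain h k where hk: "h \<in> Cfun K" "k \<in> Cfun K" "(\<integral>x. cmod (h x - f x) \<partial>\<mu>) < e / 2" "(\<integral>x. cmod (k x - g x) \<partial>\<mu>) < e / 2"
    using add.IH(1)[of "e/2"] add.IH(2)[of "e/2"] add.prems by auto
  have "(\<integral>x. cmod ((h x + k x) - (f x + g x)) \<partial>\<mu>) \<le> (\<integral>x. cmod (h x - f x) + cmod (k x - g x) \<partial>\<mu>)"
    using add.hyps Cfun_integrable[OF hk(1)] Cfun_integrable[OF hk(2)]
    by (intro integral_mono) (auto intro!: norm_diff_triangle_ineq)
  also have "\<dots> < e"
    using add.hyps Cfun_integrable[OF hk(1)] Cfun_integrable[OF hk(2)] hk(3,4) by simp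
  finally show ?case using Cfun_add[OF hk(1,2)] by (intro bexI[of _ "\<lambda>x. h x + k x"])
next
  case (lim f s)
  have "(\<lambda>i. \<integral>x. cmod (s i x - f x) \<partial>\<mu>) \<longlonglongrightarrow> (\<integral>x. cmod (0::complex) \<partial>\<mu>)"
  \<comment> \<open>The induction rule supplies approximants with
    \<open>cmod (s i x) \<le> 2 * cmod (f x)\<close>; together with \<open>f\<close> itself this
    gives the factor 3.\<close>
  proof (rule integral_dominated_convergence[where w="\<lambda>x. 3 * cmod (f x)"])
    show "AE x in \<mu>. (\<lambda>i. cmod (s i x - f x)) \<longlonglongrightarrow> cmod 0"
    proof (rule AE_I2)
      fix x assume "x \<in> space \<mu>"
      then have "(\<lambda>i. s i x - f x) \<longlonglongrightarrow> f x - f x"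
        by (intro tendsto_diff tendsto_const) (rule lim.hyps(2))
      then show "(\<lambda>i. cmod (s i x - f x)) \<longlonglongrightarrow> cmod 0" by (intro tendsto_norm) simp
    qed
    show "AE x in \<mu>. norm (cmod (s i x - f x)) \<le> 3 * cmod (f x)" for i
    proof (rule AE_I2)
      fix x assume "x \<in> space \<mu>"
      then show "norm (cmod (s i x - f x)) \<le> 3 * cmod (f x)"
        using lim.hyps(3)[of x i] norm_triangle_ineq4[of "s i x" "f x"] by simp
    qed
  qed (use lim.hyps(1,4) in auto)
  then have "(\<lambda>i. \<integral>x. cmod (s i x - f x) \<partial>\<mu>) \<longlonglongrightarrow> 0" by simp
  then have "\<forall>\<^sub>F i in sequentially. (\<integral>x. cmod (s i x - f x) \<partial>\<mu>) < e / 2"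
    using lim.prems by (intro order_tendstoD) auto
  then obtain i where i: "(\<integral>x. cmod (s i x - f x) \<partial>\<mu>) < e / 2"
    unfolding eventually_sequentially by blast
  obtain h where h: "h \<in> Cfun K" "(\<integral>x. cmod (h x - s i x) \<partial>\<mu>) < e / 2"
    using lim.IH[of "e/2" i] lim.prems by auto
  have "(\<integral>x. cmod (h x - f x) \<partial>\<mu>) < e"
    using L1_triangle[of h "s i" f] Cfun_integrable[OF h(1)] lim.hyps(1)[of i] lim.hyps(4) h(2) i by simp
  then show ?case using h by blast
qed

end

section \<open>The induced operators on L1 and Markov operators\<close>

context regular_measure
begin

abbreviation L1d :: "('a \<Rightarrow> complex) \<Rightarrow> ('a \<Rightarrow> complex) \<Rightarrow> real" where
  "L1d f g \<equiv> \<integral>x. cmod (f x - g x) \<partial>\<mu>"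

abbreviation int_on :: "'a set \<Rightarrow> ('a \<Rightarrow> real) \<Rightarrow> real" where
  "int_on A u \<equiv> \<integral>x. indicator A x * u x \<partial>\<mu>"

abbreviation L1r :: "('a \<Rightarrow> real) \<Rightarrow> ('a \<Rightarrow> real) \<Rightarrow> real" where
  "L1r f g \<equiv> \<integral>x. \<bar>f x - g x\<bar> \<partial>\<mu>"

text \<open>These are the properties through which the extension by continuity in
  \<open>L1_ext\<close> exists and is unique almost everywhere.\<close>

definition L1_contraction :: "'a oper \<Rightarrow> bool" where
  "L1_contraction S \<longleftrightarrow> (\<forall>f\<in>Cfun K. S f \<in> Cfun K)
     \<and> (\<forall>f\<in>Cfun K. \<forall>g\<in>Cfun K. S (\<lambda>x. f x - g x) = (\<lambda>x. S f x - S g x))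
     \<and> (\<forall>f\<in>Cfun K. (\<integral>x. cmod (S f x) \<partial>\<mu>) \<le> (\<integral>x. cmod (f x) \<partial>\<mu>))"

lemma L1_contraction_diff:
  assumes "L1_contraction S" "f \<in> Cfun K" "g \<in> Cfun K"
  shows "L1d (S f) (S g) \<le> L1d f g"
proof -
  have "(\<integral>x. cmod (S (\<lambda>x. f x - g x) x) \<partial>\<mu>) \<le> L1d f g"
    using assms Cfun_diff unfolding L1_contraction_def by blast
  moreover have "S (\<lambda>x. f x - g x) = (\<lambda>x. S f x - S g x)"
    using assms unfolding L1_contraction_def by blast
  ultimately show ?thesis by simp
qed

lemma L1_contraction_integrable: "L1_contraction S \<Longrightarrow> f \<in> Cfun K \<Longrightarrow> integrable \<mu> (S f)"
  by (intro Cfun_integrable) (auto simp: L1_contraction_def)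

text \<open>This is the predicate under the choice operator in \<open>L1_ext\<close>.\<close>

definition L1_limit :: "'a oper \<Rightarrow> ('a \<Rightarrow> complex) \<Rightarrow> ('a \<Rightarrow> complex) \<Rightarrow> bool" where
  "L1_limit S f g \<longleftrightarrow> integrable \<mu> g \<and>
     (\<exists>h. (\<forall>n::nat. h n \<in> Cfun K)
        \<and> (\<lambda>n. L1d (h n) f) \<longlonglongrightarrow> 0
        \<and> (\<lambda>n. L1d (S (h n)) g) \<longlonglongrightarrow> 0)"

text \<open>Two sequences approximating \<open>f\<close> approach each other in L1, and the
  contraction property passes this on to their images, hence to the limits.\<close>

lemma L1_limit_unique:
  assumes S: "L1_contraction S" and f: "integrable \<mu> f" and "L1_limit S f g" "L1_limit S f g'"
  shows "AE x in \<mu>. g x = g' x"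
proof -
  obtain h where g: "integrable \<mu> g" and h: "\<And>n::nat. h n \<in> Cfun K" "(\<lambda>n. L1d (h n) f) \<longlonglongrightarrow> 0"
    "(\<lambda>n. L1d (S (h n)) g) \<longlonglongrightarrow> 0"
    using assms(3) unfolding L1_limit_def by blast
  obtain k where g': "integrable \<mu> g'" and k: "\<And>n::nat. k n \<in> Cfun K" "(\<lambda>n. L1d (k n) f) \<longlonglongrightarrow> 0"
    "(\<lambda>n. L1d (S (k n)) g') \<longlonglongrightarrow> 0"
    using assms(4) unfolding L1_limit_def by blast
  have i: "integrable \<mu> (h n)" "integrable \<mu> (k n)" "integrable \<mu> (S (h n))" "integrable \<mu> (S (k n))" for n
    using h k S by (auto intro: Cfun_integrable L1_contraction_integrable)
  have "L1d g g' \<le> L1d (S (h n)) g + (L1d (h n) f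
      + (L1d (k n) f)) + L1d (S (k n)) g'" for n
  proof -
    have "L1d g g' \<le> L1d g (S (h n)) + L1d (S (h n)) g'"
      by (intro L1_triangle g g' i)
    also have "L1d (S (h n)) g' \<le> L1d (S (h n)) (S (k n)) + L1d (S (k n)) g'"
      by (intro L1_triangle g g' i)
    also have "L1d (S (h n)) (S (k n)) \<le> L1d (h n) (k n)"
      by (intro L1_contraction_diff S h k)
    also have "\<dots> \<le> L1d (h n) f + L1d f (k n)"
      by (intro L1_triangle f i)
    finally show ?thesis by (simp add: norm_minus_commute)
  qed
  moreover have "(\<lambda>n. L1d (S (h n)) g + (L1d (h n) f
      + (L1d (k n) f)) + (L1d (S (k n)) g')) \<longlonglongrightarrow> 0 + (0 + 0) + 0"
    by (intro tendsto_add h k)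
  ultimately have "L1d g g' \<le> 0"
    by (intro LIMSEQ_le_const) auto
  moreover have "0 \<le> L1d g g'" by (intro integral_nonneg_AE AE_I2) simp
  ultimately have "L1d g g' = 0" by linarith
  then show ?thesis
    using g g' integral_nonneg_eq_0_iff_AE[of \<mu> "\<lambda>x. cmod (g x - g' x)"] by simp
qed

lemma L1_approx_sequence:
  assumes "integrable \<mu> f"
  obtains h where "\<And>n::nat. h n \<in> Cfun K" "(\<lambda>n. L1d (h n) f) \<longlonglongrightarrow> 0"
proof -
  have "\<exists>h\<in>Cfun K. L1d h f < 1 / real (Suc n)" for n
    by (intro Cfun_dense assms) simp
  then obtain h where h: "\<And>n. h n \<in> Cfun K" "\<And>n. L1d (h n) f < 1 / real (Suc n)" by metis
  have "(\<lambda>n. L1d (h n) f) \<longlonglongrightarrow> 0"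
  proof (rule tendsto_sandwich[OF _ _ tendsto_const])
    show "(\<lambda>n. 1 / real (Suc n)) \<longlonglongrightarrow> 0" by (rule LIMSEQ_Suc[OF lim_1_over_n])
    show "\<forall>\<^sub>F n in sequentially. 0 \<le> L1d (h n) f" by (intro always_eventually allI integral_nonneg_AE AE_I2) simp
    show "\<forall>\<^sub>F n in sequentially. L1d (h n) f \<le> 1 / real (Suc n)"
      by (intro always_eventually allI less_imp_le h)
  qed
  then show thesis using that h(1) by blast
qed

lemma L1_limit_exists:
  assumes S: "L1_contraction S" and f: "integrable \<mu> f"
  shows "\<exists>g. L1_limit S f g"
proof -
  obtain h where h: "\<And>n::nat. h n \<in> Cfun K" "(\<lambda>n. L1d (h n) f) \<longlonglongrightarrow> 0"
    using L1_approx_sequence[OF f] by blast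
  have int: "integrable \<mu> (S (h n))" for n by (intro L1_contraction_integrable S h)
  have "\<exists>N. \<forall>i\<ge>N. \<forall>j\<ge>N. (\<integral>x. norm (S (h i) x - S (h j) x) \<partial>\<mu>) < e" if e: "e > 0" for e
  proof -
    have "\<forall>\<^sub>F n in sequentially. L1d (h n) f < e / 2"
      using e h(2) by (intro order_tendstoD) auto
    then obtain N where N: "\<And>n. n \<ge> N \<Longrightarrow> L1d (h n) f < e / 2"
      unfolding eventually_sequentially by blast
    have "(\<integral>x. norm (S (h i) x - S (h j) x) \<partial>\<mu>) < e" if "i \<ge> N" "j \<ge> N" for i j
    proof -
      have "(\<integral>x. norm (S (h i) x - S (h j) x) \<partial>\<mu>) \<le> L1d (h i) (h j)"
        by (intro L1_contraction_diff S h)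
      also have "\<dots> \<le> L1d (h i) f + L1d f (h j)"
        by (intro L1_triangle f Cfun_integrable h)
      also have "\<dots> < e" using N[OF that(1)] N[OF that(2)] by (simp add: norm_minus_commute)
      finally show ?thesis .
    qed
    then show ?thesis by blast
  qed
  from Cauchy_L1_convergent[OF int this] obtain g where
    "integrable \<mu> g" "(\<lambda>n. \<integral>x. norm (S (h n) x - g x) \<partial>\<mu>) \<longlonglongrightarrow> 0" by blast
  then show ?thesis unfolding L1_limit_def using h by blast
qed

lemma L1_ext_limit:
  assumes "L1_contraction S" "integrable \<mu> f"
  shows "L1_limit S f (L1_ext K \<mu> S f)"
proof -
  have "L1_ext K \<mu> S f = (SOME g. L1_limit S f g)" unfolding L1_ext_def L1_limit_def by (rule refl)
  then show ?thesis using someI_ex[OF L1_limit_exists[OF assms]] by simp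
qed

text \<open>A test for fixedness that avoids the chosen representative: a sequence of such
  \<open>h\<close> shows that \<open>f\<close> itself is an admissible value of the extension, and
  admissible values agree almost everywhere.\<close>

lemma L1_fixI:
  assumes f: "integrable \<mu> f" and S: "\<And>S. S \<in> \<S> \<Longrightarrow> L1_contraction S"
    and approx: "\<And>S e. S \<in> \<S> \<Longrightarrow> 0 < e \<Longrightarrow>
      \<exists>h\<in>Cfun K. L1d h f < e \<and> L1d (S h) f < e"
  shows "f \<in> L1_fix K \<S> \<mu>"
  unfolding L1_fix_def
proof (intro CollectI conjI ballI f)
  fix S assume "S \<in> \<S>"
  have "\<exists>h\<in>Cfun K. L1d h f < 1 / real (Suc n) \<and> L1d (S h) f < 1 / real (Suc n)" for n
    by (intro approx \<open>S \<in> \<S>\<close>) simp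
  then obtain h where h: "\<And>n. h n \<in> Cfun K" "\<And>n. L1d (h n) f < 1 / real (Suc n)"
    "\<And>n. L1d (S (h n)) f < 1 / real (Suc n)" by metis
  have lim: "u \<longlonglongrightarrow> 0" if "\<And>n. 0 \<le> u n" "\<And>n. u n < 1 / real (Suc n)" for u :: "nat \<Rightarrow> real"
  proof (rule tendsto_sandwich[OF _ _ tendsto_const])
    show "(\<lambda>n. 1 / real (Suc n)) \<longlonglongrightarrow> 0" by (rule LIMSEQ_Suc[OF lim_1_over_n])
  qed (use that in \<open>auto intro!: always_eventually less_imp_le\<close>)
  have "L1_limit S f f"
    unfolding L1_limit_def
  proof (intro conjI f exI[of _ h] allI h)
    show "(\<lambda>n. L1d (h n) f) \<longlonglongrightarrow> 0" by (intro lim h integral_nonneg_AE AE_I2) simp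
    show "(\<lambda>n. L1d (S (h n)) f) \<longlonglongrightarrow> 0" by (intro lim h integral_nonneg_AE AE_I2) simp
  qed
  then show "AE x in \<mu>. L1_ext K \<mu> S f x = f x"
    using L1_limit_unique L1_ext_limit S \<open>S \<in> \<S>\<close> f by blast
qed

text \<open>The converse of \<open>L1_fixI\<close>; with both at hand the extended operators can be
  replaced by approximation within \<open>Cfun K\<close>.\<close>

lemma L1_fix_approx:
  assumes f: "f \<in> L1_fix K \<S> \<mu>" and S: "S \<in> \<S>" "L1_contraction S" and e: "0 < e"
  shows "\<exists>h\<in>Cfun K. L1d h f < e \<and> L1d (S h) f < e"
proof -
  have fi: "integrable \<mu> f" and ae: "AE x in \<mu>. L1_ext K \<mu> S f x = f x"
    using f S unfolding L1_fix_def by blast+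
  obtain h where h: "\<And>n::nat. h n \<in> Cfun K" "(\<lambda>n. L1d (h n) f) \<longlonglongrightarrow> 0"
    "(\<lambda>n. L1d (S (h n)) (L1_ext K \<mu> S f)) \<longlonglongrightarrow> 0"
    and gi: "integrable \<mu> (L1_ext K \<mu> S f)"
    using L1_ext_limit[OF S(2) fi] unfolding L1_limit_def by blast
  have "L1d (S (h n)) (L1_ext K \<mu> S f) = L1d (S (h n)) f" for n
  proof (intro integral_cong_AE)
    have [measurable]: "S (h n) \<in> borel_measurable \<mu>" "f \<in> borel_measurable \<mu>" "L1_ext K \<mu> S f \<in> borel_measurable \<mu>"
      using L1_contraction_integrable[OF S(2) h(1)] fi gi by auto
    show "(\<lambda>x. cmod (S (h n) x - L1_ext K \<mu> S f x)) \<in> borel_measurable \<mu>"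
      "(\<lambda>x. cmod (S (h n) x - f x)) \<in> borel_measurable \<mu>" by measurable
    show "AE x in \<mu>. cmod (S (h n) x - L1_ext K \<mu> S f x) = cmod (S (h n) x - f x)"
      using ae by eventually_elim simp
  qed
  then have "(\<lambda>n. L1d (S (h n)) f) \<longlonglongrightarrow> 0" using h(3) by simp
  then have "\<forall>\<^sub>F n in sequentially. L1d (h n) f < e \<and> L1d (S (h n)) f < e"
    using h(2) e by (intro eventually_conj order_tendstoD) auto
  then obtain n where "L1d (h n) f < e \<and> L1d (S (h n)) f < e"
    unfolding eventually_sequentially by blast
  then show ?thesis using h(1) by blast
qed

end

text \<open>For a Markov operator the real part loses nothing, because real functions are mapped to
  real functions.\<close>

definition real_op :: "'a topology \<Rightarrow> 'a oper \<Rightarrow> ('a \<Rightarrow> real) \<Rightarrow> 'a \<Rightarrow> real" where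
  "real_op K S u = (\<lambda>x. Re (S (cplx K u) x))"

abbreviation (in compact_hausdorff) rop :: "'a oper \<Rightarrow> ('a \<Rightarrow> real) \<Rightarrow> 'a \<Rightarrow> real" where
  "rop \<equiv> real_op K"

section \<open>Markov operators on complex and on real functions\<close>

locale markov_operator = compact_hausdorff +
  fixes S :: "'a oper"
  assumes markov: "markov_op K S"
begin

lemma S_Cfun: "f \<in> Cfun K \<Longrightarrow> S f \<in> Cfun K"
  and S_add: "f \<in> Cfun K \<Longrightarrow> g \<in> Cfun K \<Longrightarrow> S (\<lambda>x. f x + g x) = (\<lambda>x. S f x + S g x)"
  and S_cmult: "f \<in> Cfun K \<Longrightarrow> S (\<lambda>x. c * f x) = (\<lambda>x. c * S f x)"
  and S_nonneg: "f \<in> Cfun K \<Longrightarrow> nonneg_fun f \<Longrightarrow> nonneg_fun (S f)"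
  and S_one: "S (one_on K) = one_on K"
  using markov unfolding markov_op_def bounded_ops_def clinear_op_on_def by blast+

lemma S_diff:
  assumes f: "f \<in> Cfun K" and g: "g \<in> Cfun K"
  shows "S (\<lambda>x. f x - g x) = (\<lambda>x. S f x - S g x)"
  using S_add[OF f Cfun_cmult[OF g, of "-1"]] S_cmult[OF g, of "-1"] by simp

text \<open>Adding a large constant makes \<open>f\<close> nonnegative, so the image of the sum is
  real; the operator reproduces the constant on the carrier.\<close>

lemma S_real:
  assumes f: "f \<in> Cfun K" and real: "\<And>x. Im (f x) = 0"
  shows "Im (S f x) = 0"
proof -
  obtain B where B: "B > 0" "\<And>x. cmod (f x) \<le> B" using Cfun_bounded[OF f] by blast
  let ?g = "\<lambda>x. f x + of_real B * one_on K x"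
  have oB: "(\<lambda>x. of_real B * one_on K x) \<in> Cfun K" by (intro Cfun_cmult Cfun_one)
  have "nonneg_fun ?g"
    unfolding nonneg_fun_def
  proof
    fix x
    have "- B \<le> Re (f x)" using B(2)[of x] abs_Re_le_cmod[of "f x"] by linarith
    then show "f x + of_real B * one_on K x \<in> \<real>\<^sub>\<ge>\<^sub>0"
      using real[of x] Cfun_off[OF f, of x]
      by (cases "x \<in> topspace K") (auto simp: complex_nonneg_Reals_iff)
  qed
  then have "nonneg_fun (S ?g)" by (intro S_nonneg Cfun_add f oB)
  moreover have "S ?g = (\<lambda>x. S f x + of_real B * one_on K x)"
    using S_add[OF f oB] S_cmult[OF Cfun_one] S_one by simp
  ultimately have "S f x + of_real B * one_on K x \<in> \<real>\<^sub>\<ge>\<^sub>0" unfolding nonneg_fun_def by metis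
  then show ?thesis by (cases "x \<in> topspace K") (auto simp: complex_nonneg_Reals_iff)
qed

lemma S_Re:
  assumes f: "f \<in> Cfun K"
  shows "S (\<lambda>x. of_real (Re (f x))) = (\<lambda>x. of_real (Re (S f x)))"
proof
  fix x
  let ?R = "\<lambda>x. complex_of_real (Re (f x))" and ?I = "\<lambda>x. complex_of_real (Im (f x))"
  have R: "?R \<in> Cfun K" and I: "?I \<in> Cfun K" using f by (auto intro: Cfun_Re Cfun_Im)
  have "S f = S (\<lambda>x. ?R x + \<i> * ?I x)" by (simp flip: complex_eq)
  also have "\<dots> = (\<lambda>x. S ?R x + \<i> * S ?I x)" using S_add[OF R Cfun_cmult[OF I]] S_cmult[OF I] by simp
  finally have "Re (S f x) = Re (S ?R x)" using S_real[OF I, of x] by simp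
  then show "S ?R x = of_real (Re (S f x))" using S_real[OF R, of x] by (simp add: complex_eq_iff)
qed

lemma S_mono:
  assumes f: "f \<in> Cfun K" and g: "g \<in> Cfun K" and le: "\<And>x. Re (f x) \<le> Re (g x)"
  shows "Re (S f x) \<le> Re (S g x)"
proof -
  let ?h = "\<lambda>x. g x - f x"
  have h: "?h \<in> Cfun K" using f g by (intro Cfun_diff)
  have "nonneg_fun (S (\<lambda>x. of_real (Re (?h x))))"
    using le by (intro S_nonneg Cfun_Re h) (simp add: nonneg_fun_def complex_nonneg_Reals_iff)
  then have "0 \<le> Re (S ?h x)" unfolding S_Re[OF h] nonneg_fun_def by (simp add: complex_nonneg_Reals_iff)
  then show ?thesis using S_diff[OF g f] by simp
qed

text \<open>A unimodular \<open>c\<close> turns \<open>S f x\<close> into its modulus, and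
  \<open>Re (c * f x)\<close> is at most the modulus of \<open>f\<close>, so monotonicity applies.
  The value 1 keeps \<open>c\<close> unimodular when \<open>S f x\<close> is 0.\<close>

lemma S_modulus:
  assumes f: "f \<in> Cfun K"
  shows "cmod (S f x) \<le> Re (S (modulus f) x)"
proof -
  define c where "c = (if S f x = 0 then 1 else cnj (S f x) / cmod (S f x))"
  have c: "cmod c = 1" by (auto simp: c_def norm_divide)
  have "c * S f x = cmod (S f x)"
    using complex_norm_square[of "S f x"] by (auto simp: c_def power2_eq_square divide_eq_eq mult.commute)
  then have "cmod (S f x) = Re (S (\<lambda>x. c * f x) x)" using S_cmult[OF f] by simp
  also have "\<dots> \<le> Re (S (modulus f) x)"
  proof (intro S_mono Cfun_cmult Cfun_modulus f)
    fix x show "Re (c * f x) \<le> Re (modulus f x)"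
      using complex_Re_le_cmod[of "c * f x"] c by (simp add: modulus_def norm_mult)
  qed
  finally show ?thesis .
qed

lemma real_op_cont: "cont u \<Longrightarrow> cont (rop S u)"
  unfolding real_op_def by (intro continuous_map_Re S_Cfun cplx_in_Cfun)

lemma S_cplx:
  assumes "cont u"
  shows "S (cplx K u) = cplx K (rop S u)"
proof
  fix x
  show "S (cplx K u) x = cplx K (rop S u) x"
    using S_real[OF cplx_in_Cfun[OF assms], of x] Cfun_off[OF S_Cfun[OF cplx_in_Cfun[OF assms]], of x]
    by (auto simp: cplx_def real_op_def complex_eq_iff)
qed

lemma cplx_add: "cplx K (\<lambda>x. u x + v x) = (\<lambda>x. cplx K u x + cplx K v x)"
  and cplx_diff: "cplx K (\<lambda>x. u x - v x) = (\<lambda>x. cplx K u x - cplx K v x)"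
  and cplx_scale: "cplx K (\<lambda>x. c * u x) = (\<lambda>x. of_real c * cplx K u x)"
  and cplx_one: "cplx K (\<lambda>x. 1) = one_on K"
  by (auto simp: cplx_def indicator_def)

lemma real_op_add: "cont u \<Longrightarrow> cont v \<Longrightarrow> rop S (\<lambda>x. u x + v x) = (\<lambda>x. rop S u x + rop S v x)"
  and real_op_diff: "cont u \<Longrightarrow> cont v \<Longrightarrow> rop S (\<lambda>x. u x - v x) = (\<lambda>x. rop S u x - rop S v x)"
  and real_op_scale: "cont u \<Longrightarrow> rop S (\<lambda>x. c * u x) = (\<lambda>x. c * rop S u x)"
  by (simp_all add: real_op_def cplx_add cplx_diff cplx_scale S_add S_diff S_cmult cplx_in_Cfun)

lemma real_op_one: "x \<in> topspace K \<Longrightarrow> rop S (\<lambda>x. 1) x = 1"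
  by (simp add: real_op_def cplx_one S_one)

lemma real_op_mono:
  assumes "cont u" "cont v" "\<And>x. x \<in> topspace K \<Longrightarrow> u x \<le> v x"
  shows "rop S u x \<le> rop S v x"
  unfolding real_op_def using assms by (intro S_mono cplx_in_Cfun) (auto simp: cplx_def)

lemma real_op_abs:
  assumes u: "cont u"
  shows "\<bar>rop S u x\<bar> \<le> rop S (\<lambda>x. \<bar>u x\<bar>) x"
proof -
  have c: "cont (\<lambda>x. \<bar>u x\<bar>)" "cont (\<lambda>x. -1 * u x)"
    using u by (auto intro: continuous_map_real_abs)
  have "rop S u x \<le> rop S (\<lambda>x. \<bar>u x\<bar>) x" by (intro real_op_mono u c) simp
  moreover have "rop S (\<lambda>x. -1 * u x) x \<le> rop S (\<lambda>x. \<bar>u x\<bar>) x" by (intro real_op_mono u c) simp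
  ultimately show ?thesis unfolding real_op_scale[OF u] by simp
qed

end

section \<open>The lattice of fixed functions of an invariant measure\<close>

locale markov_system = compact_hausdorff +
  fixes \<S> :: "'a oper set"
  assumes semigroup: "markov_semigroup K \<S>"
begin

lemma markov_operator: "S \<in> \<S> \<Longrightarrow> markov_operator K S"
  using semigroup by unfold_locales (simp add: markov_semigroup_def)

lemmas op_Cfun = markov_operator.S_Cfun[OF markov_operator]
  and op_modulus = markov_operator.S_modulus[OF markov_operator]
  and op_diff = markov_operator.S_diff[OF markov_operator]
  and op_cplx = markov_operator.S_cplx[OF markov_operator]
  and op_one = markov_operator.S_one[OF markov_operator]
  and op_cmult = markov_operator.S_cmult[OF markov_operator]

lemmas rop_cont = markov_operator.real_op_cont[OF markov_operator]
  and rop_add = markov_operator.real_op_add[OF markov_operator]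
  and rop_diff = markov_operator.real_op_diff[OF markov_operator]
  and rop_scale = markov_operator.real_op_scale[OF markov_operator]
  and rop_one = markov_operator.real_op_one[OF markov_operator]
  and rop_mono = markov_operator.real_op_mono[OF markov_operator]
  and rop_abs = markov_operator.real_op_abs[OF markov_operator]

lemma rop_const: "S \<in> \<S> \<Longrightarrow> x \<in> topspace K \<Longrightarrow> rop S (\<lambda>x. c) x = c"
  using rop_scale[of S "\<lambda>x. 1" c] rop_one[of S x] by simp

lemma comp: "S \<in> \<S> \<Longrightarrow> T \<in> \<S> \<Longrightarrow> S \<circ> T \<in> \<S>"
  using semigroup by (simp add: markov_semigroup_def)

end

locale invariant_measure = markov_system + regular_measure +
  assumes invariant: "\<And>S f. S \<in> \<S> \<Longrightarrow> f \<in> Cfun K \<Longrightarrow> integral\<^sup>L \<mu> (S f) = integral\<^sup>L \<mu> f"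
begin

text \<open>The pointwise bound \<open>op_modulus\<close> is integrated, and invariance of the
  measure then removes the operator.\<close>

lemma contraction:
  assumes S: "S \<in> \<S>"
  shows "L1_contraction S"
  unfolding L1_contraction_def
proof (intro conjI ballI op_Cfun[OF S] op_diff[OF S])
  fix f assume f: "f \<in> Cfun K"
  have Sm: "S (modulus f) \<in> Cfun K" by (intro op_Cfun[OF S] Cfun_modulus f)
  have "(\<integral>x. cmod (S f x) \<partial>\<mu>) \<le> (\<integral>x. Re (S (modulus f) x) \<partial>\<mu>)"
    using Cfun_integrable[OF Sm] Cfun_integrable[OF op_Cfun[OF S f]]
    by (intro integral_mono op_modulus[OF S f]) auto
  also have "\<dots> = Re (\<integral>x. modulus f x \<partial>\<mu>)"
    using Cfun_integrable[OF Sm] invariant[OF S Cfun_modulus[OF f]] by simp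
  also have "\<dots> = (\<integral>x. cmod (f x) \<partial>\<mu>)" by (simp add: modulus_def)
  finally show "(\<integral>x. cmod (S f x) \<partial>\<mu>) \<le> (\<integral>x. cmod (f x) \<partial>\<mu>)" .
qed

lemma rop_invariant:
  assumes S: "S \<in> \<S>" and u: "cont u"
  shows "(\<integral>x. rop S u x \<partial>\<mu>) = (\<integral>x. u x \<partial>\<mu>)"
proof -
  have "(\<integral>x. cplx K v x \<partial>\<mu>) = of_real (\<integral>x. v x \<partial>\<mu>)" for v
  proof -
    have "(\<integral>x. cplx K v x \<partial>\<mu>) = (\<integral>x. complex_of_real (v x) \<partial>\<mu>)"
      by (intro Bochner_Integration.integral_cong) (auto simp: cplx_def space_mu)
    then show ?thesis by simp
  qed
  then show ?thesis using invariant[OF S cplx_in_Cfun[OF u]] op_cplx[OF S u] by simp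
qed

lemma rop_contraction:
  assumes S: "S \<in> \<S>" and u: "cont u"
  shows "(\<integral>x. \<bar>rop S u x\<bar> \<partial>\<mu>) \<le> (\<integral>x. \<bar>u x\<bar> \<partial>\<mu>)"
proof -
  have a: "cont (\<lambda>x. \<bar>u x\<bar>)" using u by (rule continuous_map_real_abs)
  have "(\<integral>x. \<bar>rop S u x\<bar> \<partial>\<mu>) \<le> (\<integral>x. rop S (\<lambda>x. \<bar>u x\<bar>) x \<partial>\<mu>)"
    by (intro integral_mono rop_abs S u integrable_abs cont_integrable rop_cont a)
  then show ?thesis using rop_invariant[OF S a] by simp
qed

text \<open>The approximation form of being fixed in real L1; \<open>h\<close> may depend on
  \<open>S\<close> as well as on \<open>e\<close>. Mentioning only continuous real functions, it
  lets positivity of \<open>S\<close> be used directly in the lattice operations.\<close>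

definition real_fixed :: "('a \<Rightarrow> real) \<Rightarrow> bool" where
  "real_fixed u \<longleftrightarrow> integrable \<mu> u \<and> (\<forall>S\<in>\<S>. \<forall>e>0. \<exists>h. cont h \<and>
     L1r h u < e \<and> L1r (rop S h) u < e)"

lemma real_fixedE:
  assumes "real_fixed u" "S \<in> \<S>" "0 < e"
  obtains h where "cont h" "L1r h u < e" "L1r (rop S h) u < e"
    "integrable \<mu> h" "integrable \<mu> (rop S h)"
  using assms cont_integrable rop_cont unfolding real_fixed_def by blast

lemma real_fixed_integrable: "real_fixed u \<Longrightarrow> integrable \<mu> u"
  by (simp add: real_fixed_def)

text \<open>The factor \<open>c\<close> serves both parts at once: 1 gives the real part and
  \<open>- \<i>\<close> the imaginary part. Since it is unimodular, L1 distances do not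
  grow.\<close>

lemma L1_fix_real_fixed:
  assumes f: "f \<in> L1_fix K \<S> \<mu>" and c: "cmod c = 1"
  shows "real_fixed (\<lambda>x. Re (c * f x))"
  unfolding real_fixed_def
proof (intro conjI ballI allI impI)
  have fi: "integrable \<mu> f" using f by (simp add: L1_fix_def)
  then show "integrable \<mu> (\<lambda>x. Re (c * f x))" by simp
  fix S and e :: real assume S: "S \<in> \<S>" and e: "0 < e"
  obtain h where h: "h \<in> Cfun K" "L1d h f < e" "L1d (S h) f < e"
    using L1_fix_approx[OF f S contraction[OF S] e] by blast
  let ?h = "\<lambda>x. Re (c * h x)"
  have ch: "(\<lambda>x. c * h x) \<in> Cfun K" by (intro Cfun_cmult h)
  have "cplx K ?h = (\<lambda>x. of_real (Re (c * h x)))"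
    using Cfun_off[OF h(1)] by (auto simp: cplx_def)
  then have rop: "rop S ?h = (\<lambda>x. Re (c * S h x))"
    using markov_operator.S_Re[OF markov_operator[OF S] ch] op_cmult[OF S h(1)]
    by (simp add: real_op_def)
  have le: "(\<integral>x. \<bar>Re (c * k x) - Re (c * f x)\<bar> \<partial>\<mu>) \<le> L1d k f"
    if k: "integrable \<mu> k" for k
  proof (intro integral_mono)
    show "integrable \<mu> (\<lambda>x. \<bar>Re (c * k x) - Re (c * f x)\<bar>)" "integrable \<mu> (\<lambda>x. cmod (k x - f x))"
      using k fi by auto
    fix x
    have "\<bar>Re (c * (k x - f x))\<bar> \<le> cmod (c * (k x - f x))" by (rule abs_Re_le_cmod)
    also have "\<dots> = cmod (k x - f x)" by (simp only: norm_mult c mult_1)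
    finally show "\<bar>Re (c * k x) - Re (c * f x)\<bar> \<le> cmod (k x - f x)"
      unfolding right_diff_distrib minus_complex.sel .
  qed
  have 1: "(\<integral>x. \<bar>?h x - Re (c * f x)\<bar> \<partial>\<mu>) < e"
    using le[OF Cfun_integrable[OF h(1)]] h(2) by linarith
  have 2: "(\<integral>x. \<bar>rop S ?h x - Re (c * f x)\<bar> \<partial>\<mu>) < e"
    unfolding rop using le[OF Cfun_integrable[OF op_Cfun[OF S h(1)]]] h(3) by linarith
  show "\<exists>h. cont h \<and> (\<integral>x. \<bar>h x - Re (c * f x)\<bar> \<partial>\<mu>) < e \<and> (\<integral>x. \<bar>rop S h x - Re (c * f x)\<bar> \<partial>\<mu>) < e"
    using 1 2 continuous_map_Re[OF ch] by blast
qed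

lemma real_fixed_const: "real_fixed (\<lambda>x. c)"
  unfolding real_fixed_def
proof (intro conjI ballI allI impI)
  fix S and e :: real assume S: "S \<in> \<S>" and e: "0 < e"
  have "(\<integral>x. \<bar>rop S (\<lambda>x. c) x - c\<bar> \<partial>\<mu>) = (\<integral>x. 0 \<partial>\<mu>)"
    by (intro Bochner_Integration.integral_cong) (auto simp: rop_const[OF S] space_mu)
  then show "\<exists>h. cont h \<and> (\<integral>x. \<bar>h x - c\<bar> \<partial>\<mu>) < e \<and> (\<integral>x. \<bar>rop S h x - c\<bar> \<partial>\<mu>) < e"
    using e by (intro exI[of _ "\<lambda>x. c"]) simp
qed simp

lemma real_fixed_scale:
  assumes u: "real_fixed u"
  shows "real_fixed (\<lambda>x. c * u x)"
  unfolding real_fixed_def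
proof (intro conjI ballI allI impI)
  show "integrable \<mu> (\<lambda>x. c * u x)" using u by (simp add: real_fixed_integrable)
  fix S and e :: real assume S: "S \<in> \<S>" and e: "0 < e"
  define d where "d = e / (\<bar>c\<bar> + 1)"
  have d: "0 < d" unfolding d_def using e by (simp add: add_nonneg_pos)
  obtain h where h: "cont h" "L1r h u < d" "L1r (rop S h) u < d"
    using real_fixedE[OF u S d] by blast
  have ce: "\<bar>c\<bar> * t < e" if "t < d" "0 \<le> t" for t
  proof -
    have "\<bar>c\<bar> * t \<le> (\<bar>c\<bar> + 1) * t" using that by (intro mult_right_mono) auto
    also have "\<dots> < (\<bar>c\<bar> + 1) * d" using that by (intro mult_strict_left_mono) auto
    also have "\<dots> = e" unfolding d_def by (simp add: add_nonneg_pos)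
    finally show ?thesis .
  qed
  have int: "(\<integral>x. \<bar>c * v x - c * u x\<bar> \<partial>\<mu>) = \<bar>c\<bar> * L1r v u" for v
  proof -
    have "\<bar>c * v x - c * u x\<bar> = \<bar>c\<bar> * \<bar>v x - u x\<bar>" for x
      by (simp flip: right_diff_distrib add: abs_mult)
    then show ?thesis by simp
  qed
  have "cont (\<lambda>x. c * h x)" using h(1) by (intro continuous_map_real_mult) auto
  moreover have "(\<integral>x. \<bar>c * h x - c * u x\<bar> \<partial>\<mu>) < e" unfolding int by (intro ce h) simp
  moreover have "(\<integral>x. \<bar>rop S (\<lambda>x. c * h x) x - c * u x\<bar> \<partial>\<mu>) < e"
    unfolding rop_scale[OF S h(1)] int by (intro ce h) simp
  ultimately show "\<exists>h. cont h \<and> (\<integral>x. \<bar>h x - c * u x\<bar> \<partial>\<mu>) < e \<and> (\<integral>x. \<bar>rop S h x - c * u x\<bar> \<partial>\<mu>) < e"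
    by blast
qed

lemma real_fixed_add:
  assumes u: "real_fixed u" and v: "real_fixed v"
  shows "real_fixed (\<lambda>x. u x + v x)"
  unfolding real_fixed_def
proof (intro conjI ballI allI impI)
  have ui: "integrable \<mu> u" and vi: "integrable \<mu> v" using u v real_fixed_integrable by blast+
  then show "integrable \<mu> (\<lambda>x. u x + v x)" by simp
  fix S and e :: real assume S: "S \<in> \<S>" and e: "0 < e"
  have e2: "0 < e / 2" using e by simp
  obtain h where h: "cont h" "L1r h u < e / 2" "L1r (rop S h) u < e / 2"
    "integrable \<mu> h" "integrable \<mu> (rop S h)"
    using real_fixedE[OF u S e2] by blast
  obtain k where k: "cont k" "L1r k v < e / 2" "L1r (rop S k) v < e / 2"
    "integrable \<mu> k" "integrable \<mu> (rop S k)"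
    using real_fixedE[OF v S e2] by blast
  have int: "(\<integral>x. \<bar>(a x + b x) - (u x + v x)\<bar> \<partial>\<mu>) < e"
    if ab: "L1r a u < e / 2" "L1r b v < e / 2"
      "integrable \<mu> a" "integrable \<mu> b" for a b
  proof -
    have "(\<integral>x. \<bar>(a x + b x) - (u x + v x)\<bar> \<partial>\<mu>) \<le> (\<integral>x. \<bar>a x - u x\<bar> + \<bar>b x - v x\<bar> \<partial>\<mu>)"
      using ab ui vi by (intro integral_mono) auto
    also have "\<dots> < e" using ab ui vi by simp
    finally show ?thesis .
  qed
  have "cont (\<lambda>x. h x + k x)" using h(1) k(1) by (rule continuous_map_add)
  moreover have "(\<integral>x. \<bar>h x + k x - (u x + v x)\<bar> \<partial>\<mu>) < e" by (intro int h k)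
  moreover have "(\<integral>x. \<bar>rop S (\<lambda>x. h x + k x) x - (u x + v x)\<bar> \<partial>\<mu>) < e"
    unfolding rop_add[OF S h(1) k(1)] by (intro int h k)
  ultimately show "\<exists>h. cont h \<and> (\<integral>x. \<bar>h x - (u x + v x)\<bar> \<partial>\<mu>) < e
      \<and> (\<integral>x. \<bar>rop S h x - (u x + v x)\<bar> \<partial>\<mu>) < e" by blast
qed

text \<open>Positivity gives \<open>|S h| \<le> S |h|\<close> pointwise, and both sides have nearly the same integral when
  \<open>h\<close> is nearly fixed.\<close>

lemma real_fixed_abs:
  assumes u: "real_fixed u"
  shows "real_fixed (\<lambda>x. \<bar>u x\<bar>)"
  unfolding real_fixed_def
proof (intro conjI ballI allI impI)
  have ui: "integrable \<mu> u" using u real_fixed_integrable by blast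
  then show "integrable \<mu> (\<lambda>x. \<bar>u x\<bar>)" by simp
  fix S and e :: real assume S: "S \<in> \<S>" and e: "0 < e"
  have e3: "0 < e / 3" using e by simp
  obtain h where h: "cont h" "L1r h u < e / 3" "L1r (rop S h) u < e / 3"
    "integrable \<mu> h" "integrable \<mu> (rop S h)"
    using real_fixedE[OF u S e3] by blast
  let ?a = "\<lambda>x. \<bar>h x\<bar>"
  have a: "cont ?a" using h(1) by (rule continuous_map_real_abs)
  have ai: "integrable \<mu> (rop S ?a)" by (intro cont_integrable rop_cont S a)
  have 1: "(\<integral>x. \<bar>?a x - \<bar>u x\<bar>\<bar> \<partial>\<mu>) \<le> L1r h u"
    using h ui by (intro integral_mono) auto
  have "(\<integral>x. \<bar>rop S ?a x - \<bar>u x\<bar>\<bar> \<partial>\<mu>)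
      \<le> (\<integral>x. (rop S ?a x - \<bar>rop S h x\<bar>) + \<bar>rop S h x - u x\<bar> \<partial>\<mu>)"
  proof (intro integral_mono)
    fix x
    show "\<bar>rop S ?a x - \<bar>u x\<bar>\<bar> \<le> (rop S ?a x - \<bar>rop S h x\<bar>) + \<bar>rop S h x - u x\<bar>"
      using rop_abs[OF S h(1), of x] by linarith
  qed (use h ui ai in auto)
  also have "\<dots> = (\<integral>x. \<bar>h x\<bar> \<partial>\<mu>) - (\<integral>x. \<bar>rop S h x\<bar> \<partial>\<mu>) + L1r (rop S h) u"
    using h ui ai rop_invariant[OF S a] by simp
  also have "(\<integral>x. \<bar>h x\<bar> \<partial>\<mu>) \<le> (\<integral>x. \<bar>rop S h x\<bar> + (\<bar>rop S h x - u x\<bar> + \<bar>h x - u x\<bar>) \<partial>\<mu>)"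
    using h ui by (intro integral_mono) auto
  also have "\<dots> = (\<integral>x. \<bar>rop S h x\<bar> \<partial>\<mu>) + (L1r (rop S h) u + L1r h u)"
    using h ui by simp
  finally have 2: "(\<integral>x. \<bar>rop S ?a x - \<bar>u x\<bar>\<bar> \<partial>\<mu>) < e" using h(2,3) by linarith
  have 3: "(\<integral>x. \<bar>?a x - \<bar>u x\<bar>\<bar> \<partial>\<mu>) < e" using 1 h(2) e by linarith
  show "\<exists>h. cont h \<and> (\<integral>x. \<bar>h x - \<bar>u x\<bar>\<bar> \<partial>\<mu>) < e \<and> (\<integral>x. \<bar>rop S h x - \<bar>u x\<bar>\<bar> \<partial>\<mu>) < e"
    using 2 3 a by blast
qed

lemma real_fixed_diff: "real_fixed u \<Longrightarrow> real_fixed v \<Longrightarrow> real_fixed (\<lambda>x. u x - v x)"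
  using real_fixed_add[OF _ real_fixed_scale[of v "-1"], of u] by simp

lemma real_fixed_max:
  assumes "real_fixed u" "real_fixed v"
  shows "real_fixed (\<lambda>x. max (u x) (v x))"
proof -
  have "real_fixed (\<lambda>x. 1 / 2 * ((u x + v x) + \<bar>u x - v x\<bar>))"
    by (intro real_fixed_scale real_fixed_add real_fixed_abs real_fixed_diff assms)
  moreover have "(\<lambda>x. 1 / 2 * ((u x + v x) + \<bar>u x - v x\<bar>)) = (\<lambda>x. max (u x) (v x))"
    by (auto simp: max_def field_simps)
  ultimately show ?thesis by simp
qed

lemma real_fixed_min:
  assumes "real_fixed u" "real_fixed v"
  shows "real_fixed (\<lambda>x. min (u x) (v x))"
proof -
  have "real_fixed (\<lambda>x. 1 / 2 * ((u x + v x) - \<bar>u x - v x\<bar>))"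
    by (intro real_fixed_scale real_fixed_add real_fixed_diff real_fixed_abs assms)
  moreover have "(\<lambda>x. 1 / 2 * ((u x + v x) - \<bar>u x - v x\<bar>)) = (\<lambda>x. min (u x) (v x))"
    by (auto simp: min_def field_simps)
  ultimately show ?thesis by simp
qed

lemma real_fixed_limit:
  assumes v: "\<And>n::nat. real_fixed (v n)" and u: "integrable \<mu> u"
    and lim: "(\<lambda>n. L1r (v n) u) \<longlonglongrightarrow> 0"
  shows "real_fixed u"
  unfolding real_fixed_def
proof (intro conjI ballI allI impI u)
  fix S and e :: real assume S: "S \<in> \<S>" and e: "0 < e"
  have e2: "0 < e / 2" using e by simp
  obtain n where n: "L1r (v n) u < e / 2"
    using order_tendstoD(2)[OF lim e2] unfolding eventually_sequentially by blast
  obtain h where h: "cont h" "L1r h (v n) < e / 2" "L1r (rop S h) (v n) < e / 2"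
    "integrable \<mu> h" "integrable \<mu> (rop S h)"
    using real_fixedE[OF v S e2] by blast
  have vi: "integrable \<mu> (v n)" using v real_fixed_integrable by blast
  have "L1r h u < e"
    using L1_triangle[OF h(4) vi u] n h(2) by simp
  moreover have "L1r (rop S h) u < e"
    using L1_triangle[OF h(5) vi u] n h(3) by simp
  ultimately show "\<exists>h. cont h \<and> L1r h u < e \<and> L1r (rop S h) u < e"
    using h(1) by blast
qed

lemma superlevel_sets:
  assumes "integrable \<mu> (u :: 'a \<Rightarrow> real)"
  shows "{x \<in> topspace K. 0 < u x} \<in> sets \<mu>"
proof -
  have "u -` {0<..} \<inter> space \<mu> \<in> sets \<mu>"
    using assms by (intro measurable_sets[OF borel_measurable_integrable]) auto
  moreover have "u -` {0<..} \<inter> space \<mu> = {x \<in> topspace K. 0 < u x}" by (auto simp: space_mu)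
  ultimately show ?thesis by simp
qed

text \<open>The indicator is the L1 limit of the functions \<open>min 1 (n * max u 0)\<close>, which
  are fixed because constants are fixed and the fixed functions form a vector lattice.\<close>

lemma real_fixed_superlevel:
  assumes u: "real_fixed u"
  shows "real_fixed (indicator {x \<in> topspace K. 0 < u x})"
proof -
  let ?A = "{x \<in> topspace K. 0 < u x}"
  have ui: "integrable \<mu> u" using u real_fixed_integrable by blast
  have A: "?A \<in> sets \<mu>" by (rule superlevel_sets[OF ui])
  define v where "v n x = min 1 (real n * max (u x) 0)" for n x
  have v: "real_fixed (v n)" for n
    unfolding v_def by (intro real_fixed_min real_fixed_const real_fixed_scale real_fixed_max u)
  have Ai: "integrable \<mu> (indicator ?A :: 'a \<Rightarrow> real)"
    using A by (intro integrable_real_indicator) (auto simp: emeasure_eq_measure)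
  show ?thesis
  proof (rule real_fixed_limit[OF v Ai])
    have "(\<lambda>n. L1r (v n) (indicator ?A)) \<longlonglongrightarrow> (\<integral>x. 0 \<partial>\<mu>)"
    proof (rule integral_dominated_convergence[where w="\<lambda>x. 1"])
      show "AE x in \<mu>. (\<lambda>n. \<bar>v n x - indicator ?A x\<bar>) \<longlonglongrightarrow> 0"
      proof (rule AE_I2)
        fix x assume x: "x \<in> space \<mu>"
        show "(\<lambda>n. \<bar>v n x - indicator ?A x\<bar>) \<longlonglongrightarrow> 0"
        proof (cases "0 < u x")
          case True
          obtain N where N: "1 < real N * u x" using reals_Archimedean3[OF True] by blast
          have "v n x = 1" if "n \<ge> N" for n
          proof -
            have "real N * u x \<le> real n * u x" using that True by (intro mult_right_mono) auto
            then have "1 \<le> real n * u x" using N by linarith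
            then show ?thesis using True by (simp add: v_def)
          qed
          then have "\<forall>\<^sub>F n in sequentially. \<bar>v n x - indicator ?A x\<bar> = 0"
            using True x by (intro eventually_sequentiallyI[of N]) (simp add: space_mu)
          then show ?thesis by (rule tendsto_eventually)
        next
          case False
          then have "\<bar>v n x - indicator ?A x\<bar> = 0" for n by (simp add: v_def)
          then show ?thesis by simp
        qed
      qed
      show "AE x in \<mu>. norm \<bar>v n x - indicator ?A x\<bar> \<le> 1" for n
      proof (rule AE_I2)
        fix x
        have "0 \<le> v n x" "v n x \<le> 1" by (auto simp: v_def)
        then show "norm \<bar>v n x - indicator ?A x\<bar> \<le> 1" by (auto simp: indicator_def)
      qed
      show "(\<lambda>x. \<bar>v n x - indicator ?A x\<bar>) \<in> borel_measurable \<mu>" for n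
        using real_fixed_integrable[OF v] Ai by auto
    qed simp_all
    then show "(\<lambda>n. L1r (v n) (indicator ?A)) \<longlonglongrightarrow> 0" by simp
  qed
qed

lemma rop_abs_le:
  assumes "S \<in> \<S>" "cont u" "cont v" "\<And>x. x \<in> topspace K \<Longrightarrow> \<bar>u x\<bar> \<le> v x"
  shows "\<bar>rop S u x\<bar> \<le> rop S v x"
proof -
  have "rop S (\<lambda>x. \<bar>u x\<bar>) x \<le> rop S v x"
    by (intro rop_mono assms continuous_map_real_abs)
  then show ?thesis using rop_abs[OF assms(1,2), of x] by linarith
qed

text \<open>This makes the restriction of \<open>\<mu>\<close> to a fixed set invariant. Let
  \<open>h\<close> be continuous with \<open>h\<close> and \<open>S h\<close> close to the indicator
  of \<open>A\<close>. Then \<open>g * h\<close> has an image that is small in L1 off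
  \<open>A\<close>, and \<open>g * (1 - h)\<close> one that is small on \<open>A\<close>. So cutting
  \<open>S g\<close> down to \<open>A\<close> nearly gives \<open>S (g * h)\<close>, to which
  invariance applies.\<close>

lemma integral_fixed_indicator:
  assumes A: "A \<in> sets \<mu>" and fixed: "real_fixed (indicator A)" and S: "S \<in> \<S>" and g: "cont g"
  shows "int_on A (rop S g) = int_on A g"
proof -
  let ?P = "rop S"
  obtain B where B: "B > 0" "\<And>x. x \<in> topspace K \<Longrightarrow> \<bar>g x\<bar> \<le> B" using cont_bounded[OF g] by blast
  have small: "\<bar>int_on A (?P g) - int_on A g\<bar> \<le> 0 + e" if e: "0 < e" for e
  proof -
    \<comment> \<open>The comparison on the side of \<open>?P g\<close> costs
      \<open>B * (3 * d)\<close> and the one on the side of \<open>g\<close> costs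
      \<open>B * d\<close>, in total \<open>e\<close>.\<close>
    define d where "d = e / (4 * B)"
    have d: "0 < d" using e B(1) by (simp add: d_def)
    have Ai: "integrable \<mu> (indicator A :: 'a \<Rightarrow> real)" using fixed real_fixed_integrable by blast
    obtain k where k: "cont k" "L1r k (indicator A) < d" "L1r (?P k) (indicator A) < d"
      "integrable \<mu> k" "integrable \<mu> (?P k)"
      using real_fixedE[OF fixed S d] by blast
    \<comment> \<open>Clipping to [0, 1] does not increase the distance to the indicator. For
      \<open>?P h\<close> closeness has to be recovered from \<open>?P k\<close> through the
      contraction property, whence the bound \<open>3 * d\<close>.\<close>
    define h where "h x = max 0 (min 1 (k x))" for x
    have h: "cont h" unfolding h_def by (intro continuous_map_real_max continuous_map_real_min k(1)) auto
    have h01: "0 \<le> h x" "h x \<le> 1" for x by (auto simp: h_def)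
    have hi: "integrable \<mu> h" and Phi: "integrable \<mu> (?P h)"
      using h cont_integrable rop_cont[OF S] by blast+
    have "L1r h (indicator A) \<le> L1r k (indicator A)"
    proof (intro integral_mono integrable_abs Bochner_Integration.integrable_diff hi k(4) Ai)
      show "\<bar>h x - indicator A x\<bar> \<le> \<bar>k x - indicator A x\<bar>" for x by (auto simp: h_def indicator_def)
    qed
    then have hA: "L1r h (indicator A) < d" using k(2) by linarith
    have "L1r (?P h) (indicator A) \<le> L1r (?P h) (?P k) + L1r (?P k) (indicator A)"
      using L1_triangle[OF Phi k(5) Ai] by simp
    also have "L1r (?P h) (?P k) = (\<integral>x. \<bar>?P (\<lambda>x. h x - k x) x\<bar> \<partial>\<mu>)"
      unfolding rop_diff[OF S h k(1)] by (rule refl)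
    also have "\<dots> \<le> L1r h k" by (intro rop_contraction S continuous_map_diff h k)
    also have "\<dots> \<le> L1r h (indicator A) + L1r (indicator A) k"
      using L1_triangle[OF hi Ai k(4)] by simp
    finally have PhA: "L1r (?P h) (indicator A) < 3 * d" using hA k(2,3) by (simp add: abs_minus_commute)
    define a where "a x = g x * h x" for x
    define b where "b x = g x - a x" for x
    have a: "cont a" and b: "cont b"
      unfolding b_def a_def by (intro continuous_map_real_mult continuous_map_diff g h)+
    have Pg: "?P g x = ?P a x + ?P b x" for x
      using rop_diff[OF S g a] by (simp add: b_def[abs_def])
    have h': "cont (\<lambda>x. 1 - h x)" using h by (intro continuous_map_diff) auto
    have Bh: "cont (\<lambda>x. B * h x)" "cont (\<lambda>x. B * (1 - h x))"
      using h h' by (auto intro: continuous_map_real_mult)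
    have Pa: "\<bar>?P a x\<bar> \<le> B * ?P h x" for x
    proof -
      have "\<bar>a x\<bar> \<le> B * h x" if "x \<in> topspace K" for x
        unfolding a_def abs_mult using B(2)[OF that] h01[of x] by (auto intro: mult_right_mono)
      then show ?thesis using rop_abs_le[OF S a Bh(1), of x] rop_scale[OF S h, of B] by simp
    qed
    have Pb: "\<bar>?P b x\<bar> \<le> B * (1 - ?P h x)" if x: "x \<in> topspace K" for x
    proof -
      have "\<bar>b x\<bar> \<le> B * (1 - h x)" if "x \<in> topspace K" for x
      proof -
        have "\<bar>b x\<bar> = \<bar>g x\<bar> * \<bar>1 - h x\<bar>" by (simp add: b_def a_def right_diff_distrib flip: abs_mult)
        then show ?thesis using B(2)[OF that] h01[of x] by (auto intro: mult_right_mono)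
      qed
      then have "\<bar>?P b x\<bar> \<le> ?P (\<lambda>x. B * (1 - h x)) x" by (rule rop_abs_le[OF S b Bh(2)])
      then show ?thesis
        using rop_scale[OF S h', of B] rop_diff[OF S _ h, of "\<lambda>x. 1"] rop_one[OF S x] by simp
    qed
    have i: "integrable \<mu> (?P g)" "integrable \<mu> g" "integrable \<mu> (?P a)" "integrable \<mu> a"
      by (intro cont_integrable rop_cont[OF S] g a)+
    have Ag: "integrable \<mu> (\<lambda>x. indicator A x * ?P g x)" "integrable \<mu> (\<lambda>x. indicator A x * g x)"
      using integrable_mult_indicator[OF A i(1)] integrable_mult_indicator[OF A i(2)] by simp_all
    have dist: "\<bar>(\<integral>x. u x \<partial>\<mu>) - (\<integral>x. v x \<partial>\<mu>)\<bar> \<le> B * L1r w (indicator A)"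
      if "integrable \<mu> u" "integrable \<mu> v" "integrable \<mu> w"
        and le: "\<And>x. x \<in> topspace K \<Longrightarrow> \<bar>u x - v x\<bar> \<le> B * \<bar>w x - indicator A x\<bar>" for u v w
    proof -
      have "\<bar>(\<integral>x. u x \<partial>\<mu>) - (\<integral>x. v x \<partial>\<mu>)\<bar> = \<bar>\<integral>x. u x - v x \<partial>\<mu>\<bar>" using that by simp
      also have "\<dots> \<le> (\<integral>x. B * \<bar>w x - indicator A x\<bar> \<partial>\<mu>)"
        by (rule integral_abs_bound[THEN order_trans], intro integral_mono) (use that Ai in \<open>auto simp: space_mu\<close>)
      finally show ?thesis by simp
    qed
    have "\<bar>int_on A (?P g) - (\<integral>x. ?P a x \<partial>\<mu>)\<bar> \<le> B * L1r (?P h) (indicator A)"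
    proof (rule dist[OF Ag(1) i(3) Phi])
      fix x assume x: "x \<in> topspace K"
      show "\<bar>indicator A x * ?P g x - ?P a x\<bar> \<le> B * \<bar>?P h x - indicator A x\<bar>"
      proof (cases "x \<in> A")
        case True
        have "B * (1 - ?P h x) \<le> B * \<bar>?P h x - 1\<bar>" using B(1) by (intro mult_left_mono) auto
        then show ?thesis using True Pg[of x] Pb[OF x] by simp
      next
        case False
        have "B * ?P h x \<le> B * \<bar>?P h x\<bar>" using B(1) by (intro mult_left_mono) auto
        then show ?thesis using False Pa[of x] by simp
      qed
    qed
    also have "\<dots> < B * (3 * d)" using PhA B(1) by simp
    finally have 1: "\<bar>int_on A (?P g) - (\<integral>x. ?P a x \<partial>\<mu>)\<bar> < B * (3 * d)" .
    have "\<bar>(\<integral>x. a x \<partial>\<mu>) - int_on A g\<bar> \<le> B * L1r h (indicator A)"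
    proof (rule dist[OF i(4) Ag(2) hi])
      fix x assume x: "x \<in> topspace K"
      have "a x - indicator A x * g x = g x * (h x - indicator A x)" by (simp add: a_def algebra_simps)
      then show "\<bar>a x - indicator A x * g x\<bar> \<le> B * \<bar>h x - indicator A x\<bar>"
        using B(2)[OF x] by (simp add: abs_mult mult_right_mono)
    qed
    also have "\<dots> < B * d" using hA B(1) by simp
    finally have 2: "\<bar>(\<integral>x. a x \<partial>\<mu>) - int_on A g\<bar> < B * d" .
    have "B * (3 * d) + B * d = e" using B(1) by (simp add: d_def)
    then show ?thesis using 1 2 rop_invariant[OF S a] by linarith
  qed
  have "\<bar>int_on A (?P g) - int_on A g\<bar> \<le> 0" by (rule field_le_epsilon) (rule small)
  then show ?thesis by simp
qed

end

section \<open>Existence of ergodic measures\<close>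

lemma (in compact_hausdorff) cmod_le_supnorm:
  assumes g: "g \<in> Cfun K" and x: "x \<in> topspace K"
  shows "cmod (g x) \<le> supnorm K g"
proof -
  obtain B where B: "B > 0" "\<And>x. cmod (g x) \<le> B" using Cfun_bounded[OF g] by blast
  have "bdd_above (insert 0 ((\<lambda>x. cmod (g x)) ` topspace K))"
    by (rule bdd_aboveI[of _ B]) (use B in \<open>auto intro: less_imp_le\<close>)
  then show ?thesis unfolding supnorm_def using x by (intro cSup_upper) auto
qed

lemma (in markov_operator) S_bound:
  assumes f: "f \<in> Cfun K" and B: "0 \<le> B" "\<And>x. cmod (f x) \<le> B"
  shows "cmod (S f x) \<le> B"
proof -
  have "cmod (S f x) \<le> Re (S (modulus f) x)" by (rule S_modulus[OF f])
  also have "\<dots> \<le> Re (S (\<lambda>x. of_real B * one_on K x) x)"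
  proof (intro S_mono Cfun_modulus Cfun_cmult Cfun_one f)
    fix x show "Re (modulus f x) \<le> Re (of_real B * one_on K x)"
      using B(2)[of x] Cfun_off[OF f, of x] by (cases "x \<in> topspace K") (auto simp: modulus_def)
  qed
  also have "\<dots> \<le> B" using S_cmult[OF Cfun_one, of "of_real B"] S_one B(1) by (auto simp: indicator_def)
  finally show ?thesis .
qed

lemma supnorm_0: "supnorm K (\<lambda>x. 0) = 0"
proof -
  have "insert 0 ((\<lambda>x. cmod 0) ` topspace K) = {0}" by auto
  then show ?thesis by (simp only: supnorm_def cSup_singleton)
qed

text \<open>Needed so that the subtopology on the semigroup has the whole semigroup as its
  carrier.\<close>

lemma topspace_strong_op: "bounded_ops K \<subseteq> topspace (strong_op_topology K)"
proof
  fix T assume T: "T \<in> bounded_ops K"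
  have "{T' \<in> bounded_ops K. supnorm K (\<lambda>x. T' (\<lambda>x. 0) x - T (\<lambda>x. 0) x) < 1} \<in>
     {{T \<in> bounded_ops K. supnorm K (\<lambda>x. T f x - T0 f x) < e} | f T0 e.
        f \<in> Cfun K \<and> T0 \<in> bounded_ops K \<and> e > 0}"
    using T Cfun_0[of K] by (intro CollectI exI[of _ "\<lambda>x. 0"] exI[of _ T] exI[of _ "1::real"]) auto
  moreover have "T \<in> {T' \<in> bounded_ops K. supnorm K (\<lambda>x. T' (\<lambda>x. 0) x - T (\<lambda>x. 0) x) < 1}"
    using T by (simp add: supnorm_0)
  ultimately show "T \<in> topspace (strong_op_topology K)"
    unfolding strong_op_topology_def topology_generated_by_topspace by (rule UnionI)
qed

section \<open>Evaluations along the semigroup as bounded continuous functions\<close>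

context markov_system
begin

abbreviation sot :: "'a oper topology" where
  "sot \<equiv> subtopology (strong_op_topology K) \<S>"

lemma topspace_sot: "topspace sot = \<S>"
proof -
  have "\<S> \<subseteq> bounded_ops K" using semigroup by (auto simp: markov_semigroup_def markov_op_def)
  then show ?thesis using topspace_strong_op[of K] by auto
qed

definition orbit :: "('a \<Rightarrow> complex) \<Rightarrow> 'a \<Rightarrow> 'a oper \<Rightarrow> complex" where
  "orbit f x = (\<lambda>T. if T \<in> \<S> then T f x else 0)"

text \<open>Evaluation at \<open>x\<close> is dominated by the sup norm, so the basic strong
  neighbourhood of \<open>T0\<close> determined by \<open>f\<close> is small enough.\<close>

lemma orbit_continuous:
  assumes f: "f \<in> Cfun K" and x: "x \<in> topspace K"
  shows "continuous_map sot euclidean (orbit f x)"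
  unfolding continuous_map_def
proof (intro conjI allI impI)
  show "orbit f x \<in> topspace sot \<rightarrow> topspace euclidean" by simp
  fix W :: "complex set" assume "openin euclidean W"
  then have W: "open W" by simp
  show "openin sot {T \<in> topspace sot. orbit f x T \<in> W}"
  proof (subst openin_subopen, intro ballI)
    fix T0 assume "T0 \<in> {T \<in> topspace sot. orbit f x T \<in> W}"
    then have T0: "T0 \<in> \<S>" "T0 f x \<in> W" by (auto simp: topspace_sot orbit_def)
    have bT0: "T0 \<in> bounded_ops K" using T0 semigroup by (auto simp: markov_semigroup_def markov_op_def)
    obtain e where e: "e > 0" "\<And>z. dist z (T0 f x) < e \<Longrightarrow> z \<in> W" using W T0(2) open_dist by blast
    let ?V = "{T \<in> bounded_ops K. supnorm K (\<lambda>x. T f x - T0 f x) < e}"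
    have "openin (strong_op_topology K) ?V"
      unfolding strong_op_topology_def using f bT0 e(1) by (intro topology_generated_by_Basis) blast
    then have "openin sot (?V \<inter> \<S>)" unfolding openin_subtopology by blast
    moreover have "T0 \<in> ?V \<inter> \<S>"
      using T0 bT0 e(1) by (simp add: supnorm_0)
    moreover have "?V \<inter> \<S> \<subseteq> {T \<in> topspace sot. orbit f x T \<in> W}"
    proof
      fix T assume T: "T \<in> ?V \<inter> \<S>"
      have "(\<lambda>x. T f x - T0 f x) \<in> Cfun K"
        using T op_Cfun[OF _ f, of T] op_Cfun[OF T0(1) f] by (intro Cfun_diff) auto
      then have "cmod (T f x - T0 f x) \<le> supnorm K (\<lambda>x. T f x - T0 f x)"
        by (rule cmod_le_supnorm[OF _ x])
      then have "T f x \<in> W" using T by (intro e(2)) (simp add: dist_norm)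
      then show "T \<in> {T \<in> topspace sot. orbit f x T \<in> W}" using T topspace_sot by (auto simp: orbit_def)
    qed
    ultimately show "\<exists>V. openin sot V \<and> T0 \<in> V \<and> V \<subseteq> {T \<in> topspace sot. orbit f x T \<in> W}" by blast
  qed
qed

lemma orbit_Cbfun:
  assumes f: "f \<in> Cfun K" and x: "x \<in> topspace K"
  shows "orbit f x \<in> Cbfun sot"
proof -
  obtain B where B: "B > 0" "\<And>x. cmod (f x) \<le> B" using Cfun_bounded[OF f] by blast
  have "cmod (orbit f x T) \<le> B" for T
    using markov_operator.S_bound[OF markov_operator f _ B(2), of T x] B(1) by (auto simp: orbit_def)
  then have "bounded (orbit f x ` topspace sot)" unfolding bounded_iff by blast
  moreover have "orbit f x \<in> Cfun sot"
    unfolding Cfun_def using orbit_continuous[OF f x] topspace_sot by (auto simp: orbit_def)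
  ultimately show ?thesis by (simp add: Cbfun_def)
qed

end

section \<open>The compact set of invariant states\<close>

locale amenable_system = markov_system +
  assumes amenable: "right_amenable K \<S>"
begin

text \<open>Functionals are points of a product of real lines indexed by all functions, so the
  product topology is pointwise convergence. Prescribing 0 at noncontinuous functions keeps every
  coordinate bounded and makes a member determined by its values on continuous functions.\<close>

definition invariant_states :: "('a \<Rightarrow> complex) set \<Rightarrow> (('a \<Rightarrow> real) \<Rightarrow> real) set" where
  "invariant_states G = {L. state K L \<and> (\<forall>S\<in>\<S>. \<forall>u. cont u \<longrightarrow> L (rop S u) = L u)
     \<and> (\<forall>g\<in>G. L (\<lambda>x. cmod (g x)) = 0) \<and> (\<forall>u. \<not> cont u \<longrightarrow> L u = 0)}"

lemma invariant_states_nonempty: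
  assumes G: "G \<subseteq> Cfun K" and x: "x \<in> topspace K"
    and zero: "\<And>S g. S \<in> \<S> \<Longrightarrow> g \<in> G \<Longrightarrow> S (modulus g) x = 0"
  shows "invariant_states G \<noteq> {}"
proof -
  obtain m :: "('a oper \<Rightarrow> complex) \<Rightarrow> complex" where
    m_add: "\<And>f g. f \<in> Cbfun sot \<Longrightarrow> g \<in> Cbfun sot \<Longrightarrow> m (\<lambda>T. f T + g T) = m f + m g"
    and m_cmult: "\<And>c f. f \<in> Cbfun sot \<Longrightarrow> m (\<lambda>T. c * f T) = c * m f"
    and m_pos: "\<And>f. f \<in> Cbfun sot \<Longrightarrow> nonneg_fun f \<Longrightarrow> m f \<in> \<real>\<^sub>\<ge>\<^sub>0"
    and m_one: "m (one_on sot) = 1"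
    and m_inv: "\<And>f S. f \<in> Cbfun sot \<Longrightarrow> S \<in> \<S> \<Longrightarrow> m (right_translate \<S> S f) = m f"
    using amenable unfolding right_amenable_def Let_def by blast
  define L where "L u = (if cont u then Re (m (orbit (cplx K u) x)) else 0)" for u
  have orb: "orbit (cplx K u) x \<in> Cbfun sot" if "cont u" for u
    by (intro orbit_Cbfun cplx_in_Cfun that x)
  have "state K L"
    unfolding state_def
  proof (intro conjI allI impI)
    fix u v assume uv: "cont u" "cont v"
    have "orbit (cplx K (\<lambda>x. u x + v x)) x = (\<lambda>T. orbit (cplx K u) x T + orbit (cplx K v) x T)"
      using markov_operator.S_add[OF markov_operator cplx_in_Cfun[OF uv(1)] cplx_in_Cfun[OF uv(2)]]
      by (auto simp: orbit_def markov_operator.cplx_add[OF markov_operator])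
    then show "L (\<lambda>x. u x + v x) = L u + L v"
      using uv m_add[OF orb orb] by (simp add: L_def continuous_map_add)
  next
    fix c u assume u: "cont u"
    have "orbit (cplx K (\<lambda>x. c * u x)) x = (\<lambda>T. of_real c * orbit (cplx K u) x T)"
      using op_cmult[OF _ cplx_in_Cfun[OF u]]
      by (auto simp: orbit_def markov_operator.cplx_scale[OF markov_operator])
    moreover have "cont (\<lambda>x. c * u x)" using u by (intro continuous_map_real_mult) auto
    ultimately show "L (\<lambda>x. c * u x) = c * L u" using u m_cmult[OF orb] by (simp add: L_def)
  next
    fix u assume u: "cont u" "\<forall>x\<in>topspace K. 0 \<le> u x"
    have "nonneg_fun (cplx K u)" using u(2) by (auto simp: nonneg_fun_def cplx_def complex_nonneg_Reals_iff)
    then have "nonneg_fun (orbit (cplx K u) x)"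
      using markov_operator.S_nonneg[OF markov_operator cplx_in_Cfun[OF u(1)]]
      by (auto simp: nonneg_fun_def orbit_def)
    then show "0 \<le> L u" using m_pos[OF orb[OF u(1)]] u(1) by (simp add: L_def complex_nonneg_Reals_iff)
  next
    have "cplx K (\<lambda>x. 1) = one_on K" by (auto simp: cplx_def indicator_def)
    then have "orbit (cplx K (\<lambda>x. 1)) x = indicator \<S>"
      using op_one x by (auto simp: orbit_def indicator_def)
    then have "orbit (cplx K (\<lambda>x. 1)) x = one_on sot" by (simp only: topspace_sot)
    then show "L (\<lambda>x. 1) = 1" using m_one by (simp add: L_def)
  qed
  moreover have "L (rop S u) = L u" if S: "S \<in> \<S>" and u: "cont u" for S u
  proof -
    \<comment> \<open>Applying \<open>T\<close> to \<open>S u\<close> means applying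
      \<open>T \<circ> S\<close> to \<open>u\<close>: the mean has to be invariant under right
      translations for this reason.\<close>
    have "orbit (cplx K (rop S u)) x = right_translate \<S> S (orbit (cplx K u) x)"
      using op_cplx[OF S u] comp[OF _ S] by (auto simp: orbit_def right_translate_def)
    then show ?thesis using m_inv[OF orb[OF u] S] u rop_cont[OF S u] by (simp add: L_def)
  qed
  moreover have "L (\<lambda>x. cmod (g x)) = 0" if g: "g \<in> G" for g
  proof -
    have "g \<in> Cfun K" using G g by blast
    then have "cplx K (\<lambda>x. cmod (g x)) = modulus g" by (auto simp: cplx_def modulus_def Cfun_off)
    then have "orbit (cplx K (\<lambda>x. cmod (g x))) x = (\<lambda>T. 0)" using zero[OF _ g] by (auto simp: orbit_def)
    moreover have "m (\<lambda>T. 0) = 0" using m_cmult[of "orbit (cplx K (\<lambda>x. 1)) x" 0] orb[of "\<lambda>x. 1"] by simp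
    ultimately show ?thesis by (simp add: L_def)
  qed
  moreover have "L u = 0" if "\<not> cont u" for u using that by (simp add: L_def)
  ultimately have "L \<in> invariant_states G" unfolding invariant_states_def by blast
  then show ?thesis by blast
qed

text \<open>Each clause is an equality or a weak inequality between finitely many coordinates, under
  conditions that do not involve \<open>L\<close>.\<close>

lemma closed_invariant_states: "closed (invariant_states G)"
proof -
  have coord: "continuous_on UNIV (\<lambda>L :: ('a \<Rightarrow> real) \<Rightarrow> real. L u)" for u
    by (rule continuous_on_product_coordinates)
  have imp: "closed {L. P \<longrightarrow> Q L}" if "closed {L. Q L}" for P :: bool and Q :: "(('a \<Rightarrow> real) \<Rightarrow> real) \<Rightarrow> bool"
    using that by (cases P) auto
  show ?thesis
    unfolding invariant_states_def state_def Ball_def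
    by (intro closed_Collect_conj closed_Collect_all imp closed_Collect_eq closed_Collect_le
        coord continuous_on_const continuous_on_add continuous_on_mult)
qed

text \<open>Positivity and normalisation bound \<open>L u\<close> by any bound of \<open>u\<close>,
  so the set is a closed part of a product of compact intervals.\<close>

lemma compact_invariant_states: "compact (invariant_states G)"
proof -
  define b where "b u = (SOME b. \<forall>x\<in>topspace K. \<bar>u x\<bar> \<le> b)" for u :: "'a \<Rightarrow> real"
  have b: "\<bar>u x\<bar> \<le> b u" if u: "cont u" and x: "x \<in> topspace K" for u x
  proof -
    obtain B where "\<And>x. x \<in> topspace K \<Longrightarrow> \<bar>u x\<bar> \<le> B" by (rule cont_bounded[OF u]) blast
    then have "\<exists>b. \<forall>x\<in>topspace K. \<bar>u x\<bar> \<le> b" by blast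
    then have "\<forall>x\<in>topspace K. \<bar>u x\<bar> \<le> b u" unfolding b_def by (rule someI_ex)
    then show ?thesis using x by (rule bspec)
  qed
  define c where "c u = (if cont u then b u else 0)" for u
  let ?Q = "Pi\<^sub>E UNIV (\<lambda>u. {- c u .. c u})"
  have "compactin (product_topology (\<lambda>u. euclidean) UNIV) ?Q"
    unfolding compactin_PiE by auto
  then have "compact ?Q" by (simp add: euclidean_product_topology)
  moreover have "invariant_states G \<subseteq> ?Q"
  proof
    fix L assume L: "L \<in> invariant_states G"
    then interpret compact_state K L by unfold_locales (simp add: invariant_states_def)
    have "- c u \<le> L u \<and> L u \<le> c u" for u
    proof (cases "cont u")
      case True
      have bu: "u x \<le> b u" "- b u \<le> u x" if "x \<in> topspace K" for x
        using b[OF True that] by linarith+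
      have "L u \<le> L (\<lambda>x. b u)" by (intro L_mono True) (simp_all add: bu)
      moreover have "L (\<lambda>x. - b u) \<le> L u" by (intro L_mono True) (simp_all add: bu)
      ultimately show ?thesis using True by (simp add: c_def L_const)
    next
      case False
      then show ?thesis using L by (simp add: c_def invariant_states_def)
    qed
    then show "L \<in> ?Q" by auto
  qed
  ultimately show ?thesis using compact_Int_closed[OF _ closed_invariant_states, of ?Q G]
    by (simp add: Int_absorb1)
qed

text \<open>Passes from real to complex functions; the imaginary part is the real part after
  multiplication by \<open>- \<i>\<close>.\<close>

lemma invariant_integral:
  assumes L: "L \<in> invariant_states G" and \<mu>: "regular_prob_measure K \<mu>"
    and int: "\<And>u. cont u \<Longrightarrow> (\<integral>x. u x \<partial>\<mu>) = L u"
    and S: "S \<in> \<S>" and f: "f \<in> Cfun K"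
  shows "integral\<^sup>L \<mu> (S f) = integral\<^sup>L \<mu> f"
proof -
  interpret regular_measure K \<mu> by unfold_locales (rule \<mu>)
  have Re: "(\<integral>x. Re (S f x) \<partial>\<mu>) = (\<integral>x. Re (f x) \<partial>\<mu>)" if f: "f \<in> Cfun K" for f
  proof -
    have "cplx K (\<lambda>x. Re (f x)) = (\<lambda>x. of_real (Re (f x)))" using Cfun_off[OF f] by (auto simp: cplx_def)
    then have "rop S (\<lambda>x. Re (f x)) = (\<lambda>x. Re (S f x))"
      using markov_operator.S_Re[OF markov_operator[OF S] f] by (simp add: real_op_def)
    moreover have "L (rop S (\<lambda>x. Re (f x))) = L (\<lambda>x. Re (f x))"
      using L S continuous_map_Re[OF f] unfolding invariant_states_def by blast
    ultimately show ?thesis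
      using int[OF continuous_map_Re[OF f]] int[OF continuous_map_Re[OF op_Cfun[OF S f]]] by simp
  qed
  have "(\<integral>x. Im (S f x) \<partial>\<mu>) = (\<integral>x. Im (f x) \<partial>\<mu>)"
    using Re[OF Cfun_cmult[OF f, of "- \<i>"]] op_cmult[OF S f, of "- \<i>"] by simp
  then show ?thesis
    using Re[OF f] Cfun_integrable[OF f] Cfun_integrable[OF op_Cfun[OF S f]] by (simp add: complex_eq_iff)
qed

end

section \<open>From trivial fixed sets to ergodicity\<close>

context invariant_measure
begin

lemma real_fixed_cong:
  assumes u: "real_fixed u" and eq: "\<And>x. x \<in> topspace K \<Longrightarrow> u x = v x"
  shows "real_fixed v"
proof -
  have "L1r h v = L1r h u" for h
    by (intro Bochner_Integration.integral_cong) (auto simp: space_mu eq)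
  moreover have "integrable \<mu> v = integrable \<mu> u"
    by (intro Bochner_Integration.integrable_cong) (auto simp: space_mu eq)
  ultimately show ?thesis using u by (simp add: real_fixed_def)
qed

lemma L1_fix_one: "(\<lambda>x. 1) \<in> L1_fix K \<S> \<mu>"
proof (rule L1_fixI)
  fix S and e :: real assume S: "S \<in> \<S>" and e: "0 < e"
  have "(\<integral>x. cmod (one_on K x - 1) \<partial>\<mu>) = (\<integral>x. 0 \<partial>\<mu>)"
    by (intro Bochner_Integration.integral_cong) (auto simp: space_mu)
  then show "\<exists>h\<in>Cfun K. (\<integral>x. cmod (h x - 1) \<partial>\<mu>) < e \<and> (\<integral>x. cmod (S h x - 1) \<partial>\<mu>) < e"
    using e op_one[OF S] by (intro bexI[of _ "one_on K"] Cfun_one) simp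
qed (auto intro: contraction)

text \<open>Testing the level \<open>c = \<integral>u d\<mu>\<close> alone suffices: \<open>u > c\<close> cannot hold almost everywhere.\<close>

lemma real_fixed_constant:
  assumes u: "real_fixed u"
    and zero_one: "\<And>A. A \<in> sets \<mu> \<Longrightarrow> real_fixed (indicator A) \<Longrightarrow> prob A = 0 \<or> prob A = 1"
  shows "\<exists>c. AE x in \<mu>. u x = c"
proof -
  have ui: "integrable \<mu> u" using u real_fixed_integrable by blast
  define c where "c = (\<integral>x. u x \<partial>\<mu>)"
  have v: "real_fixed (\<lambda>x. u x - c)" by (intro real_fixed_diff u real_fixed_const)
  let ?A = "{x \<in> topspace K. 0 < u x - c}"
  have A: "?A \<in> sets \<mu>" by (intro superlevel_sets real_fixed_integrable v)
  have int0: "(\<integral>x. u x - c \<partial>\<mu>) = 0" using ui by (simp add: c_def prob_space)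
  have "prob ?A = 0 \<or> prob ?A = 1"
    by (intro zero_one A real_fixed_superlevel v)
  then have "AE x in \<mu>. u x - c \<le> 0 \<or> False"
  proof
    assume "prob ?A = 0"
    then have "AE x in \<mu>. x \<notin> ?A" using A
      by (intro AE_not_in null_setsI) (auto simp: emeasure_eq_measure)
    then show ?thesis using AE_space by eventually_elim (auto simp: space_mu)
  next
    assume "prob ?A = 1"
    then have pos: "AE x in \<mu>. 0 < u x - c"
      using AE_prob_1[of ?A] by (auto elim: AE_mp)
    have "(\<integral>x. u x - c \<partial>\<mu>) = 0 \<longleftrightarrow> (AE x in \<mu>. u x - c = 0)"
      using pos ui by (intro integral_nonneg_eq_0_iff_AE) (auto elim!: AE_mp)
    with int0 have "AE x in \<mu>. u x - c = 0" by blast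
    with pos have "AE x in \<mu>. False" by eventually_elim simp
    then show ?thesis by (auto elim!: AE_mp)
  qed
  then have nonpos: "AE x in \<mu>. 0 \<le> c - u x" by (auto elim!: AE_mp)
  have "(\<integral>x. c - u x \<partial>\<mu>) = 0 \<longleftrightarrow> (AE x in \<mu>. c - u x = 0)"
    using nonpos ui by (intro integral_nonneg_eq_0_iff_AE) auto
  moreover have "(\<integral>x. c - u x \<partial>\<mu>) = 0" using ui by (simp add: c_def prob_space)
  ultimately have "AE x in \<mu>. c - u x = 0" by blast
  then have "AE x in \<mu>. u x = c" by eventually_elim simp
  then show ?thesis by blast
qed

text \<open>The real and imaginary parts of a fixed function are constant almost everywhere, so the
  constant 1 spans the fixed space.\<close>

lemma zero_one_ergodic:
  assumes zero_one: "\<And>A. A \<in> sets \<mu> \<Longrightarrow> real_fixed (indicator A) \<Longrightarrow> prob A = 0 \<or> prob A = 1"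
  shows "\<mu> \<in> ergodic_measures K \<S>"
  unfolding ergodic_measures_def
proof (intro CollectI conjI bexI[of _ "\<lambda>x. 1"] L1_fix_one ballI)
  show "\<mu> \<in> inv_prob K \<S>" using regular invariant by (simp add: inv_prob_def)
  show "\<not> (AE x in \<mu>. (1 :: complex) = 0)" by simp
  fix f assume f: "f \<in> L1_fix K \<S> \<mu>"
  obtain a where a: "AE x in \<mu>. Re (1 * f x) = a"
    using real_fixed_constant[OF L1_fix_real_fixed[OF f, of 1] zero_one] by auto
  obtain b where b: "AE x in \<mu>. Re (- \<i> * f x) = b"
    using real_fixed_constant[OF L1_fix_real_fixed[OF f, of "- \<i>"] zero_one] by auto
  have "AE x in \<mu>. f x = Complex a b * 1"
    using a b by eventually_elim (auto simp: complex_eq_iff)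
  then show "\<exists>c. AE x in \<mu>. f x = c * 1" by blast
qed

end

context amenable_system
begin

text \<open>An extreme invariant state vanishing on \<open>G\<close> is represented by an ergodic measure: a fixed
  indicator \<open>1\<^sub>A\<close> splits the measure into its normalised restrictions to \<open>A\<close> and its complement,
  which are again invariant.\<close>

theorem ergodic_measure_exists:
  assumes G: "G \<subseteq> Cfun K" and x: "x \<in> topspace K"
    and zero: "\<And>S g. S \<in> \<S> \<Longrightarrow> g \<in> G \<Longrightarrow> S (modulus g) x = 0"
  shows "\<exists>\<mu>\<in>ergodic_measures K \<S>. G \<subseteq> null_ideal K \<mu>"
proof -
  have ne: "invariant_states G \<noteq> {}" by (rule invariant_states_nonempty[OF G x]) (rule zero)
  obtain L where L: "L \<in> invariant_states G"
    and ext: "\<And>L1 L2 s. L1 \<in> invariant_states G \<Longrightarrow> L2 \<in> invariant_states G \<Longrightarrow> 0 < s \<Longrightarrow> s < 1 \<Longrightarrow>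
       (\<And>i. L i = s * L1 i + (1 - s) * L2 i) \<Longrightarrow> L1 = L"
    using extreme_point_exists[OF compact_invariant_states closed_invariant_states ne] by blast
  have "state K L" using L by (simp add: invariant_states_def)
  then obtain \<mu> where \<mu>: "regular_prob_measure K \<mu>" and int: "\<And>u. cont u \<Longrightarrow> (\<integral>x. u x \<partial>\<mu>) = L u"
    using riesz_representation by blast
  interpret invariant_measure K \<S> \<mu>
    by unfold_locales (use \<mu> invariant_integral[OF L \<mu> int] in auto)
  have Gnull: "(\<integral>x. cmod (g x) \<partial>\<mu>) = 0" if "g \<in> G" for g
  proof -
    have "g \<in> Cfun K" using G that by blast
    then have "(\<integral>x. cmod (g x) \<partial>\<mu>) = L (\<lambda>x. cmod (g x))" by (intro int continuous_map_cmod)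
    then show ?thesis using L that by (auto simp: invariant_states_def)
  qed
  \<comment> \<open>The value 0 at noncontinuous functions is what \<open>invariant_states\<close>
    prescribes.\<close>
  define R where "R A u = (if cont u then int_on A u / prob A else 0)" for A u
  have R: "R A \<in> invariant_states G"
    if A: "A \<in> sets \<mu>" and fixed: "real_fixed (indicator A)" and pos: "0 < prob A" for A
  proof -
    have i: "integrable \<mu> (\<lambda>x. indicator A x * u x)" if "cont u" for u
      using integrable_mult_indicator[OF A cont_integrable[OF that]] by simp
    have "state K (R A)"
      unfolding state_def
    proof (intro conjI allI impI)
      fix u v assume uv: "cont u" "cont v"
      have "(\<integral>x. indicator A x * (u x + v x) \<partial>\<mu>) = int_on A u + int_on A v"
        using i[OF uv(1)] i[OF uv(2)] by (simp add: distrib_left)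
      then show "R A (\<lambda>x. u x + v x) = R A u + R A v"
        using uv by (simp add: R_def continuous_map_add add_divide_distrib)
    next
      fix c u assume u: "cont u"
      then have "cont (\<lambda>x. c * u x)" by (intro continuous_map_real_mult) auto
      then show "R A (\<lambda>x. c * u x) = c * R A u"
        using u i[OF u] by (simp add: R_def mult.left_commute)
    next
      fix u assume u: "cont u" "\<forall>x\<in>topspace K. 0 \<le> u x"
      then have "0 \<le> int_on A u"
        by (intro integral_nonneg_AE AE_I2) (auto simp: space_mu)
      then show "0 \<le> R A u" using u by (simp add: R_def)
    next
      show "R A (\<lambda>x. 1) = 1"
        using pos sets.sets_into_space[OF A] by (simp add: R_def Int_absorb2)
    qed
    moreover have "R A (rop S u) = R A u" if "S \<in> \<S>" "cont u" for S u
      using integral_fixed_indicator[OF A fixed that] that rop_cont[OF that] by (simp add: R_def)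
    moreover have "R A (\<lambda>x. cmod (g x)) = 0" if g: "g \<in> G" for g
    proof -
      have c: "cont (\<lambda>x. cmod (g x))" using G g continuous_map_cmod by blast
      have "(\<integral>x. indicator A x * cmod (g x) \<partial>\<mu>) \<le> (\<integral>x. cmod (g x) \<partial>\<mu>)"
        by (intro integral_mono i c cont_integrable) (auto simp: indicator_def)
      moreover have "0 \<le> (\<integral>x. indicator A x * cmod (g x) \<partial>\<mu>)" by (intro integral_nonneg_AE AE_I2) simp
      ultimately have "(\<integral>x. indicator A x * cmod (g x) \<partial>\<mu>) = 0" using Gnull[OF g] by linarith
      then show ?thesis by (simp add: R_def)
    qed
    ultimately show ?thesis unfolding invariant_states_def by (auto simp: R_def)
  qed
  have "prob A = 0 \<or> prob A = 1" if A: "A \<in> sets \<mu>" and fixed: "real_fixed (indicator A)" for A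
  proof (rule ccontr)
    let ?a = "prob A"
    let ?B = "topspace K - A"
    assume "\<not> (?a = 0 \<or> ?a = 1)"
    then have a: "0 < ?a" "?a < 1" using measure_nonneg[of \<mu> A] prob_le_1[of A] by linarith+
    have B: "?B \<in> sets \<mu>" using sets.compl_sets[OF A] by (simp add: space_mu)
    have mB: "prob ?B = 1 - ?a" using prob_compl[OF A] by (simp add: space_mu)
    have "real_fixed (\<lambda>x. 1 - indicator A x)" by (intro real_fixed_diff real_fixed_const fixed)
    then have fixedB: "real_fixed (indicator ?B)"
      by (rule real_fixed_cong) (auto simp: indicator_def)
    have "R A = L"
    proof (rule ext[OF R[OF A fixed a(1)] R[OF B fixedB] a])
      show "0 < prob ?B" using a mB by simp
      fix u
      show "L u = ?a * R A u + (1 - ?a) * R ?B u"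
      proof (cases "cont u")
        case True
        have "L u = (\<integral>x. indicator A x * u x + indicator ?B x * u x \<partial>\<mu>)"
          unfolding int[OF True, symmetric]
          by (intro Bochner_Integration.integral_cong) (auto simp: space_mu indicator_def)
        also have "\<dots> = int_on A u + int_on ?B u"
          using integrable_mult_indicator[OF A cont_integrable[OF True]]
            integrable_mult_indicator[OF B cont_integrable[OF True]]
          by (intro Bochner_Integration.integral_add) simp_all
        also have "\<dots> = ?a * R A u + (1 - ?a) * R ?B u"
          using True a mB by (simp add: R_def)
        finally show ?thesis .
      next
        case False
        then show ?thesis using L by (simp add: R_def invariant_states_def)
      qed
    qed
    then have RA: "R A u = L u" for u by simp
    \<comment> \<open>Extremality has made the integral over \<open>A\<close> proportional to the
      full integral on continuous functions. Letting \<open>u\<close> approach the indicator of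
      \<open>A\<close> in L1 yields \<open>?a = ?a * ?a\<close>, which is impossible strictly
      between 0 and 1.\<close>
    have eq: "int_on A u = ?a * (\<integral>x. u x \<partial>\<mu>)" if "cont u" for u
      unfolding int[OF that] using RA[of u] that a by (simp add: R_def divide_eq_eq mult.commute)
    have small: "\<bar>?a - ?a * ?a\<bar> \<le> 0 + e" if e: "0 < e" for e
    proof -
      have Ai: "integrable \<mu> (indicator A :: 'a \<Rightarrow> real)" using fixed real_fixed_integrable by blast
      have Aint: "(\<integral>x. indicator A x \<partial>\<mu>) = ?a"
        using sets.sets_into_space[OF A] by (simp add: Int_absorb2)
      have e2: "0 < e / 2" using e by simp
      \<comment> \<open>\<open>real_fixed\<close> provides approximations only once a member of the
        semigroup is given. The semigroup is nonempty, for otherwise the unit function would be the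
        zero function and have mean 0.\<close>
      obtain S where S: "S \<in> \<S>"
      proof -
        have "\<S> \<noteq> {}"
        proof
          assume e: "\<S> = {}"
          obtain m :: "('a oper \<Rightarrow> complex) \<Rightarrow> complex" where
            m: "\<And>c f. f \<in> Cbfun sot \<Longrightarrow> m (\<lambda>T. c * f T) = c * m f" "m (one_on sot) = 1"
            using amenable unfolding right_amenable_def Let_def by blast
          have z: "one_on sot = (\<lambda>T. 0)" using topspace_sot e by (auto simp: indicator_def)
          have "(\<lambda>T. 0) \<in> Cbfun sot" using e topspace_sot by (simp add: Cbfun_def Cfun_def)
          then show False using m(1)[of "\<lambda>T. 0" 0] m(2) z by simp
        qed
        then show thesis using that by blast
      qed
      obtain h where h: "cont h" "L1r h (indicator A) < e / 2" "integrable \<mu> h"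
        using real_fixedE[OF fixed S e2] by blast
      have Ah: "integrable \<mu> (\<lambda>x. indicator A x * h x)" using integrable_mult_indicator[OF A h(3)] by simp
      have "\<bar>int_on A h - ?a\<bar> = \<bar>\<integral>x. indicator A x * h x - indicator A x \<partial>\<mu>\<bar>"
        using Ah Ai Aint by simp
      also have "\<dots> \<le> L1r h (indicator A)"
        by (rule integral_abs_bound[THEN order_trans], intro integral_mono integrable_abs Bochner_Integration.integrable_diff Ah Ai h)
          (auto simp: indicator_def)
      finally have 1: "\<bar>int_on A h - ?a\<bar> \<le> e / 2" using h(2) by linarith
      have "\<bar>(\<integral>x. h x \<partial>\<mu>) - ?a\<bar> = \<bar>\<integral>x. h x - indicator A x \<partial>\<mu>\<bar>"
        using h Ai Aint by simp
      also have "\<dots> \<le> L1r h (indicator A)" by (rule integral_abs_bound)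
      finally have 2: "\<bar>(\<integral>x. h x \<partial>\<mu>) - ?a\<bar> \<le> e / 2" using h(2) by linarith
      have "\<bar>?a * (\<integral>x. h x \<partial>\<mu>) - ?a * ?a\<bar> = ?a * \<bar>(\<integral>x. h x \<partial>\<mu>) - ?a\<bar>"
        using a by (simp add: abs_mult flip: right_diff_distrib)
      also have "\<dots> \<le> 1 * (e / 2)" using a 2 by (intro mult_mono) auto
      finally show ?thesis using 1 eq[OF h(1)] by linarith
    qed
    have "\<bar>?a - ?a * ?a\<bar> \<le> 0" by (rule field_le_epsilon) (rule small)
    then have "?a * (1 - ?a) = 0" by (simp add: algebra_simps)
    then show False using a by simp
  qed
  then have "\<mu> \<in> ergodic_measures K \<S>" by (rule zero_one_ergodic)
  moreover have "G \<subseteq> null_ideal K \<mu>" using G Gnull by (auto simp: null_ideal_def)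
  ultimately show ?thesis by blast
qed

end

section \<open>The primitive spectrum\<close>

lemma (in compact_hausdorff) zerosD: "x \<in> zeros G \<Longrightarrow> g \<in> G \<Longrightarrow> g x = 0"
  by (simp add: zeros_def)

context markov_system
begin

abbreviation ergodic :: "'a measure set" where "ergodic \<equiv> ergodic_measures K \<S>"
abbreviation KM :: "'a topology" where "KM \<equiv> Mtop K \<S>"
abbreviation Fix :: "('a \<Rightarrow> complex) set" where "Fix \<equiv> rad_fix K \<S>"
abbreviation Hat :: "('a \<Rightarrow> complex) \<Rightarrow> ('a \<Rightarrow> complex) set \<Rightarrow> complex" where "Hat \<equiv> hat K \<S>"
abbreviation hk :: "('a \<Rightarrow> complex) set set \<Rightarrow> ('a \<Rightarrow> complex) set set" where "hk \<equiv> hk_closure K \<S>"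
abbreviation PrimS :: "('a \<Rightarrow> complex) set set" where "PrimS \<equiv> Prim K \<S>"
abbreviation I :: "'a measure \<Rightarrow> ('a \<Rightarrow> complex) set" where "I \<equiv> null_ideal K"

lemma ergodic_invariant:
  assumes "\<mu> \<in> ergodic"
  shows "invariant_measure K \<S> \<mu>"
proof -
  have "\<mu> \<in> inv_prob K \<S>" using assms by (simp add: ergodic_measures_def)
  then show ?thesis by unfold_locales (auto simp: inv_prob_def)
qed

lemma ergodic_regular: "\<mu> \<in> ergodic \<Longrightarrow> regular_measure K \<mu>"
  using ergodic_invariant by (simp add: invariant_measure_def)

lemma ergodic_prob: "\<mu> \<in> ergodic \<Longrightarrow> prob_space \<mu>"
  using ergodic_regular regular_measure.axioms regular_prob_measure_def regular_measure_axioms_def by blast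

lemma AE_ex:
  assumes "\<mu> \<in> ergodic" "AE x in \<mu>. P x"
  obtains x where "P x"
proof -
  interpret prob_space \<mu> by (rule ergodic_prob[OF assms(1)])
  have "\<exists>x. P x"
  proof (rule ccontr)
    assume "\<not> (\<exists>x. P x)"
    with assms(2) show False by simp
  qed
  then show thesis using that by blast
qed

lemma AE_carrier: "\<mu> \<in> ergodic \<Longrightarrow> AE x in \<mu>. x \<in> topspace K"
  using regular_measure.space_mu[OF ergodic_regular, of \<mu>] AE_space[of \<mu>] by simp

lemma null_ideal_iff:
  assumes "\<mu> \<in> ergodic"
  shows "f \<in> I \<mu> \<longleftrightarrow> f \<in> Cfun K \<and> (AE x in \<mu>. f x = 0)"
  using regular_measure.Cfun_norm_zero_iff[OF ergodic_regular[OF assms]] by (auto simp: null_ideal_def)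

text \<open>The constant 1 is fixed, hence a nonzero multiple of the spanning function, which is
  therefore itself constant almost everywhere.\<close>

lemma ergodic_constant:
  assumes \<mu>: "\<mu> \<in> ergodic" and f: "f \<in> L1_fix K \<S> \<mu>"
  shows "\<exists>c. AE x in \<mu>. f x = c"
proof -
  interpret invariant_measure K \<S> \<mu> by (rule ergodic_invariant[OF \<mu>])
  obtain f0 where f0: "\<And>g. g \<in> L1_fix K \<S> \<mu> \<Longrightarrow> \<exists>c. AE x in \<mu>. g x = c * f0 x"
    using \<mu> unfolding ergodic_measures_def by blast
  obtain a where a: "AE x in \<mu>. 1 = a * f0 x" using f0[OF L1_fix_one] by blast
  obtain b where b: "AE x in \<mu>. f x = b * f0 x" using f0[OF f] by blast
  have "AE x in \<mu>. f x = b / a"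
    using a b
  proof eventually_elim
    case (elim x)
    then have "a \<noteq> 0" by auto
    then show ?case using elim by (simp add: field_simps)
  qed
  then show ?thesis by blast
qed

lemma null_ideal_op:
  assumes \<mu>: "\<mu> \<in> ergodic" and S: "S \<in> \<S>" and f: "f \<in> I \<mu>"
  shows "S f \<in> I \<mu>"
proof -
  interpret invariant_measure K \<S> \<mu> by (rule ergodic_invariant[OF \<mu>])
  have fC: "f \<in> Cfun K" and f0: "(\<integral>x. cmod (f x) \<partial>\<mu>) = 0" using f by (simp_all add: null_ideal_def)
  have "(\<integral>x. cmod (S f x) \<partial>\<mu>) \<le> (\<integral>x. cmod (f x) \<partial>\<mu>)"
    using contraction[OF S] fC unfolding L1_contraction_def by blast
  moreover have "0 \<le> (\<integral>x. cmod (S f x) \<partial>\<mu>)" by (intro integral_nonneg_AE AE_I2) simp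
  ultimately have "(\<integral>x. cmod (S f x) \<partial>\<mu>) = 0" using f0 by linarith
  then show ?thesis using op_Cfun[OF S fC] by (simp add: null_ideal_def)
qed

section \<open>Kernels of sets of primitive ideals and their zero sets\<close>

lemma PrimE:
  assumes "p \<in> PrimS"
  obtains \<mu> where "\<mu> \<in> ergodic" "p = I \<mu>"
  using assms by (auto simp: Prim_def)

lemma Prim_I: "\<mu> \<in> ergodic \<Longrightarrow> I \<mu> \<in> PrimS"
  by (simp add: Prim_def)

lemma ker_iff:
  assumes "A \<subseteq> PrimS"
  shows "f \<in> ker K A \<longleftrightarrow> f \<in> Cfun K \<and> (\<forall>\<mu>\<in>ergodic. I \<mu> \<in> A \<longrightarrow> (AE x in \<mu>. f x = 0))"
proof -
  have "f \<in> ker K A \<longleftrightarrow> f \<in> Cfun K \<and> (\<forall>\<mu>\<in>ergodic. I \<mu> \<in> A \<longrightarrow> f \<in> I \<mu>)"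
    using assms unfolding ker_def by (blast elim: PrimE)
  then show ?thesis using null_ideal_iff by blast
qed

lemma ker_Cfun: "f \<in> ker K A \<Longrightarrow> f \<in> Cfun K"
  by (simp add: ker_def)

lemma ker_antimono: "A \<subseteq> B \<Longrightarrow> ker K B \<subseteq> ker K A"
  by (auto simp: ker_def)

lemma ker_subset: "p \<in> A \<Longrightarrow> ker K A \<subseteq> p"
  by (auto simp: ker_def)

lemma ker_op:
  assumes "A \<subseteq> PrimS" "S \<in> \<S>" "f \<in> ker K A"
  shows "S f \<in> ker K A"
  using assms op_Cfun[OF assms(2)] null_ideal_op[OF _ assms(2)] unfolding ker_def by (blast elim: PrimE)

lemma ker_modulus:
  assumes "A \<subseteq> PrimS" "f \<in> ker K A"
  shows "modulus f \<in> ker K A"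
  using assms by (auto simp: ker_iff modulus_def[of f] intro!: Cfun_modulus[of f, unfolded modulus_def])

abbreviation zset :: "('a \<Rightarrow> complex) set set \<Rightarrow> 'a set" where "zset A \<equiv> zeros (ker K A)"

lemma AE_zeros_ker:
  assumes A: "A \<subseteq> PrimS" and \<mu>: "\<mu> \<in> ergodic" "ker K A \<subseteq> I \<mu>"
  shows "AE x in \<mu>. x \<in> zeros (ker K A)"
proof -
  interpret regular_measure K \<mu> by (rule ergodic_regular[OF \<mu>(1)])
  show ?thesis
    by (rule AE_zeros) (use \<mu> null_ideal_iff ker_Cfun in auto)
qed

text \<open>The zero set of the kernel is conull for every ergodic measure whose ideal lies in
  \<open>A\<close>, so a function vanishing there is null for all of these measures.\<close>

lemma ker_zeros:
  assumes A: "A \<subseteq> PrimS"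
  shows "f \<in> ker K A \<longleftrightarrow> f \<in> Cfun K \<and> (\<forall>x\<in>zset A. f x = 0)"
proof
  assume "f \<in> ker K A"
  then show "f \<in> Cfun K \<and> (\<forall>x\<in>zset A. f x = 0)" by (auto simp: zeros_def ker_Cfun)
next
  assume f: "f \<in> Cfun K \<and> (\<forall>x\<in>zset A. f x = 0)"
  have "AE x in \<mu>. f x = 0" if "\<mu> \<in> ergodic" "I \<mu> \<in> A" for \<mu>
    using AE_zeros_ker[OF A that(1) ker_subset[OF that(2)]] by eventually_elim (use f in blast)
  then show "f \<in> ker K A" using f by (simp add: ker_iff[OF A])
qed

lemma closedin_zeros_ker: "closedin K (zset A)"
  by (intro closedin_zeros) (auto simp: ker_Cfun)

lemma zeros_ker_mono: "A \<subseteq> B \<Longrightarrow> zset A \<subseteq> zset B"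
  using ker_antimono[of A B] by (auto simp: zeros_def)

text \<open>If \<open>a\<close> and \<open>b\<close> from the two kernels are both nonzero at
  \<open>x\<close>, their product is nonzero at \<open>x\<close> but belongs to the kernel of the
  union.\<close>

lemma zeros_ker_Un:
  assumes A: "A \<subseteq> PrimS" and B: "B \<subseteq> PrimS"
  shows "zset (A \<union> B) = zset A \<union> zset B"
proof
  show "zset A \<union> zset B \<subseteq> zset (A \<union> B)"
    using zeros_ker_mono[of A "A \<union> B"] zeros_ker_mono[of B "A \<union> B"] by blast
  show "zset (A \<union> B) \<subseteq> zset A \<union> zset B"
  proof
    fix x assume x: "x \<in> zset (A \<union> B)"
    show "x \<in> zset A \<union> zset B"
    proof (rule ccontr)
      assume "x \<notin> zset A \<union> zset B"
      then obtain a b where a: "a \<in> ker K A" "a x \<noteq> 0" and b: "b \<in> ker K B" "b x \<noteq> 0"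
        using x by (auto simp: zeros_def)
      have "AE y in \<mu>. a y * b y = 0" if \<mu>: "\<mu> \<in> ergodic" "I \<mu> \<in> A \<union> B" for \<mu>
      proof (cases "I \<mu> \<in> A")
        case True
        then have "AE y in \<mu>. a y = 0" using a(1) \<mu> by (auto simp: ker_iff[OF A])
        then show ?thesis by eventually_elim simp
      next
        case False
        then have "AE y in \<mu>. b y = 0" using b(1) \<mu> by (auto simp: ker_iff[OF B])
        then show ?thesis by eventually_elim simp
      qed
      moreover have "(\<lambda>y. a y * b y) \<in> Cfun K" using a b by (intro Cfun_mult ker_Cfun)
      ultimately have "(\<lambda>y. a y * b y) \<in> ker K (A \<union> B)" using A B by (subst ker_iff) auto
      then have "a x * b x = 0" by (rule zerosD[OF x])
      then show False using a b by simp
    qed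
  qed
qed

text \<open>\<open>1\<^sub>U\<close> is approximated from below by functions \<open>h \<in> I\<close> with \<open>0 \<le> h \<le> 1\<close>; as \<open>S h\<close> again lies in
  \<open>I\<close> and between 0 and 1, it stays below \<open>1\<^sub>U\<close>, and it has the same integral as \<open>h\<close>.\<close>

lemma zero_one_law:
  assumes A: "A \<subseteq> PrimS" and \<mu>: "\<mu> \<in> ergodic"
  shows "(AE x in \<mu>. x \<in> zset A) \<or> (AE x in \<mu>. x \<notin> zset A)"
proof -
  interpret invariant_measure K \<S> \<mu> by (rule ergodic_invariant[OF \<mu>])
  let ?Z = "zset A"
  let ?U = "topspace K - ?Z"
  have Z: "closedin K ?Z" by (rule closedin_zeros_ker)
  have U: "openin K ?U" using Z by (simp add: closedin_def)
  have Us: "?U \<in> sets \<mu>" by (rule open_sets[OF U])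
  have "integrable \<mu> (\<lambda>x. complex_of_real (indicator ?U x))"
    by (intro integrable_of_real integrable_real_indicator Us) (simp add: emeasure_eq_measure)
  moreover have "(\<lambda>x. complex_of_real (indicator ?U x)) = indicator ?U"
    by (simp add: fun_eq_iff indicator_def)
  ultimately have Ui: "integrable \<mu> (indicator ?U :: 'a \<Rightarrow> complex)" by simp
  have "(indicator ?U :: 'a \<Rightarrow> complex) \<in> L1_fix K \<S> \<mu>"
  proof (rule L1_fixI[OF Ui contraction])
    fix S and e :: real assume S: "S \<in> \<S>" and e: "0 < e"
    obtain C V where CV: "closedin K C" "openin K V" "C \<subseteq> ?U" "?U \<subseteq> V" "prob (V - C) < e"
      by (rule approx_closed_open[OF Us e])
    have dis: "?Z \<inter> C = {}" using CV(3) by blast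
    obtain u where u: "cont u" "\<And>x. x \<in> ?Z \<Longrightarrow> u x = 0" "\<And>x. x \<in> C \<Longrightarrow> u x = 1"
      "\<And>x. x \<in> topspace K \<Longrightarrow> 0 \<le> u x \<and> u x \<le> 1"
      by (rule urysohn[OF Z CV(1) dis]) blast
    let ?h = "cplx K u"
    have h: "?h \<in> Cfun K" by (rule cplx_in_Cfun[OF u(1)])
    have hker: "?h \<in> ker K A" using u(2) h by (subst ker_zeros[OF A]) (auto simp: cplx_def zeros_def)
    have Sh: "S ?h = cplx K (rop S u)" by (rule op_cplx[OF S u(1)])
    have cP: "cont (rop S u)" by (rule rop_cont[OF S u(1)])
    have P01: "0 \<le> rop S u x" "x \<in> topspace K \<Longrightarrow> rop S u x \<le> 1" for x
    proof -
      show "0 \<le> rop S u x"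
        using rop_mono[OF S _ u(1), of "\<lambda>x. 0" x] u(4) rop_scale[OF S u(1), of 0] by simp
      show "rop S u x \<le> 1" if "x \<in> topspace K"
        using rop_mono[OF S u(1), of "\<lambda>x. 1" x] u(4) rop_one[OF S that] by simp
    qed
    have PZ: "rop S u x = 0" if "x \<in> ?Z" for x
    proof -
      have "S ?h x = 0" by (rule zerosD[OF that ker_op[OF A S hker]])
      then show ?thesis using that unfolding Sh by (simp add: cplx_def zeros_def)
    qed
    have dist: "L1d (cplx K v) (indicator ?U) = prob ?U - (\<integral>x. v x \<partial>\<mu>)"
      if v: "cont v" "\<And>x. x \<in> topspace K \<Longrightarrow> 0 \<le> v x \<and> v x \<le> 1" "\<And>x. x \<in> ?Z \<Longrightarrow> v x = 0" for v
    proof -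
      have "L1d (cplx K v) (indicator ?U) = (\<integral>x. indicator ?U x - v x \<partial>\<mu>)"
      proof (intro Bochner_Integration.integral_cong refl)
        fix x assume "x \<in> space \<mu>"
        then have x: "x \<in> topspace K" by (simp add: space_mu)
        show "cmod (cplx K v x - indicator ?U x) = indicator ?U x - v x"
        proof (cases "x \<in> ?Z")
          case False
          have "cmod (of_real (v x) - 1) = \<bar>v x - 1\<bar>" by (metis norm_of_real of_real_1 of_real_diff)
          then show ?thesis using x False v(2)[OF x] by (simp add: cplx_def)
        qed (use x v(3) in \<open>simp add: cplx_def\<close>)
      qed
      also have "\<dots> = (\<integral>x. indicator ?U x \<partial>\<mu>) - (\<integral>x. v x \<partial>\<mu>)"
        using Us by (intro Bochner_Integration.integral_diff cont_integrable v integrable_real_indicator)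
          (simp_all add: emeasure_eq_measure)
      also have "(\<integral>x. indicator ?U x \<partial>\<mu>) = prob ?U"
        using sets.sets_into_space[OF Us] by (simp add: Int_absorb2)
      finally show ?thesis .
    qed
    have "prob ?U - (\<integral>x. u x \<partial>\<mu>) < e"
    proof -
      have Cs: "C \<in> sets \<mu>" "V - C \<in> sets \<mu>" using CV open_sets closed_sets by blast+
      have "prob C = (\<integral>x. indicator C x \<partial>\<mu>)"
        using sets.sets_into_space[OF Cs(1)] by (simp add: Int_absorb2)
      also have "\<dots> \<le> (\<integral>x. u x \<partial>\<mu>)"
        using Cs u by (intro integral_mono cont_integrable integrable_real_indicator)
          (auto simp: emeasure_eq_measure indicator_def space_mu)
      finally have "prob C \<le> (\<integral>x. u x \<partial>\<mu>)" .
      moreover have "prob ?U \<le> prob (C \<union> (V - C))"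
        using CV by (intro finite_measure_mono sets.Un Cs) auto
      moreover have "\<dots> \<le> prob C + prob (V - C)"
        by (intro measure_Un_le Cs)
      ultimately show ?thesis using CV(5) by linarith
    qed
    then have "L1d ?h (indicator ?U) < e" "L1d (S ?h) (indicator ?U) < e"
      unfolding Sh using dist[OF u(1) u(4) u(2)] dist[OF cP _ PZ] P01 rop_invariant[OF S u(1)] by simp_all
    then show "\<exists>h\<in>Cfun K. L1d h (indicator ?U) < e \<and> L1d (S h) (indicator ?U) < e"
      using h by blast
  qed
  then obtain c where c: "AE x in \<mu>. (indicator ?U x :: complex) = c" using ergodic_constant[OF \<mu>] by blast
  show ?thesis
  proof (cases "c = 0")
    case True
    have "AE x in \<mu>. x \<in> ?Z" using c AE_carrier[OF \<mu>] by eventually_elim (use True in \<open>auto simp: indicator_def split: if_splits\<close>)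
    then show ?thesis ..
  next
    case False
    have "AE x in \<mu>. x \<notin> ?Z" using c by eventually_elim (use False in \<open>auto simp: indicator_def split: if_splits\<close>)
    then show ?thesis ..
  qed
qed

text \<open>If neither zero set is conull, both are null by the zero-one law; but their union is the
  zero set of the joint kernel, which is conull. This is what lets the hull-kernel closure commute
  with finite unions.\<close>

lemma null_ideal_prime:
  assumes A: "A \<subseteq> PrimS" and B: "B \<subseteq> PrimS" and \<mu>: "\<mu> \<in> ergodic" and le: "ker K (A \<union> B) \<subseteq> I \<mu>"
  shows "ker K A \<subseteq> I \<mu> \<or> ker K B \<subseteq> I \<mu>"
proof -
  interpret prob_space \<mu> by (rule ergodic_prob[OF \<mu>])
  have ker: "ker K C \<subseteq> I \<mu>" if C: "C \<subseteq> PrimS" and ae: "AE x in \<mu>. x \<in> zset C" for C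
  proof
    fix f assume f: "f \<in> ker K C"
    have "AE x in \<mu>. f x = 0" using ae by eventually_elim (use f in \<open>simp add: zeros_def\<close>)
    then show "f \<in> I \<mu>" using ker_Cfun[OF f] by (simp add: null_ideal_iff[OF \<mu>])
  qed
  have "(AE x in \<mu>. x \<in> zset A) \<or> (AE x in \<mu>. x \<in> zset B)"
  proof (rule ccontr)
    assume "\<not> ?thesis"
    then have a: "AE x in \<mu>. x \<notin> zset A" and b: "AE x in \<mu>. x \<notin> zset B"
      using zero_one_law[OF A \<mu>] zero_one_law[OF B \<mu>] by blast+
    have "AE x in \<mu>. x \<in> zset (A \<union> B)" using A B by (intro AE_zeros_ker \<mu> le) auto
    then have "AE x in \<mu>. False"
      using a b by eventually_elim (simp add: zeros_ker_Un[OF A B])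
    then show False by simp
  qed
  then show ?thesis using ker[OF A] ker[OF B] by blast
qed

section \<open>The hull-kernel topology\<close>

lemma hk_mono: "A \<subseteq> B \<Longrightarrow> hk A \<subseteq> hk B"
  using ker_antimono[of A B] by (auto simp: hk_closure_def)

lemma hk_extensive: "A \<subseteq> PrimS \<Longrightarrow> A \<subseteq> hk A"
  using ker_subset[of _ A] by (auto simp: hk_closure_def)

lemma hk_subset: "hk A \<subseteq> PrimS"
  by (auto simp: hk_closure_def)

lemma hk_Un:
  assumes "A \<subseteq> PrimS" "B \<subseteq> PrimS"
  shows "hk (A \<union> B) = hk A \<union> hk B"
proof
  show "hk A \<union> hk B \<subseteq> hk (A \<union> B)"
    using hk_mono[of A "A \<union> B"] hk_mono[of B "A \<union> B"] by blast
  show "hk (A \<union> B) \<subseteq> hk A \<union> hk B"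
  proof
    fix q assume q: "q \<in> hk (A \<union> B)"
    then have "q \<in> PrimS" "ker K (A \<union> B) \<subseteq> q" by (auto simp: hk_closure_def)
    then show "q \<in> hk A \<union> hk B"
      using null_ideal_prime[OF assms] by (auto simp: hk_closure_def elim!: PrimE)
  qed
qed

lemma hk_empty: "hk {} = {}"
proof -
  have False if q: "q \<in> PrimS" "Cfun K \<subseteq> q" for q
  proof -
    obtain \<mu> where \<mu>: "\<mu> \<in> ergodic" "q = I \<mu>" by (rule PrimE[OF q(1)])
    have "one_on K \<in> I \<mu>" using q(2) \<mu> Cfun_one by blast
    then have "AE x in \<mu>. one_on K x = 0" by (simp add: null_ideal_iff[OF \<mu>(1)])
    then have "AE x in \<mu>. x \<in> topspace K \<and> one_on K x = 0" using AE_carrier[OF \<mu>(1)] by eventually_elim simp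
    then obtain x where "x \<in> topspace K \<and> one_on K x = 0" by (rule AE_ex[OF \<mu>(1)])
    then show False by auto
  qed
  then show ?thesis by (auto simp: hk_closure_def ker_def)
qed

lemma istopology_prim:
  "istopology (\<lambda>U. U \<subseteq> PrimS \<and> hk (PrimS - U) = PrimS - U)"
  unfolding istopology_def
proof (rule conjI; intro allI impI)
  fix U V assume U: "U \<subseteq> PrimS \<and> hk (PrimS - U) = PrimS - U"
    and V: "V \<subseteq> PrimS \<and> hk (PrimS - V) = PrimS - V"
  have "PrimS - U \<inter> V = (PrimS - U) \<union> (PrimS - V)" by blast
  then show "U \<inter> V \<subseteq> PrimS \<and> hk (PrimS - U \<inter> V) = PrimS - U \<inter> V"
    using U V hk_Un[of "PrimS - U" "PrimS - V"] by auto
next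
  fix \<U> assume U: "\<forall>U\<in>\<U>. U \<subseteq> PrimS \<and> hk (PrimS - U) = PrimS - U"
  have "hk (PrimS - \<Union>\<U>) \<subseteq> PrimS - U" if "U \<in> \<U>" for U
    using hk_mono[of "PrimS - \<Union>\<U>" "PrimS - U"] U that by blast
  then have "hk (PrimS - \<Union>\<U>) \<subseteq> PrimS - \<Union>\<U>" using hk_subset[of "PrimS - \<Union>\<U>"] by blast
  moreover have "PrimS - \<Union>\<U> \<subseteq> hk (PrimS - \<Union>\<U>)" by (rule hk_extensive) blast
  moreover have "\<Union>\<U> \<subseteq> PrimS" using U by blast
  ultimately show "\<Union>\<U> \<subseteq> PrimS \<and> hk (PrimS - \<Union>\<U>) = PrimS - \<Union>\<U>" by blast
qed

abbreviation primtop :: "('a \<Rightarrow> complex) set topology" where "primtop \<equiv> prim_topology K \<S>"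

lemma openin_prim: "openin primtop U \<longleftrightarrow> U \<subseteq> PrimS \<and> hk (PrimS - U) = PrimS - U"
  unfolding prim_topology_def topology_inverse'[OF istopology_prim] by (rule refl)

lemma topspace_prim: "topspace primtop = PrimS"
proof
  show "topspace primtop \<subseteq> PrimS" using openin_topspace[of primtop] unfolding openin_prim by blast
  show "PrimS \<subseteq> topspace primtop" by (rule openin_subset) (simp add: openin_prim hk_empty)
qed

lemma closedin_prim: "closedin primtop C \<longleftrightarrow> C \<subseteq> PrimS \<and> hk C = C"
  unfolding closedin_def topspace_prim openin_prim by (auto simp: double_diff)

section \<open>The support of the radical\<close>

abbreviation M :: "'a set" where "M \<equiv> Msupp K \<S>"

text \<open>Existence is \<open>ker_zeros\<close>. Uniqueness holds because Urysohn functions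
  separate points from closed sets, so a closed set is determined by the functions vanishing on
  it.\<close>

lemma Msupp_eq: "M = zeros (rad K \<S>)"
  unfolding Msupp_def
proof (rule the_equality)
  let ?Z = "zeros (rad K \<S>)"
  have cZ: "closedin K ?Z" unfolding rad_def by (rule closedin_zeros_ker)
  have radZ: "rad K \<S> = {f \<in> Cfun K. \<forall>x\<in>?Z. f x = 0}" using ker_zeros[OF order_refl] unfolding rad_def by blast
  then show "closedin K ?Z \<and> rad K \<S> = {f \<in> Cfun K. \<forall>x\<in>?Z. f x = 0}" using cZ by blast
  fix N assume N: "closedin K N \<and> rad K \<S> = {f \<in> Cfun K. \<forall>x\<in>N. f x = 0}"
  have sub: "Y \<subseteq> X" if X: "closedin K X" and Y: "closedin K Y"
    and eq: "{f \<in> Cfun K. \<forall>x\<in>X. f x = 0} = {f \<in> Cfun K. \<forall>x\<in>Y. f x = 0}" for X Y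
  proof
    fix y assume y: "y \<in> Y"
    have yK: "y \<in> topspace K" using y closedin_subset[OF Y] by blast
    show "y \<in> X"
    proof (rule ccontr)
      assume "y \<notin> X"
      then have dis: "X \<inter> {y} = {}" by blast
      have cy: "closedin K {y}" using yK hausdorff by (rule closedin_Hausdorff_singleton[rotated])
      obtain u where u: "cont u" "\<And>x. x \<in> X \<Longrightarrow> u x = 0" "\<And>x. x \<in> {y} \<Longrightarrow> u x = 1"
        by (rule urysohn[OF X cy dis]) blast
      have "cplx K u \<in> {f \<in> Cfun K. \<forall>x\<in>X. f x = 0}" using cplx_in_Cfun[OF u(1)] u(2) by (simp add: cplx_def)
      then have "cplx K u y = 0" unfolding eq using y by blast
      then show False using u(3)[of y] yK by (simp add: cplx_def)
    qed
  qed
  have eq: "{f \<in> Cfun K. \<forall>x\<in>N. f x = 0} = {f \<in> Cfun K. \<forall>x\<in>?Z. f x = 0}" using N radZ by simp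
  show "N = ?Z" using N by (intro antisym sub[OF cZ _ eq[symmetric]] sub[OF _ cZ eq]) auto
qed

lemma closedin_M: "closedin K M"
  unfolding Msupp_eq rad_def by (rule closedin_zeros_ker)

lemma M_subset: "M \<subseteq> topspace K"
  by (rule closedin_subset[OF closedin_M])

lemma topspace_M: "topspace KM = M"
  using M_subset by auto

lemma AE_M:
  assumes "\<mu> \<in> ergodic"
  shows "AE x in \<mu>. x \<in> M"
  unfolding Msupp_eq rad_def using Prim_I[OF assms] by (intro AE_zeros_ker assms ker_subset order_refl)

lemma rad_iff: "f \<in> rad K \<S> \<longleftrightarrow> f \<in> Cfun K \<and> (\<forall>\<mu>\<in>ergodic. AE x in \<mu>. f x = 0)"
  unfolding rad_def using ker_iff[OF order_refl] Prim_I by blast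

lemma rad_zero: "f \<in> rad K \<S> \<Longrightarrow> x \<in> M \<Longrightarrow> f x = 0"
  by (simp add: Msupp_eq zeros_def)

lemma Cfun_extension:
  assumes f: "f \<in> Cfun KM"
  shows "\<exists>F. F \<in> Cfun K \<and> (\<forall>x\<in>M. F x = f x)"
proof -
  have ext: "\<exists>g. cont g \<and> (\<forall>x\<in>M. g x = u x)" if u: "continuous_map KM euclideanreal u" for u
    by (rule Tietze_extension_realinterval[OF normal closedin_M _ _ u, of UNIV]) auto
  obtain g where g: "cont g" "\<forall>x\<in>M. g x = Re (f x)" using ext[OF continuous_map_Re[OF f]] by blast
  obtain h where h: "cont h" "\<forall>x\<in>M. h x = Im (f x)" using ext[OF continuous_map_Im[OF f]] by blast
  let ?F = "\<lambda>x. cplx K g x + \<i> * cplx K h x"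
  have "?F \<in> Cfun K" by (intro Cfun_add Cfun_cmult cplx_in_Cfun g h)
  moreover have "?F x = f x" if "x \<in> M" for x
    using g(2) h(2) that M_subset by (auto simp: cplx_def complex_eq_iff)
  ultimately show ?thesis by blast
qed

section \<open>Fixed functions on the support as functions constant for every ergodic
  measure\<close>

definition AE_const :: "('a \<Rightarrow> complex) \<Rightarrow> bool" where
  "AE_const f \<longleftrightarrow> (\<forall>\<mu>\<in>ergodic. \<exists>c. AE x in \<mu>. f x = c)"

text \<open>The fixed functions on \<open>M\<close> are those which are constant almost everywhere for each ergodic
  measure; all lattice properties of the fixed space are read off from this description.\<close>

lemma rad_fix_iff: "f \<in> Fix \<longleftrightarrow> f \<in> Cfun KM \<and> AE_const f"
proof (cases "f \<in> Cfun KM")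
  case f: True
  define F where "F = (SOME F. F \<in> Cfun K \<and> (\<forall>x\<in>M. F x = f x))"
  have F: "F \<in> Cfun K" and Ff: "\<And>x. x \<in> M \<Longrightarrow> F x = f x"
    using someI_ex[OF Cfun_extension[OF f]] unfolding F_def by blast+
  have ind: "induced_op K M S f = (\<lambda>x. if x \<in> M then S F x else 0)" for S
    unfolding induced_op_def Let_def F_def using f by simp
  have off: "f x = 0" if "x \<notin> M" for x using Cfun_off[OF f] that by (simp add: topspace_M)
  have fix_iff: "f \<in> Fix \<longleftrightarrow> (\<forall>S\<in>\<S>. \<forall>x\<in>M. S F x = F x)"
    using f Ff off by (auto simp: rad_fix_def fixspace_def rad_semigroup_def ind fun_eq_iff)
  have AE_F: "(AE x in \<mu>. F x = c) \<longleftrightarrow> (AE x in \<mu>. f x = c)" if "\<mu> \<in> ergodic" for \<mu> c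
  proof
    assume "AE x in \<mu>. F x = c"
    with AE_M[OF that] show "AE x in \<mu>. f x = c" by eventually_elim (use Ff in auto)
  next
    assume "AE x in \<mu>. f x = c"
    with AE_M[OF that] show "AE x in \<mu>. F x = c" by eventually_elim (use Ff in auto)
  qed
  have "(\<forall>S\<in>\<S>. \<forall>x\<in>M. S F x = F x) \<longleftrightarrow> AE_const f"
  proof
    \<comment> \<open>Every ergodic measure is concentrated on \<open>M\<close>, so \<open>F\<close>
      is fixed in its L1 space and ergodicity makes it constant.\<close>
    assume fixed: "\<forall>S\<in>\<S>. \<forall>x\<in>M. S F x = F x"
    show "AE_const f"
      unfolding AE_const_def
    proof
      fix \<mu> assume \<mu>: "\<mu> \<in> ergodic"
      interpret invariant_measure K \<S> \<mu> by (rule ergodic_invariant[OF \<mu>])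
      have "F \<in> L1_fix K \<S> \<mu>"
      proof (rule L1_fixI[OF Cfun_integrable[OF F] contraction])
        fix S and e :: real assume S: "S \<in> \<S>" and e: "0 < e"
        have "AE x in \<mu>. cmod (S F x - F x) = 0" using AE_M[OF \<mu>] by eventually_elim (use fixed S in simp)
        then have "L1d (S F) F = 0" by (rule integral_eq_zero_AE)
        then show "\<exists>h\<in>Cfun K. L1d h F < e \<and> L1d (S h) F < e"
          using e F by (intro bexI[of _ F]) simp_all
      qed
      then show "\<exists>c. AE x in \<mu>. f x = c" using ergodic_constant[OF \<mu>] AE_F[OF \<mu>] by blast
    qed
  next
    \<comment> \<open>For each ergodic measure, with its own constant \<open>c\<close>, the function
      \<open>F - c\<close> lies in the null ideal, and so does its image. Hence
      \<open>S F - F\<close> is null for all of these measures, lies in the radical, and vanishes at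
      every point of \<open>M\<close>.\<close>
    assume const: "AE_const f"
    show "\<forall>S\<in>\<S>. \<forall>x\<in>M. S F x = F x"
    proof
      fix S assume S: "S \<in> \<S>"
      have "AE x in \<mu>. S F x - F x = 0" if \<mu>: "\<mu> \<in> ergodic" for \<mu>
      proof -
        obtain c where "AE x in \<mu>. f x = c" using const \<mu> by (auto simp: AE_const_def)
        then have c: "AE x in \<mu>. F x = c" using AE_F[OF \<mu>] by blast
        have oC: "(\<lambda>x. c * one_on K x) \<in> Cfun K" by (intro Cfun_cmult Cfun_one)
        let ?g = "\<lambda>x. F x - c * one_on K x"
        have g: "?g \<in> Cfun K" by (intro Cfun_diff F oC)
        have "AE x in \<mu>. ?g x = 0" using c AE_carrier[OF \<mu>] by eventually_elim simp
        then have "?g \<in> I \<mu>" using g by (simp add: null_ideal_iff[OF \<mu>])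
        then have "S ?g \<in> I \<mu>" by (rule null_ideal_op[OF \<mu> S])
        then have "AE x in \<mu>. S ?g x = 0" by (simp add: null_ideal_iff[OF \<mu>])
        moreover have "S ?g = (\<lambda>x. S F x - c * one_on K x)"
          using op_diff[OF S F oC] op_cmult[OF S Cfun_one] op_one[OF S] by simp
        ultimately have "AE x in \<mu>. S F x - c * one_on K x = 0" by simp
        then show ?thesis using c AE_carrier[OF \<mu>] by eventually_elim simp
      qed
      moreover have "(\<lambda>x. S F x - F x) \<in> Cfun K" by (intro Cfun_diff op_Cfun[OF S F] F)
      ultimately have "(\<lambda>x. S F x - F x) \<in> rad K \<S>" by (simp add: rad_iff)
      then show "\<forall>x\<in>M. S F x = F x" using rad_zero by fastforce
    qed
  qed
  then show ?thesis using fix_iff f by blast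
next
  case False
  then show ?thesis by (auto simp: rad_fix_def fixspace_def)
qed

section \<open>The transform \<open>hat\<close> and its algebraic properties\<close>

lemma AE_const_unique:
  assumes "\<mu> \<in> ergodic" "AE x in \<mu>. f x = c" "AE x in \<mu>. f x = d"
  shows "c = d"
proof -
  have "AE x in \<mu>. f x = c \<and> f x = d" using assms(2,3) by eventually_elim simp
  then obtain x where "f x = c \<and> f x = d" by (rule AE_ex[OF assms(1)])
  then show ?thesis by auto
qed

lemma set_integral_const:
  assumes f: "f \<in> Cfun KM" and \<mu>: "\<mu> \<in> ergodic" and c: "AE x in \<mu>. f x = c"
  shows "set_lebesgue_integral \<mu> M f = c"
proof -
  interpret regular_measure K \<mu> by (rule ergodic_regular[OF \<mu>])
  obtain F where F: "F \<in> Cfun K" "\<And>x. x \<in> M \<Longrightarrow> F x = f x" using Cfun_extension[OF f] by blast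
  have "set_lebesgue_integral \<mu> M f = (\<integral>x. indicator M x *\<^sub>R F x \<partial>\<mu>)"
    unfolding set_lebesgue_integral_def by (intro Bochner_Integration.integral_cong) (auto simp: indicator_def F(2))
  also have "\<dots> = (\<integral>x. c \<partial>\<mu>)"
  proof (rule integral_cong_AE)
    have "M \<in> sets \<mu>" by (rule closed_sets[OF closedin_M])
    then show "(\<lambda>x. indicator M x *\<^sub>R F x) \<in> borel_measurable \<mu>"
      using Cfun_measurable[OF F(1)] by measurable
    show "AE x in \<mu>. indicator M x *\<^sub>R F x = c" using c AE_M[OF \<mu>] by eventually_elim (simp add: F(2))
  qed simp
  finally show ?thesis by (simp add: prob_space)
qed

text \<open>The definite description is justified here: if \<open>f\<close> equals \<open>d\<close>
  almost everywhere for \<open>\<nu>\<close>, then \<open>F - d\<close> lies in the shared null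
  ideal, so \<open>f\<close> equals \<open>d\<close> almost everywhere for \<open>\<mu>\<close> too,
  and \<open>d = c\<close>.\<close>

lemma hat_eq:
  assumes f: "f \<in> Fix" and \<mu>: "\<mu> \<in> ergodic" and c: "AE x in \<mu>. f x = c"
  shows "Hat f (I \<mu>) = c"
proof -
  have fC: "f \<in> Cfun KM" and const: "AE_const f" using f by (simp_all add: rad_fix_iff)
  obtain F where F: "F \<in> Cfun K" "\<And>x. x \<in> M \<Longrightarrow> F x = f x" using Cfun_extension[OF fC] by blast
  have same: "set_lebesgue_integral \<nu> M f = c" if \<nu>: "\<nu> \<in> ergodic" "I \<nu> = I \<mu>" for \<nu>
  proof -
    obtain d where d: "AE x in \<nu>. f x = d" using const \<nu> by (auto simp: AE_const_def)
    let ?g = "\<lambda>x. F x - d * one_on K x"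
    have g: "?g \<in> Cfun K" by (intro Cfun_diff F Cfun_cmult Cfun_one)
    have "AE x in \<nu>. ?g x = 0"
      using d AE_M[OF \<nu>(1)] by eventually_elim (use F(2) M_subset in auto)
    then have "?g \<in> I \<mu>" using g \<nu> null_ideal_iff[OF \<nu>(1)] by blast
    then have "AE x in \<mu>. ?g x = 0" by (simp add: null_ideal_iff[OF \<mu>])
    then have "AE x in \<mu>. f x = d"
      using AE_M[OF \<mu>] by eventually_elim (use F(2) M_subset in \<open>auto simp: indicator_def split: if_splits\<close>)
    then have "d = c" using AE_const_unique[OF \<mu> _ c] by blast
    then show ?thesis using set_integral_const[OF fC \<nu>(1) d] by simp
  qed
  have "(THE c. \<forall>\<nu>\<in>ergodic. I \<nu> = I \<mu> \<longrightarrow> set_lebesgue_integral \<nu> M f = c) = c"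
    by (rule the_equality) (use same \<mu> in blast)+
  then show ?thesis using Prim_I[OF \<mu>] by (simp add: hat_def)
qed

lemma AE_hat:
  assumes f: "f \<in> Fix" and \<mu>: "\<mu> \<in> ergodic"
  shows "AE x in \<mu>. f x = Hat f (I \<mu>)"
proof -
  obtain c where c: "AE x in \<mu>. f x = c" using f \<mu> unfolding rad_fix_iff AE_const_def by blast
  then show ?thesis using hat_eq[OF f \<mu> c] by simp
qed

lemma hat_off: "p \<notin> PrimS \<Longrightarrow> Hat f p = 0"
  by (simp add: hat_def)

lemma hat_ext:
  assumes "f \<in> Fix" "\<And>\<mu>. \<mu> \<in> ergodic \<Longrightarrow> AE x in \<mu>. f x = \<phi> (I \<mu>)" "\<And>p. p \<notin> PrimS \<Longrightarrow> \<phi> p = 0"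
  shows "Hat f = \<phi>"
proof
  fix p
  show "Hat f p = \<phi> p"
  proof (cases "p \<in> PrimS")
    case True
    then obtain \<mu> where "\<mu> \<in> ergodic" "p = I \<mu>" by (rule PrimE)
    then show ?thesis using hat_eq[OF assms(1) _ assms(2)] by blast
  qed (simp add: hat_off assms(3))
qed

text \<open>Scalar multiples, conjugation and modulus are instances; \<open>h 0 = 0\<close> respects
  the value 0 off the carriers.\<close>

lemma fix_compose:
  assumes f: "f \<in> Fix" and h: "continuous_on UNIV h" "h 0 = 0"
  shows "(\<lambda>x. h (f x)) \<in> Fix" "Hat (\<lambda>x. h (f x)) = (\<lambda>p. h (Hat f p))"
proof -
  have ae: "AE x in \<mu>. h (f x) = h (Hat f (I \<mu>))" if "\<mu> \<in> ergodic" for \<mu>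
    using AE_hat[OF f that] by eventually_elim simp
  show fixed: "(\<lambda>x. h (f x)) \<in> Fix"
    using f Cfun_compose[OF _ h] ae unfolding rad_fix_iff AE_const_def by blast
  show "Hat (\<lambda>x. h (f x)) = (\<lambda>p. h (Hat f p))"
    by (rule hat_ext[OF fixed ae]) (simp_all add: hat_off h(2))
qed

lemma fix_add:
  assumes f: "f \<in> Fix" and g: "g \<in> Fix"
  shows "(\<lambda>x. f x + g x) \<in> Fix" "Hat (\<lambda>x. f x + g x) = (\<lambda>p. Hat f p + Hat g p)"
proof -
  have ae: "AE x in \<mu>. f x + g x = Hat f (I \<mu>) + Hat g (I \<mu>)" if "\<mu> \<in> ergodic" for \<mu>
    using AE_hat[OF f that] AE_hat[OF g that] by eventually_elim simp
  show fixed: "(\<lambda>x. f x + g x) \<in> Fix"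
    using f g Cfun_add ae unfolding rad_fix_iff AE_const_def by blast
  show "Hat (\<lambda>x. f x + g x) = (\<lambda>p. Hat f p + Hat g p)"
    by (rule hat_ext[OF fixed ae]) (simp_all add: hat_off)
qed

lemma fix_one: "one_on KM \<in> Fix" "Hat (one_on KM) = one_on primtop"
proof -
  have ae: "AE x in \<mu>. one_on KM x = one_on primtop (I \<mu>)" if "\<mu> \<in> ergodic" for \<mu>
    using AE_M[OF that] unfolding topspace_M topspace_prim by eventually_elim (simp add: Prim_I[OF that])
  show fixed: "one_on KM \<in> Fix"
    using Cfun_one[of "KM"] ae unfolding rad_fix_iff AE_const_def by blast
  show "Hat (one_on KM) = one_on primtop"
    by (rule hat_ext[OF fixed ae]) (simp_all add: topspace_prim)
qed

section \<open>Closedness of the fixed space; isometry, continuity and injectivity of the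
  transform\<close>

lemma compact_hausdorff_M: "compact_hausdorff KM"
  using closedin_M closedin_iff_compactin
  by unfold_locales (simp_all add: compact_space_subtopology Hausdorff_space_subtopology hausdorff)

lemma le_supnorm_M: "f \<in> Cfun KM \<Longrightarrow> x \<in> M \<Longrightarrow> cmod (f x) \<le> supnorm KM f"
  using compact_hausdorff.cmod_le_supnorm[OF compact_hausdorff_M] by (simp only: topspace_M)

text \<open>Countably many almost sure equations \<open>h n x = c n\<close> hold simultaneously
  almost everywhere, and there \<open>f x\<close> is the limit of the constants.\<close>

lemma fix_closed:
  assumes h: "\<And>n::nat. h n \<in> Fix" and f: "f \<in> Cfun KM"
    and lim: "(\<lambda>n. supnorm KM (\<lambda>x. h n x - f x)) \<longlonglongrightarrow> 0"
  shows "f \<in> Fix"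
proof -
  have "\<exists>c. AE x in \<mu>. f x = c" if \<mu>: "\<mu> \<in> ergodic" for \<mu>
  proof -
    define c where "c n = Hat (h n) (I \<mu>)" for n
    have "AE x in \<mu>. \<forall>n. h n x = c n" unfolding c_def using AE_hat[OF h \<mu>] by (simp add: AE_all_countable)
    then have "AE x in \<mu>. f x = Topological_Spaces.lim c"
      using AE_M[OF \<mu>]
    proof eventually_elim
      case (elim x)
      have "(\<lambda>n. h n x - f x) \<longlonglongrightarrow> 0"
      proof (rule Lim_null_comparison[OF always_eventually lim])
        show "\<forall>n. norm (h n x - f x) \<le> supnorm KM (\<lambda>x. h n x - f x)"
        proof
          fix n
          have "h n \<in> Cfun KM" using h[of n] by (simp add: rad_fix_iff)
          then show "norm (h n x - f x) \<le> supnorm KM (\<lambda>x. h n x - f x)"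
            using le_supnorm_M[OF Cfun_diff[OF _ f] elim(2)] by blast
        qed
      qed
      then have "(\<lambda>n. h n x) \<longlonglongrightarrow> f x" by (simp add: LIM_zero_iff)
      then have "c \<longlonglongrightarrow> f x" using elim(1) by simp
      then show ?case by (simp add: limI)
    qed
    then show ?thesis by blast
  qed
  then show ?thesis using f by (simp add: rad_fix_iff AE_const_def)
qed

lemma banach_sublattice_fix: "banach_sublattice KM (Fix)"
  unfolding banach_sublattice_def clinear_subspace_def
proof (intro conjI ballI allI impI)
  show "Fix \<subseteq> Cfun KM" by (auto simp: rad_fix_iff)
  show "(\<lambda>x. 0) \<in> Fix" using fix_compose(1)[OF fix_one(1), of "\<lambda>x. 0"] by simp
  show "(\<lambda>x. c * f x) \<in> Fix" if "f \<in> Fix" for c f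
    using that by (rule fix_compose(1)) (auto intro!: continuous_intros)
  show "(\<lambda>x. cnj (f x)) \<in> Fix" if "f \<in> Fix" for f
    using that by (rule fix_compose(1)) (auto intro!: continuous_intros)
  show "modulus f \<in> Fix" if "f \<in> Fix" for f
    unfolding modulus_def using that by (rule fix_compose(1)) (auto intro!: continuous_intros)
qed (use fix_add fix_closed in blast)+

text \<open>The excess of \<open>cmod (F x)\<close> over \<open>B\<close> is null for every ergodic
  measure, so it lies in the radical and vanishes at each point of \<open>M\<close>. This gives one
  half of the isometry and, for \<open>B = 0\<close>, injectivity.\<close>

lemma hat_bound:
  assumes f: "f \<in> Fix" and B: "0 \<le> B" "\<And>p. p \<in> PrimS \<Longrightarrow> cmod (Hat f p) \<le> B" and x: "x \<in> M"
  shows "cmod (f x) \<le> B"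
proof -
  have fC: "f \<in> Cfun KM" using f by (simp add: rad_fix_iff)
  obtain F where F: "F \<in> Cfun K" "\<And>x. x \<in> M \<Longrightarrow> F x = f x" using Cfun_extension[OF fC] by blast
  let ?h = "\<lambda>z::complex. complex_of_real (max (cmod z - B) 0)"
  have "(\<lambda>x. ?h (F x)) \<in> Cfun K"
    by (rule Cfun_compose[OF F(1), of ?h]) (use B(1) in \<open>auto intro!: continuous_intros\<close>)
  moreover have "AE x in \<mu>. ?h (F x) = 0" if \<mu>: "\<mu> \<in> ergodic" for \<mu>
    using AE_hat[OF f \<mu>] AE_M[OF \<mu>]
  proof eventually_elim
    case (elim x)
    then have "cmod (F x) \<le> B" using F(2) B(2)[OF Prim_I[OF \<mu>]] by simp
    then show ?case by simp
  qed
  ultimately have "(\<lambda>x. ?h (F x)) \<in> rad K \<S>" by (simp add: rad_iff)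
  from rad_zero[OF this x] show ?thesis using F(2)[OF x] by (simp add: max_def split: if_splits)
qed

lemma hat_attained:
  assumes f: "f \<in> Fix" and p: "p \<in> PrimS"
  obtains x where "x \<in> M" "f x = Hat f p"
proof -
  obtain \<mu> where \<mu>: "\<mu> \<in> ergodic" "p = I \<mu>" using p by (rule PrimE)
  have "AE x in \<mu>. x \<in> M \<and> f x = Hat f p"
    using AE_hat[OF f \<mu>(1)] AE_M[OF \<mu>(1)] unfolding \<mu>(2) by eventually_elim simp
  then show thesis using AE_ex[OF \<mu>(1)] that by blast
qed

lemma hat_isometric:
  assumes f: "f \<in> Fix"
  shows "supnorm primtop (Hat f) = supnorm KM f"
proof -
  have fC: "f \<in> Cfun KM" using f by (simp add: rad_fix_iff)
  let ?P = "insert 0 ((\<lambda>p. cmod (Hat f p)) ` PrimS)" and ?X = "insert 0 ((\<lambda>x. cmod (f x)) ` M)"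
  have P: "supnorm primtop (Hat f) = Sup ?P" and X: "supnorm KM f = Sup ?X"
    unfolding supnorm_def topspace_prim topspace_M by (rule refl)+
  have eqs: "?P \<subseteq> ?X" using hat_attained[OF f] by (auto simp: image_iff) metis
  have bX: "bdd_above ?X"
    using le_supnorm_M[OF fC] by (auto intro!: bdd_aboveI[of _ "max 0 (supnorm KM f)"] simp: le_max_iff_disj)
  have bP: "bdd_above ?P" by (rule bdd_above_mono[OF bX eqs])
  have "Sup ?P \<le> Sup ?X" by (rule cSup_subset_mono[OF _ bX eqs]) simp
  moreover have "Sup ?X \<le> Sup ?P"
  proof (rule cSup_least)
    have nonneg: "0 \<le> Sup ?P" by (rule cSup_upper[OF _ bP]) simp
    have le: "cmod (Hat f p) \<le> Sup ?P" if "p \<in> PrimS" for p using that by (intro cSup_upper[OF _ bP]) simp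
    fix y assume "y \<in> ?X"
    then show "y \<le> Sup ?P" using nonneg hat_bound[OF f nonneg le] by auto
  qed simp
  ultimately show ?thesis unfolding P X by (rule antisym)
qed

text \<open>One function decides membership in the preimage of a closed set \<open>C\<close>: the
  distance from \<open>F x\<close> to \<open>C\<close> is null for \<open>\<mu>\<close> exactly when
  \<open>Hat f (I \<mu>)\<close> lies in \<open>C\<close>. So the preimage is a hull.\<close>

lemma hat_Cfun:
  assumes f: "f \<in> Fix"
  shows "Hat f \<in> Cfun primtop"
  unfolding Cfun_def
proof (intro CollectI conjI allI impI)
  show "Hat f p = 0" if "p \<notin> topspace primtop" for p using that by (simp add: topspace_prim hat_off)
  have fC: "f \<in> Cfun KM" using f by (simp add: rad_fix_iff)
  obtain F where F: "F \<in> Cfun K" "\<And>x. x \<in> M \<Longrightarrow> F x = f x" using Cfun_extension[OF fC] by blast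
  have AE_F: "AE x in \<mu>. x \<in> topspace K \<and> F x = Hat f (I \<mu>)" if \<mu>: "\<mu> \<in> ergodic" for \<mu>
    using AE_hat[OF f \<mu>] AE_M[OF \<mu>] by eventually_elim (use F(2) M_subset in auto)
  show "continuous_map primtop euclidean (Hat f)"
    unfolding continuous_map_closedin
  proof (intro conjI allI impI)
    fix C :: "complex set" assume "closedin euclidean C"
    then have C: "closed C" by simp
    let ?A = "{p \<in> PrimS. Hat f p \<in> C}"
    have "hk ?A \<subseteq> ?A"
    \<comment> \<open>\<open>infdist\<close> to the empty set is 0 by convention and would not
      detect membership.\<close>
    proof (cases "C = {}")
      case True
      then show ?thesis using hk_empty by simp
    next
      case False
      let ?g = "\<lambda>x. if x \<in> topspace K then complex_of_real (infdist (F x) C) else 0"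
      have g: "?g \<in> Cfun K"
        by (intro Cfun_restrict continuous_map_compose_unary[where h="\<lambda>z. complex_of_real (infdist z C)" and f=F]
            Cfun_continuous F continuous_intros)
      have g0: "(AE x in \<mu>. ?g x = 0) \<longleftrightarrow> Hat f (I \<mu>) \<in> C" if \<mu>: "\<mu> \<in> ergodic" for \<mu>
      proof
        assume "AE x in \<mu>. ?g x = 0"
        with AE_F[OF \<mu>] have "AE x in \<mu>. infdist (Hat f (I \<mu>)) C = 0" by eventually_elim auto
        then obtain x :: 'a where "infdist (Hat f (I \<mu>)) C = 0" by (rule AE_ex[OF \<mu>])
        then show "Hat f (I \<mu>) \<in> C" using C False by (simp add: in_closed_iff_infdist_zero)
      next
        assume "Hat f (I \<mu>) \<in> C"
        then have "infdist (Hat f (I \<mu>)) C = 0" by simp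
        with AE_F[OF \<mu>] show "AE x in \<mu>. ?g x = 0" by (auto elim!: AE_mp)
      qed
      have "?g \<in> ker K ?A" using g g0 by (subst ker_iff) auto
      then show ?thesis
        using g0 null_ideal_iff Prim_I by (auto simp: hk_closure_def elim!: PrimE)
    qed
    moreover have "?A \<subseteq> hk ?A" by (rule hk_extensive) blast
    ultimately have "closedin primtop ?A" unfolding closedin_prim by blast
    then show "closedin primtop {p \<in> topspace primtop. Hat f p \<in> C}" by (simp only: topspace_prim)
  qed simp
qed

lemma hat_inj:
  assumes f: "f \<in> Fix" and g: "g \<in> Fix" and eq: "Hat f = Hat g"
  shows "f = g"
proof
  fix x
  have d: "(\<lambda>x. f x + - 1 * g x) \<in> Fix" "Hat (\<lambda>x. f x + - 1 * g x) = (\<lambda>p. 0)"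
  proof -
    have g': "(\<lambda>x. - 1 * g x) \<in> Fix" "Hat (\<lambda>x. - 1 * g x) = (\<lambda>p. - 1 * Hat g p)"
      by (rule fix_compose[OF g]; auto intro!: continuous_intros)+
    show "(\<lambda>x. f x + - 1 * g x) \<in> Fix" by (rule fix_add(1)[OF f g'(1)])
    show "Hat (\<lambda>x. f x + - 1 * g x) = (\<lambda>p. 0)" unfolding fix_add(2)[OF f g'(1)] g'(2) eq by simp
  qed
  show "f x = g x"
  proof (cases "x \<in> M")
    case True
    have "cmod (f x + - 1 * g x) \<le> 0" by (rule hat_bound[OF d(1) order_refl _ True]) (simp only: d(2) norm_zero)
    then show ?thesis by simp
  next
    case False
    then have "x \<notin> topspace KM" by (simp only: topspace_M) simp
    moreover have "f \<in> Cfun KM" "g \<in> Cfun KM" using f g by (simp_all add: rad_fix_iff)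
    ultimately show ?thesis using Cfun_off by metis
  qed
qed

end

section \<open>Surjectivity of the transform\<close>

context amenable_system
begin

text \<open>Kernels are closed under the operators and under modulus, so vanishing at the common
  point \<open>x\<close> is the hypothesis of \<open>ergodic_measure_exists\<close> for the union of
  all these kernels.\<close>

lemma common_zero_ergodic:
  assumes \<A>: "\<And>A. A \<in> \<A> \<Longrightarrow> A \<subseteq> PrimS" and x: "x \<in> topspace K" and zero: "\<And>A. A \<in> \<A> \<Longrightarrow> x \<in> zset A"
  obtains \<mu> where "\<mu> \<in> ergodic" "\<And>A. A \<in> \<A> \<Longrightarrow> I \<mu> \<in> hk A"
proof -
  let ?G = "\<Union>A\<in>\<A>. ker K A"
  have "\<exists>\<mu>\<in>ergodic. ?G \<subseteq> I \<mu>"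
  proof (rule ergodic_measure_exists[OF _ x])
    show "?G \<subseteq> Cfun K" by (auto simp: ker_Cfun)
    fix S g assume S: "S \<in> \<S>" and "g \<in> ?G"
    then obtain A where A: "A \<in> \<A>" "g \<in> ker K A" by blast
    have "S (modulus g) \<in> ker K A"
      by (rule ker_op[OF \<A>[OF A(1)] S ker_modulus[OF \<A>[OF A(1)] A(2)]])
    then show "S (modulus g) x = 0" by (rule zerosD[OF zero[OF A(1)]])
  qed
  then obtain \<mu> where \<mu>: "\<mu> \<in> ergodic" "?G \<subseteq> I \<mu>" by blast
  show thesis
  proof (rule that[OF \<mu>(1)])
    fix A assume "A \<in> \<A>"
    then show "I \<mu> \<in> hk A" using \<mu> Prim_I by (auto simp: hk_closure_def)
  qed
qed

text \<open>A real continuous function \<open>u\<close> on the primitive spectrum is transported to \<open>M\<close> by its sublevel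
  sets: \<open>f x\<close> is the least \<open>a\<close> such that \<open>x\<close> is a common zero of the kernel of \<open>{u \<le> a}\<close>. The zero sets
  of \<open>{u \<le> a}\<close> and \<open>{u \<ge> b}\<close> are disjoint for \<open>a < b\<close>, since a common point would carry an ergodic
  measure lying in both closed sets.\<close>

lemma real_function_lift:
  fixes u :: "('a \<Rightarrow> complex) set \<Rightarrow> real"
  assumes le: "\<And>a. hk {p \<in> PrimS. u p \<le> a} = {p \<in> PrimS. u p \<le> a}"
    and ge: "\<And>a. hk {p \<in> PrimS. a \<le> u p} = {p \<in> PrimS. a \<le> u p}"
  obtains f where "continuous_map KM euclideanreal f"
    "\<And>\<mu> x. \<mu> \<in> ergodic \<Longrightarrow> x \<in> zeros (I \<mu>) \<Longrightarrow> f x = u (I \<mu>)"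
proof -
  let ?A = "\<lambda>a. {p \<in> PrimS. u p \<le> a}" and ?B = "\<lambda>a. {p \<in> PrimS. a \<le> u p}"
  define Z where "Z a = zset (?A a)" for a
  define W where "W a = zset (?B a)" for a
  define f where "f x = Inf {a. x \<in> Z a}" for x
  have Zt: "Z a \<subseteq> topspace K" for a by (auto simp: Z_def zeros_def)
  have disjoint: False if x: "x \<in> Z a" "x \<in> W b" and "a < b" for x a b
  proof -
    have "x \<in> topspace K" using x(1) Zt by blast
    then obtain \<mu> where \<mu>: "\<mu> \<in> ergodic"
      "\<And>A. A \<in> {?A a, ?B b} \<Longrightarrow> I \<mu> \<in> hk A"
      by (rule common_zero_ergodic[of "{?A a, ?B b}", rotated])
        (use x in \<open>auto simp: Z_def W_def\<close>)
    have "I \<mu> \<in> ?A a" "I \<mu> \<in> ?B b"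
      using \<mu>(2)[of "?A a"] \<mu>(2)[of "?B b"] le ge by simp_all
    then show False using \<open>a < b\<close> by simp
  qed
  \<comment> \<open>The two level sets exhaust the spectrum, and passing to zero sets of kernels
    respects unions.\<close>
  have cover: "x \<in> Z a \<or> x \<in> W a" if "x \<in> M" for x a
  proof -
    have "?A a \<union> ?B a = PrimS" by auto
    then have "M = Z a \<union> W a"
      unfolding Msupp_eq rad_def Z_def W_def by (subst zeros_ker_Un[symmetric]) auto
    then show ?thesis using that by blast
  qed
  have Zmono: "Z a \<subseteq> Z b" if "a \<le> b" for a b
    unfolding Z_def by (rule zeros_ker_mono) (use that in auto)
  \<comment> \<open>Together with \<open>below\<close> this makes the infimum finite. A point in no
    \<open>Z a\<close> would lie in every \<open>W a\<close>, and an ergodic measure obtained from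
    all of them would have a value of \<open>u\<close> above every real number.\<close>
  have above: "\<exists>a. x \<in> Z a" if x: "x \<in> M" for x
  proof (rule ccontr)
    assume "\<nexists>a. x \<in> Z a"
    then have W: "x \<in> W a" for a using cover[OF x] by blast
    have "x \<in> topspace K" using x M_subset by blast
    then obtain \<mu> where \<mu>: "\<mu> \<in> ergodic" "\<And>A. A \<in> range (\<lambda>a. ?B a) \<Longrightarrow> I \<mu> \<in> hk A"
      by (rule common_zero_ergodic[of "range (\<lambda>a. ?B a)", rotated])
        (use W in \<open>auto simp: W_def\<close>)
    have "I \<mu> \<in> ?B (u (I \<mu>) + 1)" using \<mu>(2)[of "?B (u (I \<mu>) + 1)"] ge by simp
    then show False by simp
  qed
  have below: "\<exists>a. x \<notin> Z a" if x: "x \<in> M" for x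
  proof (rule ccontr)
    assume "\<nexists>a. x \<notin> Z a"
    then have Z: "x \<in> Z a" for a by blast
    have "x \<in> topspace K" using x M_subset by blast
    then obtain \<mu> where \<mu>: "\<mu> \<in> ergodic" "\<And>A. A \<in> range (\<lambda>a. ?A a) \<Longrightarrow> I \<mu> \<in> hk A"
      by (rule common_zero_ergodic[of "range (\<lambda>a. ?A a)", rotated])
        (use Z in \<open>auto simp: Z_def\<close>)
    have "I \<mu> \<in> ?A (u (I \<mu>) - 1)" using \<mu>(2)[of "?A (u (I \<mu>) - 1)"] le by simp
    then show False by simp
  qed
  have bdd: "bdd_below {a. x \<in> Z a}" if x: "x \<in> M" for x
  proof -
    obtain a0 where a0: "x \<notin> Z a0" using below[OF x] by blast
    have "a0 \<le> a" if "x \<in> Z a" for a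
    proof (rule ccontr)
      assume "\<not> a0 \<le> a"
      then have "Z a \<subseteq> Z a0" by (intro Zmono) simp
      then show False using that a0 by blast
    qed
    then show ?thesis by (intro bdd_belowI[of _ a0]) simp
  qed
  have f_le: "f x \<le> a" if "x \<in> M" "x \<in> Z a" for x a
    unfolding f_def using that by (intro cInf_lower bdd) auto
  have f_ge: "b \<le> f x" if "x \<in> M" "x \<in> W b" for x b
    unfolding f_def
  proof (rule cInf_greatest)
    show "{a. x \<in> Z a} \<noteq> {}" using above[OF that(1)] by blast
    show "b \<le> a" if "a \<in> {a. x \<in> Z a}" for a using disjoint[of x a b] that \<open>x \<in> W b\<close> by fastforce
  qed
  have f_less: "\<exists>a<t. x \<in> Z a" if "x \<in> M" "f x < t" for x t
  proof -
    have "{a. x \<in> Z a} \<noteq> {}" using above[OF that(1)] by blast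
    then show ?thesis using cInf_lessD[of "{a. x \<in> Z a}" t] that(2) unfolding f_def by blast
  qed
  have cl: "closedin K (Z a)" "closedin K (W a)" for a
    unfolding Z_def W_def by (rule closedin_zeros_ker)+
  have op: "openin KM (M - C)" if "closedin K C" for C
  proof -
    have "openin K (topspace K - C)" using that by (simp add: closedin_def)
    moreover have "M - C = (topspace K - C) \<inter> M" using M_subset by blast
    ultimately show ?thesis unfolding openin_subtopology by blast
  qed
  have "continuous_map KM euclideanreal f"
    unfolding continuous_map_upper_lower_semicontinuous_lt topspace_M
  proof (intro conjI allI)
    fix t
    show "openin KM {x \<in> M. t < f x}"
    proof (subst openin_subopen, intro ballI)
      fix x assume x: "x \<in> {x \<in> M. t < f x}"
      then obtain a where a: "t < a" "a < f x" using dense by blast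
      have "x \<notin> Z a" using f_le[of x a] x a by auto
      \<comment> \<open>Outside \<open>Z a\<close> a point of \<open>M\<close> lies in
        \<open>W a\<close>, where \<open>f\<close> is at least \<open>a\<close>.\<close>
      moreover have "M - Z a \<subseteq> {x \<in> M. t < f x}"
        using cover f_ge a(1) by fastforce
      ultimately show "\<exists>T. openin KM T \<and> x \<in> T \<and> T \<subseteq> {x \<in> M. t < f x}"
        using op[OF cl(1)] x by blast
    qed
    show "openin KM {x \<in> M. f x < t}"
    proof (subst openin_subopen, intro ballI)
      fix x assume x: "x \<in> {x \<in> M. f x < t}"
      then obtain a where a: "a < t" "x \<in> Z a" using f_less by blast
      obtain b where b: "a < b" "b < t" using dense[OF a(1)] by blast
      have "x \<notin> W b" using disjoint a(2) b(1) by blast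
      moreover have "M - W b \<subseteq> {x \<in> M. f x < t}"
        using cover f_le b(2) by fastforce
      ultimately show "\<exists>T. openin KM T \<and> x \<in> T \<and> T \<subseteq> {x \<in> M. f x < t}"
        using op[OF cl(2)] x by blast
    qed
  qed
  \<comment> \<open>A common zero of \<open>I \<mu>\<close> lies in both \<open>Z\<close> and
    \<open>W\<close> at the level \<open>u (I \<mu>)\<close>, which bounds \<open>f x\<close> from
    both sides.\<close>
  moreover have "f x = u (I \<mu>)" if \<mu>: "\<mu> \<in> ergodic" and x: "x \<in> zeros (I \<mu>)" for \<mu> x
  proof -
    have in_zeros: "x \<in> zset A" if "I \<mu> \<in> A" for A
      using ker_subset[OF that] x by (auto simp: zeros_def)
    have "x \<in> Z (u (I \<mu>))" unfolding Z_def by (rule in_zeros) (simp add: Prim_I[OF \<mu>])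
    moreover have "x \<in> W (u (I \<mu>))" unfolding W_def by (rule in_zeros) (simp add: Prim_I[OF \<mu>])
    moreover have "x \<in> M" unfolding Msupp_eq rad_def by (rule in_zeros[OF Prim_I[OF \<mu>]])
    ultimately show ?thesis by (intro antisym f_le f_ge)
  qed
  ultimately show thesis using that by blast
qed

lemma hat_surj:
  assumes \<phi>: "\<phi> \<in> Cfun primtop"
  shows "\<exists>f\<in>Fix. Hat f = \<phi>"
proof -
  have cl: "hk {p \<in> PrimS. \<phi> p \<in> C} = {p \<in> PrimS. \<phi> p \<in> C}" if "closed C" for C
    using closedin_continuous_map_preimage[OF Cfun_continuous[OF \<phi>], of C] that
    by (simp add: topspace_prim closedin_prim)
  have Re: "hk {p \<in> PrimS. Re (\<phi> p) \<le> a} = {p \<in> PrimS. Re (\<phi> p) \<le> a}"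
    "hk {p \<in> PrimS. a \<le> Re (\<phi> p)} = {p \<in> PrimS. a \<le> Re (\<phi> p)}" for a
    using cl[OF closed_halfspace_Re_le, of a] cl[OF closed_halfspace_Re_ge, of a] by simp_all
  have Im: "hk {p \<in> PrimS. Im (\<phi> p) \<le> a} = {p \<in> PrimS. Im (\<phi> p) \<le> a}"
    "hk {p \<in> PrimS. a \<le> Im (\<phi> p)} = {p \<in> PrimS. a \<le> Im (\<phi> p)}" for a
    using cl[OF closed_halfspace_Im_le, of a] cl[OF closed_halfspace_Im_ge, of a] by simp_all
  obtain g where g: "continuous_map KM euclideanreal g"
    "\<And>\<mu> x. \<mu> \<in> ergodic \<Longrightarrow> x \<in> zeros (I \<mu>) \<Longrightarrow> g x = Re (\<phi> (I \<mu>))"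
    by (rule real_function_lift[of "\<lambda>p. Re (\<phi> p)", OF Re]) blast
  obtain h where h: "continuous_map KM euclideanreal h"
    "\<And>\<mu> x. \<mu> \<in> ergodic \<Longrightarrow> x \<in> zeros (I \<mu>) \<Longrightarrow> h x = Im (\<phi> (I \<mu>))"
    by (rule real_function_lift[of "\<lambda>p. Im (\<phi> p)", OF Im]) blast
  let ?f = "\<lambda>x. cplx KM g x + \<i> * cplx KM h x"
  have fC: "?f \<in> Cfun KM" by (intro Cfun_add Cfun_cmult cplx_in_Cfun g h)
  have ae: "AE x in \<mu>. ?f x = \<phi> (I \<mu>)" if \<mu>: "\<mu> \<in> ergodic" for \<mu>
  proof -
    interpret regular_measure K \<mu> by (rule ergodic_regular[OF \<mu>])
    \<comment> \<open>The lifted functions are known exactly on the zero set of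
      \<open>I \<mu>\<close>, which is conull by regularity.\<close>
    have "AE x in \<mu>. x \<in> zeros (I \<mu>)"
      by (rule AE_zeros) (auto simp: null_ideal_iff[OF \<mu>])
    then show ?thesis using AE_M[OF \<mu>]
    proof eventually_elim
      case (elim x)
      have "cplx KM v x = of_real (v x)" for v using elim(2) unfolding cplx_def topspace_M by simp
      then show ?case using g(2)[OF \<mu> elim(1)] h(2)[OF \<mu> elim(1)] by (simp flip: complex_eq)
    qed
  qed
  have fixed: "?f \<in> Fix" using fC ae unfolding rad_fix_iff AE_const_def by blast
  moreover have "Hat ?f = \<phi>"
    by (rule hat_ext[OF fixed ae]) (use Cfun_off[OF \<phi>] in \<open>simp_all add: topspace_prim\<close>)
  ultimately show ?thesis by blast
qed

lemma hat_markov_lattice_iso: "markov_lattice_iso KM (Fix) primtop (Hat)"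
  unfolding markov_lattice_iso_def clinear_op_on_def bij_betw_def
proof (intro conjI ballI allI)
  show "inj_on (Hat) (Fix)" using hat_inj by (rule inj_onI)
  show "Hat ` Fix = Cfun primtop" using hat_Cfun hat_surj by blast
  show "Hat (\<lambda>x. c * f x) = (\<lambda>p. c * Hat f p)" if "f \<in> Fix" for c f
    using that by (rule fix_compose(2)) (auto intro!: continuous_intros)
  show "Hat (modulus f) = modulus (Hat f)" if "f \<in> Fix" for f
    unfolding modulus_def using that by (rule fix_compose(2)) (auto intro!: continuous_intros)
qed (use fix_add(2) fix_one in blast)+

end

theorem theorem6p5:
  fixes K :: "'a topology" and \<S> :: "'a oper set"
  assumes "compact_space K" and "Hausdorff_space K"
    and "markov_semigroup K \<S>" and "right_amenable K \<S>"
  shows "banach_sublattice (Mtop K \<S>) (rad_fix K \<S>)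
    \<and> (\<forall>f\<in>rad_fix K \<S>. \<forall>\<mu>\<in>ergodic_measures K \<S>.
          hat K \<S> f (null_ideal K \<mu>) = set_lebesgue_integral \<mu> (Msupp K \<S>) f)
    \<and> markov_lattice_iso (Mtop K \<S>) (rad_fix K \<S>) (prim_topology K \<S>) (hat K \<S>)
    \<and> (\<forall>f\<in>rad_fix K \<S>. supnorm (prim_topology K \<S>) (hat K \<S> f) = supnorm (Mtop K \<S>) f)"
proof -
  interpret amenable_system K \<S> by unfold_locales (fact assms)+
  have "hat K \<S> f (null_ideal K \<mu>) = set_lebesgue_integral \<mu> (Msupp K \<S>) f"
    if f: "f \<in> rad_fix K \<S>" and \<mu>: "\<mu> \<in> ergodic" for f \<mu>
    using set_integral_const[OF _ \<mu> AE_hat[OF f \<mu>]] f by (simp add: rad_fix_iff)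
  then show ?thesis using banach_sublattice_fix hat_markov_lattice_iso hat_isometric by blast
qed

end
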